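(* (i) There exists at least one solution of Problem $\mathrm{VE}_h$, and the velocity part $u_h$ is unique. (ii) If $(u_h,p_h,\lambda_h)$ and $(u_h,p_h^*,\lambda_h^* )$ are two solutions of Problem $\mathrm{VE}_h$, then there exists a unique $\delta_h\in\mathbf R$ such that $$p_h=p_h^*+\delta_h\qquad\text{and}\qquad\lambda_h(M)=\lambda_h^*(M)+\frac{\delta_h}{g(M)}\quad(\forall M\in\mathring\Gamma_{1,h}).$$ (iii) If $(u_h,p_h,\lambda_h)$ and $(u_h,p_h^*,\lambda_h^* )$ are two solutions of Problem $\mathrm{VE}_h$ and $u_{hn}\ne0$ on $\Gamma_1$ (that is, $u_{hn}$ is not identically zero on $\Gamma_1$), then the constant $\delta_h$ in (ii) equals $0$; namely, the solution of Problem $\mathrm{VE}_h$ is unique.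
   Context: Geometry. $\Omega\subset\mathbf R^2$ is a bounded polygonal domain with boundary $\Gamma=\partial\Omega=\overline\Gamma_0\cup\overline\Gamma_1$, where $\Gamma_0,\Gamma_1$ are disjoint nonempty relatively open subsets of $\Gamma$ and $\overline\Gamma_1$ is exactly one whole side of the polygon, with endpoints $M_1,M_{m+1}$. On $\Gamma_1$, $n=(n_1,n_2)$ is the (constant) outer unit normal and $\tau=(n_2,-n_1)$; for a vector field $v$, $v_n=v\cdot n$, $v_\tau=v\cdot\tau$ on $\Gamma_1$ (and $v_{hn}$, $v_{h\tau}$ for $v_h$). Data. $\nu>0$, $f\in L^2(\Omega)^2$, $g\in C^0(\overline\Gamma_1)$ with $g>0$ on $\Gamma_1$. Mesh. $\{\mathscr T_h\}_h$ is a family of triangulations of $\overline\Omega$, $h$ being the length of the greatest side, such that: two distinct triangles meet in a side, a node or $\emptyset$; the triangles cover $\overline\Omega$ and the boundary vertices belong to $\Gamma$; for some constants $K,K'>0$ independent of $h$ each triangle contains a circle of radius $Kh$ and is contained in a circle of radius $K'h$; each triangle has at least one vertex not on $\Gamma$. $\Sigma_h$ is the set of all vertices and all midpoints of sides of triangles. $\Gamma_{0,h}=\overline\Gamma_0\cap\Sigma_h$, $\overline\Gamma_1\cap\Sigma_h=\{M_1,M_{3/2},M_2,\dots,M_{m+1/2},M_{m+1}\}$, where $M_1,\dots,M_{m+1}$ are the vertices on $\overline\Gamma_1$ in order along $\overline\Gamma_1$ ($m$ depends on $h$) and $M_{i+1/2}$ is the midpoint of $e_i=[M_i,M_{i+1}]$,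 of length $|e_i|$; $\mathring\Gamma_{1,h}=\Gamma_1\cap\Sigma_h$. Spaces ($\mathscr P_k$ = polynomials of degree $\le k$). $V_h=\{v_h\in C^0(\overline\Omega)^2: v_h|_T\in\mathscr P_2(T)^2\ \forall T\in\mathscr T_h\}$, $Q_h=\{q_h\in C^0(\overline\Omega): q_h|_T\in\mathscr P_1(T)\ \forall T\in\mathscr T_h\}$, $V_{\tau h}=\{v_h\in V_h: v_h(M)=0\ \forall M\in\Gamma_{0,h},\ v_{h\tau}(M)=0\ \forall M\in\mathring\Gamma_{1,h}\}$. $\Lambda_h=\{\mu_h\in C^0(\overline\Gamma_1):\mu_h|_{e_i}\in\mathscr P_2(e_i)\ (1\le i\le m),\ \mu_h(M_1)=\mu_h(M_{m+1})=0\}$, $\tilde\Lambda_h=\{\mu_h\in\Lambda_h:|\mu_h(M)|\le1\ \forall M\in\mathring\Gamma_{1,h}\}$. Forms. $a(u,v)=2\nu\sum_{i,j=1}^2\int_\Omega e_{ij}(u)e_{ij}(v)\,dx$ with $e_{ij}(u)=\frac12(\partial u_i/\partial x_j+\partial u_j/\partial x_i)$; $b(v,q)=-\int_\Omega(\mathrm{div}\,v)q\,dx$. With $g_i=g(M_i)$, $\lambda_{h,i}=\lambda_h(M_i)$, etc. (also for half-integer indices), for $\lambda_h,\mu_h\in\Lambda_h$, $$(\lambda_h,\mu_h)_{\Lambda_h}=\frac16\sum_{i=1}^m|e_i|\big(g_i\lambda_{h,i}\mu_{h,i}+4g_{i+\frac12}\lambda_{h,i+\frac12}\mu_{h,i+\frac12}+g_{i+1}\lambda_{h,i+1}\mu_{h,i+1}\big).$$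 Problem $\mathrm{VE}_h$: find $(u_h,p_h,\lambda_h)\in V_{\tau h}\times Q_h\times\tilde\Lambda_h$ with $a(u_h,v_h)+b(v_h,p_h)+(v_{hn},\lambda_h)_{\Lambda_h}=(f,v_h)_{L^2(\Omega)^2}$ for all $v_h\in V_{\tau h}$, $b(u_h,q_h)=0$ for all $q_h\in Q_h$, and $(u_{hn},\mu_h-\lambda_h)_{\Lambda_h}\le0$ for all $\mu_h\in\tilde\Lambda_h$. *)

theory Defs
  imports "HOL-Analysis.Analysis"
begin

text \<open>Polygonal domains. A simple polygon is given by the cyclic list of its (genuine) corners.\<close>

definition polygon_side :: "(real^2) list \<Rightarrow> nat \<Rightarrow> (real^2) set" where
  "polygon_side vs i = closed_segment (vs ! i) (vs ! (Suc i mod length vs))"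

definition polygon_curve :: "(real^2) list \<Rightarrow> (real^2) set" where
  "polygon_curve vs = (\<Union>i<length vs. polygon_side vs i)"

definition simple_polygon :: "(real^2) list \<Rightarrow> bool" where
  "simple_polygon vs \<longleftrightarrow>
     3 \<le> length vs \<and> distinct vs \<and>
     (\<forall>i<length vs.
        \<not> collinear {vs ! i, vs ! ((i + 1) mod length vs), vs ! ((i + 2) mod length vs)}) \<and>
     (\<forall>i<length vs. \<forall>j<length vs. i \<noteq> j \<longrightarrow>
        polygon_side vs i \<inter> polygon_side vs j
          \<subseteq> {vs ! i, vs ! (Suc i mod length vs)} \<inter> {vs ! j, vs ! (Suc j mod length vs)})"

text \<open>The boundary consists of finitely many pairwise disjoint simple polygons, so that holes are
  allowed; the condition on the interior of the closure says that the domain lies on one side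
  of its boundary.\<close>

definition polygonal_domain :: "(real^2) set \<Rightarrow> (real^2) list set \<Rightarrow> bool" where
  "polygonal_domain \<Omega> Ps \<longleftrightarrow>
     \<Omega> \<noteq> {} \<and> open \<Omega> \<and> connected \<Omega> \<and> bounded \<Omega> \<and> interior (closure \<Omega>) = \<Omega> \<and>
     finite Ps \<and> (\<forall>vs\<in>Ps. simple_polygon vs) \<and>
     (\<forall>vs\<in>Ps. \<forall>ws\<in>Ps. vs \<noteq> ws \<longrightarrow> polygon_curve vs \<inter> polygon_curve ws = {}) \<and>
     frontier \<Omega> = (\<Union>vs\<in>Ps. polygon_curve vs)"

text \<open>The closure of \<open>\<Gamma>1\<close> is the whole side with endpoints \<open>A\<close> and \<open>B\<close>, and \<open>\<Gamma>1\<close> itself is that side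
  without its endpoints.\<close>

definition boundary_partition ::
  "(real^2) set \<Rightarrow> (real^2) list set \<Rightarrow> (real^2) set \<Rightarrow> (real^2) set \<Rightarrow> real^2 \<Rightarrow> real^2 \<Rightarrow> bool" where
  "boundary_partition \<Omega> Ps \<Gamma>0 \<Gamma>1 A B \<longleftrightarrow>
     \<Gamma>0 \<noteq> {} \<and> \<Gamma>1 \<noteq> {} \<and> \<Gamma>0 \<inter> \<Gamma>1 = {} \<and>
     openin (top_of_set (frontier \<Omega>)) \<Gamma>0 \<and> openin (top_of_set (frontier \<Omega>)) \<Gamma>1 \<and>
     frontier \<Omega> = closure \<Gamma>0 \<union> closure \<Gamma>1 \<and>
     (\<exists>vs\<in>Ps. \<exists>i<length vs. closed_segment A B = polygon_side vs i) \<and>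
     \<Gamma>1 = open_segment A B"

definition outer_unit_normal ::
  "(real^2) set \<Rightarrow> real^2 \<Rightarrow> real^2 \<Rightarrow> real^2 \<Rightarrow> bool" where
  "outer_unit_normal \<Omega> A B n \<longleftrightarrow>
     norm n = 1 \<and> n \<bullet> (B - A) = 0 \<and>
     (\<forall>x\<in>open_segment A B. \<exists>\<epsilon>>0. \<forall>t. 0 < t \<and> t < \<epsilon> \<longrightarrow>
        x - t *\<^sub>R n \<in> \<Omega> \<and> x + t *\<^sub>R n \<notin> closure \<Omega>)"

definition tangent :: "real^2 \<Rightarrow> real^2" where
  "tangent n = vector [n $ 2, - (n $ 1)]"

definition L2_vec :: "(real^2) set \<Rightarrow> (real^2 \<Rightarrow> real^2) \<Rightarrow> bool" where
  "L2_vec \<Omega> f \<longleftrightarrow>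
     f \<in> borel_measurable (lebesgue_on \<Omega>) \<and> integrable (lebesgue_on \<Omega>) (\<lambda>x. (norm (f x))\<^sup>2)"

text \<open>Triangulations. A mesh is a set of closed triangles.\<close>

definition mesh_vertices :: "(real^2) set set \<Rightarrow> (real^2) set" where
  "mesh_vertices \<T> = {v. \<exists>T\<in>\<T>. v extreme_point_of T}"

definition mesh_nodes :: "(real^2) set set \<Rightarrow> (real^2) set" where
  "mesh_nodes \<T> = mesh_vertices \<T> \<union>
     {midpoint a b | a b. a \<noteq> b \<and> (\<exists>T\<in>\<T>. a extreme_point_of T \<and> b extreme_point_of T)}"

definition mesh_size :: "(real^2) set set \<Rightarrow> real" where
  "mesh_size \<T> =
     Max {dist a b | a b. \<exists>T\<in>\<T>. a extreme_point_of T \<and> b extreme_point_of T}"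

text \<open>The library's \<^const>\<open>triangulation\<close> contains finiteness and the requirement that any two cells
  meet in a common face, which may be empty, a vertex or a side.\<close>

definition mesh_of :: "(real^2) set \<Rightarrow> (real^2) set set \<Rightarrow> bool" where
  "mesh_of \<Omega> \<T> \<longleftrightarrow>
     triangulation \<T> \<and> (\<forall>T\<in>\<T>. 2 simplex T) \<and>
     \<Union>\<T> = closure \<Omega> \<and>
     mesh_vertices \<T> \<inter> frontier (\<Union>\<T>) \<subseteq> frontier \<Omega> \<and>
     (\<forall>T\<in>\<T>. \<exists>v. v extreme_point_of T \<and> v \<notin> frontier \<Omega>)"

definition mesh_family :: "(real^2) set \<Rightarrow> real set \<Rightarrow> (real \<Rightarrow> (real^2) set set) \<Rightarrow> bool" where
  "mesh_family \<Omega> H \<T> \<longleftrightarrow>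
     (\<forall>h\<in>H. mesh_of \<Omega> (\<T> h) \<and> mesh_size (\<T> h) = h) \<and>
     (\<exists>K>0. \<exists>K'>0. \<forall>h\<in>H. \<forall>T\<in>\<T> h.
        (\<exists>c. cball c (K * h) \<subseteq> T) \<and> (\<exists>c. T \<subseteq> cball c (K' * h)))"

text \<open>\<open>M 1, \<dots>, M (m + 1)\<close> are the mesh vertices on the side from \<open>A\<close> to \<open>B\<close>, in order; the half-integer
  nodes are \<open>Mhalf M i\<close>, standing for \<open>M\<close> at \<open>i + 1/2\<close>.\<close>

definition Mhalf :: "(nat \<Rightarrow> real^2) \<Rightarrow> nat \<Rightarrow> real^2" where
  "Mhalf M i = midpoint (M i) (M (i + 1))"

definition side_nodes ::
  "(real^2) set set \<Rightarrow> (real^2) set \<Rightarrow> real^2 \<Rightarrow> real^2 \<Rightarrow> nat \<Rightarrow> (nat \<Rightarrow> real^2) \<Rightarrow> bool" where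
  "side_nodes \<T> \<Gamma>1 A B m M \<longleftrightarrow>
     M 1 = A \<and> M (m + 1) = B \<and>
     closure \<Gamma>1 \<inter> mesh_vertices \<T> = M ` {1..m + 1} \<and>
     closure \<Gamma>1 \<inter> mesh_nodes \<T> = M ` {1..m + 1} \<union> Mhalf M ` {1..m} \<and>
     (\<forall>i j. 1 \<le> i \<and> i < j \<and> j \<le> m + 1 \<longrightarrow> dist A (M i) < dist A (M j))"

text \<open>Finite element spaces. Functions are total; their values outside the closure of the domain
  (for \<open>\<Lambda>\<^sub>h\<close>: outside the side) are irrelevant.\<close>

definition polys :: "nat \<Rightarrow> (real^2 \<Rightarrow> real) set" where
  "polys k = {p. \<exists>c :: nat \<Rightarrow> nat \<Rightarrow> real. \<forall>x.
     p x = (\<Sum>i\<le>k. \<Sum>j\<le>k - i. c i j * (x $ 1) ^ i * (x $ 2) ^ j)}"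

text \<open>On a segment, the restrictions of bivariate polynomials of degree at most \<open>k\<close> are exactly the
  polynomials of degree at most \<open>k\<close> in the arc length.\<close>

definition poly_on :: "nat \<Rightarrow> (real^2) set \<Rightarrow> (real^2 \<Rightarrow> real) \<Rightarrow> bool" where
  "poly_on k S q \<longleftrightarrow> (\<exists>p\<in>polys k. \<forall>x\<in>S. q x = p x)"

definition V_space :: "(real^2) set \<Rightarrow> (real^2) set set \<Rightarrow> (real^2 \<Rightarrow> real^2) set" where
  "V_space \<Omega> \<T> =
     {v. continuous_on (closure \<Omega>) v \<and> (\<forall>T\<in>\<T>. \<forall>i. poly_on 2 T (\<lambda>x. v x $ i))}"

definition Q_space :: "(real^2) set \<Rightarrow> (real^2) set set \<Rightarrow> (real^2 \<Rightarrow> real) set" where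
  "Q_space \<Omega> \<T> = {q. continuous_on (closure \<Omega>) q \<and> (\<forall>T\<in>\<T>. poly_on 1 T q)}"

definition V_tau_space ::
  "(real^2) set \<Rightarrow> (real^2) set \<Rightarrow> (real^2) set \<Rightarrow> real^2 \<Rightarrow> (real^2) set set
     \<Rightarrow> (real^2 \<Rightarrow> real^2) set" where
  "V_tau_space \<Omega> \<Gamma>0 \<Gamma>1 n \<T> =
     {v \<in> V_space \<Omega> \<T>.
        (\<forall>x \<in> closure \<Gamma>0 \<inter> mesh_nodes \<T>. v x = 0) \<and>
        (\<forall>x \<in> \<Gamma>1 \<inter> mesh_nodes \<T>. v x \<bullet> tangent n = 0)}"

definition Lambda_space ::
  "(real^2) set \<Rightarrow> nat \<Rightarrow> (nat \<Rightarrow> real^2) \<Rightarrow> (real^2 \<Rightarrow> real) set" where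
  "Lambda_space \<Gamma>1 m M =
     {\<mu>. continuous_on (closure \<Gamma>1) \<mu> \<and>
         (\<forall>i\<in>{1..m}. poly_on 2 (closed_segment (M i) (M (i + 1))) \<mu>) \<and>
         \<mu> (M 1) = 0 \<and> \<mu> (M (m + 1)) = 0}"

definition Lambda_tilde ::
  "(real^2) set \<Rightarrow> (real^2) set set \<Rightarrow> nat \<Rightarrow> (nat \<Rightarrow> real^2) \<Rightarrow> (real^2 \<Rightarrow> real) set" where
  "Lambda_tilde \<Gamma>1 \<T> m M =
     {\<mu> \<in> Lambda_space \<Gamma>1 m M. \<forall>x \<in> \<Gamma>1 \<inter> mesh_nodes \<T>. \<bar>\<mu> x\<bar> \<le> 1}"

text \<open>Forms. Elements of the finite element spaces are differentiable on the interiors of the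
  triangles, that is, almost everywhere; there the classical partial derivatives represent the weak
  ones. The value of \<open>frechet_derivative\<close> on the remaining null set is arbitrary and does not
  affect the integrals with respect to the (complete) Lebesgue measure.\<close>

definition pderiv_comp :: "(real^2 \<Rightarrow> real^2) \<Rightarrow> 2 \<Rightarrow> 2 \<Rightarrow> real^2 \<Rightarrow> real" where
  "pderiv_comp u i j x = frechet_derivative u (at x) (axis j 1) $ i"

definition strain :: "(real^2 \<Rightarrow> real^2) \<Rightarrow> 2 \<Rightarrow> 2 \<Rightarrow> real^2 \<Rightarrow> real" where
  "strain u i j x = (pderiv_comp u i j x + pderiv_comp u j i x) / 2"

definition divergence :: "(real^2 \<Rightarrow> real^2) \<Rightarrow> real^2 \<Rightarrow> real" where
  "divergence u x = (\<Sum>i\<in>UNIV. pderiv_comp u i i x)"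

definition form_a ::
  "real \<Rightarrow> (real^2) set \<Rightarrow> (real^2 \<Rightarrow> real^2) \<Rightarrow> (real^2 \<Rightarrow> real^2) \<Rightarrow> real" where
  "form_a \<nu> \<Omega> u v =
     2 * \<nu> * (\<Sum>i\<in>UNIV. \<Sum>j\<in>UNIV. LINT x|lebesgue_on \<Omega>. strain u i j x * strain v i j x)"

definition form_b :: "(real^2) set \<Rightarrow> (real^2 \<Rightarrow> real^2) \<Rightarrow> (real^2 \<Rightarrow> real) \<Rightarrow> real" where
  "form_b \<Omega> v q = - (LINT x|lebesgue_on \<Omega>. divergence v x * q x)"

definition L2_inner ::
  "(real^2) set \<Rightarrow> (real^2 \<Rightarrow> real^2) \<Rightarrow> (real^2 \<Rightarrow> real^2) \<Rightarrow> real" where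
  "L2_inner \<Omega> f v = (LINT x|lebesgue_on \<Omega>. f x \<bullet> v x)"

definition form_Lambda ::
  "(real^2 \<Rightarrow> real) \<Rightarrow> nat \<Rightarrow> (nat \<Rightarrow> real^2) \<Rightarrow> (real^2 \<Rightarrow> real) \<Rightarrow> (real^2 \<Rightarrow> real) \<Rightarrow> real" where
  "form_Lambda g m M \<eta> \<mu> = 1 / 6 * (\<Sum>i = 1..m. dist (M i) (M (i + 1)) *
     (g (M i) * \<eta> (M i) * \<mu> (M i)
      + 4 * g (Mhalf M i) * \<eta> (Mhalf M i) * \<mu> (Mhalf M i)
      + g (M (i + 1)) * \<eta> (M (i + 1)) * \<mu> (M (i + 1))))"

definition VE_solution ::
  "(real^2) set \<Rightarrow> (real^2) set \<Rightarrow> (real^2) set \<Rightarrow> real^2 \<Rightarrow>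
   real \<Rightarrow> (real^2 \<Rightarrow> real^2) \<Rightarrow> (real^2 \<Rightarrow> real) \<Rightarrow>
   (real^2) set set \<Rightarrow> nat \<Rightarrow> (nat \<Rightarrow> real^2) \<Rightarrow>
   (real^2 \<Rightarrow> real^2) \<Rightarrow> (real^2 \<Rightarrow> real) \<Rightarrow> (real^2 \<Rightarrow> real) \<Rightarrow> bool" where
  "VE_solution \<Omega> \<Gamma>0 \<Gamma>1 n \<nu> f g \<T> m M u p \<eta> \<longleftrightarrow>
     u \<in> V_tau_space \<Omega> \<Gamma>0 \<Gamma>1 n \<T> \<and> p \<in> Q_space \<Omega> \<T> \<and> \<eta> \<in> Lambda_tilde \<Gamma>1 \<T> m M \<and>
     (\<forall>v \<in> V_tau_space \<Omega> \<Gamma>0 \<Gamma>1 n \<T>.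
        form_a \<nu> \<Omega> u v + form_b \<Omega> v p + form_Lambda g m M (\<lambda>x. v x \<bullet> n) \<eta> = L2_inner \<Omega> f v) \<and>
     (\<forall>q \<in> Q_space \<Omega> \<T>. form_b \<Omega> u q = 0) \<and>
     (\<forall>\<mu> \<in> Lambda_tilde \<Gamma>1 \<T> m M.
        form_Lambda g m M (\<lambda>x. u x \<bullet> n) (\<lambda>x. \<mu> x - \<eta> x) \<le> 0)"

definition shift_relation ::
  "(real^2) set \<Rightarrow> (real^2) set \<Rightarrow> (real^2 \<Rightarrow> real) \<Rightarrow> (real^2) set set \<Rightarrow>
   (real^2 \<Rightarrow> real) \<Rightarrow> (real^2 \<Rightarrow> real) \<Rightarrow> (real^2 \<Rightarrow> real) \<Rightarrow> (real^2 \<Rightarrow> real) \<Rightarrow> real \<Rightarrow> bool" where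
  "shift_relation \<Omega> \<Gamma>1 g \<T> p \<eta> p' \<eta>' \<delta> \<longleftrightarrow>
     (\<forall>x \<in> closure \<Omega>. p x = p' x + \<delta>) \<and>
     (\<forall>x \<in> \<Gamma>1 \<inter> mesh_nodes \<T>. \<eta> x = \<eta>' x + \<delta> / g x)"

end

theory Submission
  imports Defs
begin

text \<open>Only the finite-dimensional saddle point structure is needed. On the discrete space the strain form is
  definite: a velocity with vanishing strain is a rigid motion on every triangle, neighbouring triangles
  share two points, so it is one rigid motion on \<open>\<Omega>\<close>, and it vanishes at the corners \<open>A\<close> and \<open>B\<close>. By the
  Fredholm alternative the discrete Stokes problem is then solvable for every right hand side that tests
  the velocity only, although the pressure is not unique. Existence follows by minimizing the energy of the
  velocity over the compact cube of multipliers; uniqueness of the velocity is the usual monotonicity argument.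

  For the multipliers, let \<open>q\<close> be a difference of two pressures. Testing with the quadratic bubble of an
  interior edge times the direction of the edge gives equal values of \<open>q\<close> at the endpoints; as every
  triangle has a vertex in \<open>\<Omega>\<close>, the function \<open>q\<close> is a constant \<open>\<delta>\<close>. Testing with a nodal shape function times
  the normal, whose divergence integrates to the Simpson weight of the node, then yields the value
  \<open>\<delta> / g\<close> for the difference of the multipliers.\<close>

text \<open>A constant \<delta> added to the pressure acts on a velocity v as -\<delta> times the
  flux of v through \<Gamma>1. The normal component of v is quadratic on every edge, so the Simpson
  rule gives this flux exactly, and pairing v with \<delta>/g cancels it: hence the shift in (ii).
  The bound on the multiplier limits such a shift and, in (iii), forbids it: if the normal velocity
  is not identically zero on \<Gamma>1, it is nonzero at a node, and there the inequality forces
  every multiplier to be its sign. The flux is computed without a divergence theorem. Over one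
  triangle the divergence of a nodal function integrates to terms attached to edges, with the sign
  of the orientation, and these cancel between neighbours. The real work is therefore combinatorial:
  an edge inside \<Omega> has one triangle on either side, an edge on \<Gamma>1 has just one, and
  consecutive nodes \<open>M i\<close>, \<open>M (i + 1)\<close> do span an edge of the mesh. All
  this has to be extracted from the covering, from the condition that cells meet in faces, and from
  the position of \<Omega> on one side of its boundary.\<close>

section \<open>The Fredholm alternative for finite linear systems\<close>

text \<open>Induction on the columns. Either some y annihilates the columns in J but not column j0;
  pairing the system with y then dictates the new unknown, and column j0 moves to the right hand
  side. Or column j0 imposes no further condition on y, and its unknown is set to 0.\<close>

lemma fredholm_finite:
  fixes K :: "'i \<Rightarrow> 'j \<Rightarrow> real" and r :: "'i \<Rightarrow> real"
  assumes "finite J" "finite I"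
    and "\<And>y. (\<And>j. j \<in> J \<Longrightarrow> (\<Sum>i\<in>I. y i * K i j) = 0) \<Longrightarrow> (\<Sum>i\<in>I. y i * r i) = 0"
  shows "\<exists>x. \<forall>i\<in>I. (\<Sum>j\<in>J. K i j * x j) = r i"
  using assms(1,3)
proof (induction J arbitrary: r rule: finite_induct)
  case empty
  have "r k = 0" if "k \<in> I" for k
    using empty[of "\<lambda>i. of_bool (i = k)"] that \<open>finite I\<close> by simp
  then show ?case by simp
next
  case (insert j0 J)
  show ?case
  proof (cases "\<exists>y. (\<forall>j\<in>J. (\<Sum>i\<in>I. y i * K i j) = 0) \<and> (\<Sum>i\<in>I. y i * K i j0) \<noteq> 0")
    case True
    then obtain y where y: "\<And>j. j \<in> J \<Longrightarrow> (\<Sum>i\<in>I. y i * K i j) = 0" "(\<Sum>i\<in>I. y i * K i j0) \<noteq> 0"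
      by auto
    define t where "t = (\<Sum>i\<in>I. y i * r i) / (\<Sum>i\<in>I. y i * K i j0)"
    have "(\<Sum>i\<in>I. z i * (r i - t * K i j0)) = 0"
      if z: "\<And>j. j \<in> J \<Longrightarrow> (\<Sum>i\<in>I. z i * K i j) = 0" for z
    proof -
      \<comment> \<open>With this factor, \<open>z - s y\<close> annihilates column
        \<open>j0\<close> in addition to those of \<open>J\<close>, so the hypothesis applies to
        it.\<close>
      define s where "s = (\<Sum>i\<in>I. z i * K i j0) / (\<Sum>i\<in>I. y i * K i j0)"
      have e: "(\<Sum>i\<in>I. (z i - s * y i) * c i) = (\<Sum>i\<in>I. z i * c i) - s * (\<Sum>i\<in>I. y i * c i)" for c
        by (simp add: left_diff_distrib sum_subtractf sum_distrib_left mult.assoc)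
      have "(\<Sum>i\<in>I. (z i - s * y i) * r i) = 0"
        by (rule insert.prems, unfold e) (use y z in \<open>auto simp: s_def\<close>)
      moreover have "s * (\<Sum>i\<in>I. y i * r i) = t * (\<Sum>i\<in>I. z i * K i j0)"
        by (simp add: s_def t_def)
      ultimately show ?thesis
        by (simp add: e right_diff_distrib sum_subtractf sum_distrib_left mult.left_commute)
    qed
    from insert.IH[OF this] obtain x where x: "\<forall>i\<in>I. (\<Sum>j\<in>J. K i j * x j) = r i - t * K i j0"
      by auto
    have "(\<Sum>j\<in>J. K i j * (x(j0 := t)) j) = (\<Sum>j\<in>J. K i j * x j)" for i
      using insert.hyps by (intro sum.cong) auto
    with x insert.hyps show ?thesis
      by (intro exI[of _ "x(j0 := t)"]) auto
  next
    case False
    then have "\<exists>x. \<forall>i\<in>I. (\<Sum>j\<in>J. K i j * x j) = r i"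
      by (intro insert.IH insert.prems) auto
    then obtain x where x: "\<forall>i\<in>I. (\<Sum>j\<in>J. K i j * x j) = r i" by auto
    have "(\<Sum>j\<in>J. K i j * (x(j0 := 0)) j) = (\<Sum>j\<in>J. K i j * x j)" for i
      using insert.hyps by (intro sum.cong) auto
    with x insert.hyps show ?thesis
      by (intro exI[of _ "x(j0 := 0)"]) auto
  qed
qed

subsection \<open>Barycentric coordinates in the plane\<close>

definition cross2 :: "real^2 \<Rightarrow> real^2 \<Rightarrow> real" where
  "cross2 u v = u $ 1 * v $ 2 - u $ 2 * v $ 1"

text \<open>Twice the signed area of the triangle; the sign tells on which side of the line through
  a and b the point c lies.\<close>

definition orient :: "real^2 \<Rightarrow> real^2 \<Rightarrow> real^2 \<Rightarrow> real" where
  "orient a b c = cross2 (b - a) (c - a)"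

text \<open>The barycentric coordinate that belongs to the first vertex, as a quotient of areas. The
  coordinates of the other two vertices are written by rotation as \<open>bary b c a\<close> and
  \<open>bary c a b\<close>.\<close>

definition bary :: "real^2 \<Rightarrow> real^2 \<Rightarrow> real^2 \<Rightarrow> real^2 \<Rightarrow> real" where
  "bary a b c x = orient x b c / orient a b c"

lemma orient_rotate: "orient b c a = orient a b c"
  and orient_swap: "orient a c b = - orient a b c"
  by (simp_all add: orient_def cross2_def algebra_simps)

lemma bary_sum: "orient a b c \<noteq> 0 \<Longrightarrow> bary a b c x + bary b c a x + bary c a b x = 1"
  unfolding bary_def orient_rotate[of a b c] orient_rotate[of b c a, unfolded orient_rotate[of a b c]]
    add_divide_distrib[symmetric]
  by (simp, simp add: orient_def cross2_def algebra_simps)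

lemma bary_comb:
  assumes "orient a b c \<noteq> 0"
  shows "bary a b c x *\<^sub>R a + bary b c a x *\<^sub>R b + bary c a b x *\<^sub>R c = x"
proof -
  have "orient x b c *\<^sub>R a + orient x c a *\<^sub>R b + orient x a b *\<^sub>R c = orient a b c *\<^sub>R x"
    by (simp add: vec_eq_iff forall_2 orient_def cross2_def algebra_simps)
  then have "(1 / orient a b c) *\<^sub>R (orient x b c *\<^sub>R a + orient x c a *\<^sub>R b + orient x a b *\<^sub>R c) = x"
    using assms by simp
  then show ?thesis
    unfolding bary_def orient_rotate[of a b c] orient_rotate[of b c a, unfolded orient_rotate[of a b c]]
    by (simp add: scaleR_right_distrib)
qed

lemma bary_of_comb:
  assumes "orient a b c \<noteq> 0" "u + v + w = 1"
  shows "bary a b c (u *\<^sub>R a + v *\<^sub>R b + w *\<^sub>R c) = u"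
proof -
  have u: "u = 1 - v - w" using assms by simp
  have "orient (u *\<^sub>R a + v *\<^sub>R b + w *\<^sub>R c) b c = u * orient a b c"
    unfolding u by (simp add: orient_def cross2_def algebra_simps)
  then show ?thesis using assms by (simp add: bary_def)
qed

lemma bary_vertex:
  assumes "orient a b c \<noteq> 0"
  shows "bary a b c a = 1" "bary a b c b = 0" "bary a b c c = 0"
  using assms by (simp_all add: bary_def) (simp_all add: orient_def cross2_def)

text \<open>The increment is the constant derivative of the coordinate in direction w. All gradients
  in the sequel are expressed through it.\<close>

lemma bary_add: "bary a b c (x + w) = bary a b c x + cross2 w (b - c) / orient a b c"
  by (simp add: bary_def add_divide_distrib[symmetric])
    (simp add: orient_def cross2_def algebra_simps)

lemma in_triangle_iff:
  assumes "orient a b c \<noteq> 0"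
  shows "x \<in> convex hull {a, b, c} \<longleftrightarrow> 0 \<le> bary a b c x \<and> 0 \<le> bary b c a x \<and> 0 \<le> bary c a b x"
    (is "?L \<longleftrightarrow> ?R")
proof
  assume ?L
  then obtain u v w where x: "x = u *\<^sub>R a + v *\<^sub>R b + w *\<^sub>R c" "0 \<le> u" "0 \<le> v" "0 \<le> w" "u + v + w = 1"
    unfolding convex_hull_3 by auto
  have "bary a b c x = u" "bary b c a x = v" "bary c a b x = w"
    using bary_of_comb[of a b c u v w] bary_of_comb[of b c a v w u] bary_of_comb[of c a b w u v] x assms
      orient_rotate[of a b c] orient_rotate[of b c a]
    by (simp_all add: algebra_simps)
  with x show ?R by simp
next
  assume ?R
  then show ?L
    unfolding convex_hull_3 mem_Collect_eq
    using bary_comb[OF assms, of x, symmetric] bary_sum[OF assms, of x] by blast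
qed

lemma continuous_on_bary [continuous_intros]: "continuous_on S (bary a b c)"
  unfolding bary_def orient_def cross2_def divide_inverse by (intro continuous_intros)

lemma in_interior_triangle:
  assumes "orient a b c \<noteq> 0" "0 < bary a b c x" "0 < bary b c a x" "0 < bary c a b x"
  shows "x \<in> interior (convex hull {a, b, c})"
proof (rule interiorI)
  show "open {x. 0 < bary a b c x \<and> 0 < bary b c a x \<and> 0 < bary c a b x}"
    by (intro open_Collect_conj open_Collect_less continuous_on_bary continuous_on_const)
  show "{x. 0 < bary a b c x \<and> 0 < bary b c a x \<and> 0 < bary c a b x} \<subseteq> convex hull {a, b, c}"
    unfolding subset_iff in_triangle_iff[OF assms(1)] by simp
  show "x \<in> {x. 0 < bary a b c x \<and> 0 < bary b c a x \<and> 0 < bary c a b x}"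
    using assms by simp
qed

lemma orient_eq_0_imp_collinear:
  assumes "orient a b c = 0"
  shows "collinear {a, b, c}"
proof (cases "b = a")
  case False
  define d where "d = b - a"
  have d: "d \<bullet> d \<noteq> 0" using False by (simp add: d_def)
  have c: "d $ 1 * (c - a) $ 2 = d $ 2 * (c - a) $ 1"
    using assms by (simp add: orient_def cross2_def d_def)
  have "(d \<bullet> d) *\<^sub>R (c - a) = ((c - a) \<bullet> d) *\<^sub>R d"
    unfolding vec_eq_iff forall_2 inner_vec_def sum_2 vector_scaleR_component inner_real_def real_scaleR_def
    using c by algebra
  then have "c - a = ((c - a) \<bullet> d / (d \<bullet> d)) *\<^sub>R d"
    using d by (metis divide_inverse_commute right_inverse scaleR_one scaleR_scaleR mult.commute)
  then have "collinear {0, b - a, c - a}"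
    unfolding collinear_lemma d_def by blast
  then show ?thesis
    using collinear_3[of b a c] by (simp add: insert_commute)
qed simp

lemma simplex_2_triangle:
  fixes T :: "(real^2) set"
  assumes "2 simplex T"
  obtains a b c where "T = convex hull {a, b, c}" "orient a b c \<noteq> 0"
    "{v. v extreme_point_of T} = {a, b, c}"
proof -
  from assms obtain C where C: "\<not> affine_dependent C" "int (card C) = 2 + 1" "T = convex hull C"
    unfolding simplex_def by blast
  then have "card C = 3" by simp
  then obtain a b c where abc: "C = {a, b, c}" "a \<noteq> b" "b \<noteq> c" "a \<noteq> c"
    by (auto simp: card_3_iff)
  have "\<not> collinear {a, b, c}"
    using C abc collinear_3_eq_affine_dependent by blast
  then have "orient a b c \<noteq> 0" using orient_eq_0_imp_collinear by blast
  moreover have "{v. v extreme_point_of T} = {a, b, c}"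
    using extreme_point_of_convex_hull_affine_independent[OF C(1)] C(3) abc by auto
  ultimately show ?thesis using that C abc by blast
qed

subsection \<open>Polynomials of low degree\<close>

lemma polys_1_iff: "q \<in> polys 1 \<longleftrightarrow> (\<exists>\<alpha> \<beta>. q = (\<lambda>x. \<alpha> + \<beta> \<bullet> x))"
proof
  assume "q \<in> polys 1"
  then obtain c where "q = (\<lambda>x. \<Sum>i\<le>1. \<Sum>j\<le>1 - i. c i j * (x $ 1) ^ i * (x $ 2) ^ j)"
    unfolding polys_def by auto
  then have "q = (\<lambda>x. c 0 0 + (vector [c 1 0, c 0 1] :: real^2) \<bullet> x)"
    by (auto simp: inner_vec_def sum_2)
  then show "\<exists>\<alpha> \<beta>. q = (\<lambda>x. \<alpha> + \<beta> \<bullet> x)" by blast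
next
  assume "\<exists>\<alpha> \<beta>. q = (\<lambda>x. \<alpha> + \<beta> \<bullet> x)"
  then obtain \<alpha> \<beta> where q: "q = (\<lambda>x. \<alpha> + \<beta> \<bullet> x)" by blast
  define c :: "nat \<Rightarrow> nat \<Rightarrow> real" where
    "c i j = (if i = 0 then (if j = 0 then \<alpha> else \<beta> $ 2) else \<beta> $ 1)" for i j
  have "q x = (\<Sum>i\<le>1. \<Sum>j\<le>1 - i. c i j * (x $ 1) ^ i * (x $ 2) ^ j)" for x
    by (auto simp: q c_def inner_vec_def sum_2)
  then show "q \<in> polys 1" unfolding polys_def by blast
qed

lemma polys_2_iff: "q \<in> polys 2 \<longleftrightarrow> (\<exists>c0 c1 c2 c3 c4 c5.
    q = (\<lambda>x. c0 + c1 * x $ 1 + c2 * x $ 2 + c3 * (x $ 1)\<^sup>2 + c4 * (x $ 1 * x $ 2) + c5 * (x $ 2)\<^sup>2))"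
    (is "_ \<longleftrightarrow> ?R")
proof
  assume "q \<in> polys 2"
  then obtain c where "q = (\<lambda>x. \<Sum>i\<le>2. \<Sum>j\<le>2 - i. c i j * (x $ 1) ^ i * (x $ 2) ^ j)"
    unfolding polys_def by auto
  then have "q = (\<lambda>x. c 0 0 + c 1 0 * x $ 1 + c 0 1 * x $ 2 + c 2 0 * (x $ 1)\<^sup>2
      + c 1 1 * (x $ 1 * x $ 2) + c 0 2 * (x $ 2)\<^sup>2)"
    by (auto simp: numeral_2_eq_2)
  then show ?R by blast
next
  assume ?R
  then obtain c0 c1 c2 c3 c4 c5 where q:
    "q = (\<lambda>x. c0 + c1 * x $ 1 + c2 * x $ 2 + c3 * (x $ 1)\<^sup>2 + c4 * (x $ 1 * x $ 2) + c5 * (x $ 2)\<^sup>2)"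
    by blast
  define c :: "nat \<Rightarrow> nat \<Rightarrow> real" where
    "c i j = (if i = 0 then (if j = 0 then c0 else if j = 1 then c2 else c5)
       else if i = 1 then (if j = 0 then c1 else c4) else c3)" for i j
  have "q x = (\<Sum>i\<le>2. \<Sum>j\<le>2 - i. c i j * (x $ 1) ^ i * (x $ 2) ^ j)" for x
    by (auto simp: q c_def numeral_2_eq_2)
  then show "q \<in> polys 2" unfolding polys_def by blast
qed

lemma polys_add: "p \<in> polys k \<Longrightarrow> q \<in> polys k \<Longrightarrow> (\<lambda>x. p x + q x) \<in> polys k"
proof -
  assume "p \<in> polys k" "q \<in> polys k"
  then obtain c d where
    "\<And>x. p x = (\<Sum>i\<le>k. \<Sum>j\<le>k - i. c i j * (x $ 1) ^ i * (x $ 2) ^ j)"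
    "\<And>x. q x = (\<Sum>i\<le>k. \<Sum>j\<le>k - i. d i j * (x $ 1) ^ i * (x $ 2) ^ j)"
    unfolding polys_def by auto
  then have "p x + q x = (\<Sum>i\<le>k. \<Sum>j\<le>k - i. (c i j + d i j) * (x $ 1) ^ i * (x $ 2) ^ j)" for x
    by (simp add: sum.distrib[symmetric] distrib_right)
  then show ?thesis unfolding polys_def by (auto intro: exI[of _ "\<lambda>i j. c i j + d i j"])
qed

lemma polys_scale: "p \<in> polys k \<Longrightarrow> (\<lambda>x. r * p x) \<in> polys k"
proof -
  assume "p \<in> polys k"
  then obtain c where
    "\<And>x. p x = (\<Sum>i\<le>k. \<Sum>j\<le>k - i. c i j * (x $ 1) ^ i * (x $ 2) ^ j)"
    unfolding polys_def by auto
  then have "r * p x = (\<Sum>i\<le>k. \<Sum>j\<le>k - i. (r * c i j) * (x $ 1) ^ i * (x $ 2) ^ j)" for x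
    by (simp add: sum_distrib_left mult.assoc)
  then show ?thesis unfolding polys_def by (auto intro: exI[of _ "\<lambda>i j. r * c i j"])
qed

lemma polys_mult: "p \<in> polys 1 \<Longrightarrow> q \<in> polys 1 \<Longrightarrow> (\<lambda>x. p x * q x) \<in> polys 2"
proof -
  assume "p \<in> polys 1" "q \<in> polys 1"
  then obtain \<alpha> \<beta> \<alpha>' \<beta>' where pq: "p = (\<lambda>x. \<alpha> + \<beta> \<bullet> x)" "q = (\<lambda>x. \<alpha>' + \<beta>' \<bullet> x)"
    unfolding polys_1_iff by blast
  have "(\<lambda>x. p x * q x) = (\<lambda>x. \<alpha> * \<alpha>' + (\<alpha> * \<beta>' $ 1 + \<alpha>' * \<beta> $ 1) * x $ 1 +
      (\<alpha> * \<beta>' $ 2 + \<alpha>' * \<beta> $ 2) * x $ 2 + (\<beta> $ 1 * \<beta>' $ 1) * (x $ 1)\<^sup>2 +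
      (\<beta> $ 1 * \<beta>' $ 2 + \<beta> $ 2 * \<beta>' $ 1) * (x $ 1 * x $ 2) + (\<beta> $ 2 * \<beta>' $ 2) * (x $ 2)\<^sup>2)"
    unfolding pq by (rule ext) (simp add: inner_vec_def sum_2 power2_eq_square algebra_simps)
  then show ?thesis unfolding polys_2_iff by blast
qed

lemma polys_1_subset_2: "p \<in> polys 1 \<Longrightarrow> p \<in> polys 2"
proof -
  have "(\<lambda>x. 1) \<in> polys 1"
    unfolding polys_1_iff by (rule exI[of _ 1], rule exI[of _ 0]) simp
  then show "p \<in> polys 1 \<Longrightarrow> p \<in> polys 2"
    using polys_mult[of p "\<lambda>x. 1"] by simp
qed

lemma poly_on_0: "poly_on k S (\<lambda>x. 0)"
  unfolding poly_on_def polys_def by (auto intro!: exI[of _ "\<lambda>x. 0"] exI[of _ "\<lambda>i j. 0"])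

lemma poly_on_add: "poly_on k S p \<Longrightarrow> poly_on k S q \<Longrightarrow> poly_on k S (\<lambda>x. p x + q x)"
  unfolding poly_on_def using polys_add by fastforce

lemma poly_on_scale: "poly_on k S p \<Longrightarrow> poly_on k S (\<lambda>x. r * p x)"
  unfolding poly_on_def using polys_scale by fastforce

lemma poly_on_mult: "poly_on 1 S p \<Longrightarrow> poly_on 1 S q \<Longrightarrow> poly_on 2 S (\<lambda>x. p x * q x)"
  unfolding poly_on_def using polys_mult by fastforce

lemma poly_on_sum: "(\<And>i. i \<in> I \<Longrightarrow> poly_on k S (p i)) \<Longrightarrow> poly_on k S (\<lambda>x. \<Sum>i\<in>I. p i x)"
  by (induction I rule: infinite_finite_induct) (auto intro: poly_on_0 poly_on_add)

lemma poly_on_mono: "poly_on k S p \<Longrightarrow> S' \<subseteq> S \<Longrightarrow> poly_on k S' p"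
  unfolding poly_on_def by blast

lemma bary_polys: "bary a b c \<in> polys 1"
proof -
  define d where "d = b - c"
  have "bary a b c = (\<lambda>x. bary a b c 0 +
      (vector [d $ 2 / orient a b c, - (d $ 1 / orient a b c)] :: real^2) \<bullet> x)"
  proof
    show "bary a b c x = bary a b c 0 +
      (vector [d $ 2 / orient a b c, - (d $ 1 / orient a b c)] :: real^2) \<bullet> x" for x
      unfolding bary_add[of a b c 0 x, folded d_def, unfolded add_0]
      by (simp add: inner_vec_def sum_2 cross2_def diff_divide_distrib mult.commute)
  qed
  then show ?thesis unfolding polys_1_iff by blast
qed

lemma polys_1_convex_comb:
  assumes "q \<in> polys 1" "u + v + w = 1"
  shows "q (u *\<^sub>R a + v *\<^sub>R b + w *\<^sub>R c) = u * q a + v * q b + w * q c"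
proof -
  obtain \<alpha> \<beta> where q: "q = (\<lambda>x. \<alpha> + \<beta> \<bullet> x)" using assms polys_1_iff by blast
  have u: "u = 1 - v - w" using assms by simp
  show ?thesis unfolding q u by (simp add: algebra_simps)
qed

text \<open>These are the six quadratic Lagrange functions of a triangle in barycentric form. By
  linearity in q it suffices to treat the monomials of degree 0, 1 and 2, which are
  \<open>e0\<close>, \<open>e1\<close> and \<open>e2\<close>. The points need not be in general
  position.\<close>

lemma polys_2_interpolation:
  assumes "q \<in> polys 2" "u + v + w = 1"
  shows "q (u *\<^sub>R a + v *\<^sub>R b + w *\<^sub>R c) =
    u * (2 * u - 1) * q a + v * (2 * v - 1) * q b + w * (2 * w - 1) * q c +
    4 * u * v * q (midpoint a b) + 4 * v * w * q (midpoint b c) + 4 * w * u * q (midpoint c a)"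
proof -
  obtain c0 c1 c2 c3 c4 c5 where q:
    "q = (\<lambda>x. c0 + c1 * x $ 1 + c2 * x $ 2 + c3 * (x $ 1)\<^sup>2 + c4 * (x $ 1 * x $ 2) + c5 * (x $ 2)\<^sup>2)"
    using assms polys_2_iff by blast
  define x where "x = u *\<^sub>R a + v *\<^sub>R b + w *\<^sub>R c"
  define d where "d = midpoint a b"
  define e where "e = midpoint b c"
  define f where "f = midpoint c a"
  define k1 where "k1 = u * (2 * u - 1)"
  define k2 where "k2 = v * (2 * v - 1)"
  define k3 where "k3 = w * (2 * w - 1)"
  define l1 where "l1 = 4 * u * v"
  define l2 where "l2 = 4 * v * w"
  define l3 where "l3 = 4 * w * u"
  note ks = k1_def k2_def k3_def l1_def l2_def l3_def
  have u: "u = 1 - v - w" using assms by simp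
  have e0: "k1 + k2 + k3 + l1 + l2 + l3 = 1"
    unfolding ks u by algebra
  have comp: "x $ i = u * a $ i + v * b $ i + w * c $ i"
    "2 * d $ i = a $ i + b $ i" "2 * e $ i = b $ i + c $ i" "2 * f $ i = c $ i + a $ i" for i
    by (simp_all add: x_def d_def e_def f_def midpoint_def)
  have e1: "k1 * a $ i + k2 * b $ i + k3 * c $ i + l1 * d $ i + l2 * e $ i + l3 * f $ i = x $ i" for i
    using comp[of i] unfolding ks u by algebra
  have e2: "k1 * (a $ i * a $ j) + k2 * (b $ i * b $ j) + k3 * (c $ i * c $ j) +
      l1 * (d $ i * d $ j) + l2 * (e $ i * e $ j) + l3 * (f $ i * f $ j) = x $ i * x $ j" for i j
  proof -
    have "4 * (d $ i * d $ j) = (a $ i + b $ i) * (a $ j + b $ j)"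
      "4 * (e $ i * e $ j) = (b $ i + c $ i) * (b $ j + c $ j)"
      "4 * (f $ i * f $ j) = (c $ i + a $ i) * (c $ j + a $ j)"
      unfolding comp[symmetric] by simp_all
    then have "l1 * (d $ i * d $ j) = u * v * ((a $ i + b $ i) * (a $ j + b $ j))"
      "l2 * (e $ i * e $ j) = v * w * ((b $ i + c $ i) * (b $ j + c $ j))"
      "l3 * (f $ i * f $ j) = w * u * ((c $ i + a $ i) * (c $ j + a $ j))"
      unfolding ks by simp_all
    then show ?thesis
      unfolding comp(1) k1_def k2_def k3_def u by (simp add: algebra_simps)
  qed
  have "q x = c0 * (k1 + k2 + k3 + l1 + l2 + l3) +
      c1 * (k1 * a $ 1 + k2 * b $ 1 + k3 * c $ 1 + l1 * d $ 1 + l2 * e $ 1 + l3 * f $ 1) +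
      c2 * (k1 * a $ 2 + k2 * b $ 2 + k3 * c $ 2 + l1 * d $ 2 + l2 * e $ 2 + l3 * f $ 2) +
      c3 * (k1 * (a $ 1 * a $ 1) + k2 * (b $ 1 * b $ 1) + k3 * (c $ 1 * c $ 1) +
        l1 * (d $ 1 * d $ 1) + l2 * (e $ 1 * e $ 1) + l3 * (f $ 1 * f $ 1)) +
      c4 * (k1 * (a $ 1 * a $ 2) + k2 * (b $ 1 * b $ 2) + k3 * (c $ 1 * c $ 2) +
        l1 * (d $ 1 * d $ 2) + l2 * (e $ 1 * e $ 2) + l3 * (f $ 1 * f $ 2)) +
      c5 * (k1 * (a $ 2 * a $ 2) + k2 * (b $ 2 * b $ 2) + k3 * (c $ 2 * c $ 2) +
        l1 * (d $ 2 * d $ 2) + l2 * (e $ 2 * e $ 2) + l3 * (f $ 2 * f $ 2))"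
    unfolding e0 e1 e2 q power2_eq_square mult_1_right ..
  also have "\<dots> = k1 * q a + k2 * q b + k3 * q c + l1 * q d + l2 * q e + l3 * q f"
    unfolding q power2_eq_square by (simp only: distrib_left distrib_right ac_simps)
  finally have "q x = k1 * q a + k2 * q b + k3 * q c + l1 * q d + l2 * q e + l3 * q f" .
  then show ?thesis
    unfolding x_def d_def e_def f_def ks .
qed

subsection \<open>Integrals over triangles\<close>

lemma integrable_lebesgue_on_compact:
  fixes f :: "'a::euclidean_space \<Rightarrow> real"
  assumes "compact S" "continuous_on S f"
  shows "integrable (lebesgue_on S) f"
proof -
  have "integrable lborel (\<lambda>x. indicator S x *\<^sub>R f x)"
    using assms by (rule borel_integrable_compact)
  then have "integrable lebesgue (\<lambda>x. indicator S x *\<^sub>R f x)"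
    by (simp add: integrable_completion)
  then show ?thesis
    using assms(1) by (subst integrable_restrict_space) (auto dest: compact_imp_closed)
qed

lemma measure_triangle: "measure lebesgue (convex hull {a, b, c}) = \<bar>orient a b c\<bar> / 2"
proof -
  have "(C $ 1 - A $ 1) * (B $ 2 - A $ 2) - (B $ 1 - A $ 1) * (C $ 2 - A $ 2) = - orient A B C" for A B C
    by (simp add: orient_def cross2_def algebra_simps)
  then show ?thesis
    using content_triangle[of a b c] by (simp add: measure_completion compact_imp_closed finite_imp_compact_convex_hull)
qed

text \<open>The affine involution that exchanges two vertices of a triangle and fixes the third one
  preserves area.\<close>

lemma triangle_swap_integral:
  fixes f :: "real^2 \<Rightarrow> real"
  assumes o: "orient a b c \<noteq> 0" and f: "continuous_on UNIV f"
  defines "s \<equiv> \<lambda>x. x + (bary a b c x - bary b c a x) *\<^sub>R (b - a)"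
  shows "(LINT x|lebesgue_on (convex hull {a, b, c}). f (s x)) = (LINT x|lebesgue_on (convex hull {a, b, c}). f x)"
    and "bary a b c (s x) = bary b c a x"
    and "bary b c a (s x) = bary a b c x"
    and "bary c a b (s x) = bary c a b x"
    and "continuous_on UNIV (\<lambda>x. f (s x))"
proof -
  let ?T = "convex hull {a, b, c}"
  have r: "orient b c a = orient a b c" "orient c a b = orient a b c"
    by (simp_all add: orient_def cross2_def algebra_simps)
  have cr: "cross2 (t *\<^sub>R (b - a)) (b - c) = - t * orient a b c"
    "cross2 (t *\<^sub>R (b - a)) (c - a) = t * orient a b c"
    "cross2 (t *\<^sub>R (b - a)) (a - b) = 0" for t
    by (simp_all add: orient_def cross2_def algebra_simps)
  show 1: "bary a b c (s x) = bary b c a x" for x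
    unfolding s_def bary_add cr using o by simp
  show 2: "bary b c a (s x) = bary a b c x" for x
    unfolding s_def bary_add cr r using o by simp
  show 3: "bary c a b (s x) = bary c a b x" for x
    unfolding s_def bary_add cr r using o by simp
  have ss: "s (s x) = x" for x
    unfolding s_def by (subst 1[unfolded s_def], subst 2[unfolded s_def]) (simp add: algebra_simps)
  have cs: "continuous_on A s" for A
    unfolding s_def by (intro continuous_intros)
  show fs: "continuous_on UNIV (\<lambda>x. f (s x))"
    by (rule continuous_on_compose2[OF f cs]) auto
  have sT: "s ` ?T = ?T"
  proof -
    have "s x \<in> ?T" if "x \<in> ?T" for x
      using that unfolding in_triangle_iff[OF o] 1 2 3 by auto
    then show ?thesis using ss by (metis image_eqI image_subsetI subsetI subset_antisym)
  qed
  have cT: "compact ?T" by (simp add: finite_imp_compact_convex_hull)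
  then have mT: "?T \<in> sets lebesgue" by (intro fmeasurableD lmeasurable_compact)
  \<comment> \<open>The map \<open>s\<close> is affine with linear part \<open>s'\<close>, the
    identity plus the rank one term \<open>k w *\<^sub>R (b - a)\<close>.\<close>
  define k where "k w = cross2 w (b - c) / orient a b c - cross2 w (c - a) / orient a b c" for w
  define s' where "s' w = w + k w *\<^sub>R (b - a)" for w
  have s_add: "s (x + w) = s x + s' w" for x w
    unfolding s_def s'_def k_def bary_add r by (simp add: algebra_simps)
  have lin: "linear s'"
  proof (rule linearI)
    have "cross2 (x + y) v = cross2 x v + cross2 y v" "cross2 (r *\<^sub>R x) v = r * cross2 x v" for r x y v
      by (simp_all add: cross2_def algebra_simps)
    then have "k (x + y) = k x + k y" "k (r *\<^sub>R x) = r * k x" for r x y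
      by (simp_all add: k_def add_divide_distrib right_diff_distrib)
    then show "s' (x + y) = s' x + s' y" "s' (r *\<^sub>R x) = r *\<^sub>R s' x" for r x y
      by (simp_all add: s'_def scaleR_add_left scaleR_add_right)
  qed
  have der: "(s has_derivative s') (at x within A)" for x A
  proof -
    have "s x - s' x + s' y = s y" for y
      using s_add[of x "y - x"] linear_diff[OF lin, of y x] by simp
    then have "(\<lambda>y. s x - s' x + s' y) = s" ..
    moreover have "((\<lambda>y. s x - s' x + s' y) has_derivative s') (at x within A)"
      by (rule has_derivative_add[OF has_derivative_const linear_imp_has_derivative[OF lin], simplified])
    ultimately show ?thesis by simp
  qed
  \<comment> \<open>Determinant of a rank one update of the identity; since
    \<open>k (b - a) = - 2\<close> it equals -1, as expected of a reflection.\<close>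
  have "det (matrix s') = 1 + k (b - a)"
  proof -
    define d where "d = b - a"
    have "matrix s' $ i $ j = of_bool (i = j) + k (axis j 1) * d $ i" for i j
      by (simp add: matrix_def s'_def axis_def d_def)
    moreover have "k d = d $ 1 * k (axis 1 1) + d $ 2 * k (axis 2 1)"
      by (simp add: k_def cross2_def axis_def add_divide_distrib diff_divide_distrib algebra_simps)
    ultimately show ?thesis
      unfolding d_def[symmetric] by (simp add: det_2 algebra_simps)
  qed
  also have "k (b - a) = - 2"
    using cr[of 1] o by (simp add: k_def)
  finally have det: "\<bar>det (matrix s')\<bar> = 1" by simp
  have inj: "inj_on s ?T" by (metis ss inj_onI)
  have "integrable (lebesgue_on ?T) f" and i2: "integrable (lebesgue_on ?T) (\<lambda>x. f (s x))"
    using f fs cT by (auto intro!: integrable_lebesgue_on_compact intro: continuous_on_subset)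
  then have e: "(LINT x|lebesgue_on ?T. f x) = integral ?T f"
      "(LINT x|lebesgue_on ?T. f (s x)) = integral ?T (\<lambda>x. f (s x))"
      "f absolutely_integrable_on ?T"
    using mT by (simp_all add: lebesgue_integral_eq_integral integrable_restrict_space set_integrable_def)
  \<comment> \<open>The change of variables theorem speaks of vector-valued functions, so f is
    regarded as a function into \<open>real^1\<close>.\<close>
  define F where "F x = (vec (f x) :: real^1)" for x
  have "integral ?T (\<lambda>x. f (s x)) = integral ?T f"
  proof -
    have "F absolutely_integrable_on ?T"
      using e(3) unfolding F_def absolutely_integrable_on_1_iff by simp
    moreover have "(\<lambda>x. \<bar>det (matrix s')\<bar> *\<^sub>R F (s x)) absolutely_integrable_on ?T \<and>
        integral ?T (\<lambda>x. \<bar>det (matrix s')\<bar> *\<^sub>R F (s x)) = integral ?T F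
      \<longleftrightarrow> F absolutely_integrable_on s ` ?T \<and> integral (s ` ?T) F = integral ?T F"
      using cT der inj by (rule has_absolute_integral_change_of_variables_compact)
    ultimately have "integral ?T (\<lambda>x. F (s x)) = integral ?T F"
      unfolding det sT by simp
    then show ?thesis
      unfolding F_def integral_on_1_eq by simp
  qed
  then show "(LINT x|lebesgue_on ?T. f (s x)) = (LINT x|lebesgue_on ?T. f x)"
    using e by simp
qed


text \<open>By continuity a nonzero value persists on a nonempty open set, and such a set is not
  negligible.\<close>

lemma AE_eq_0_imp_eq_0_on_open:
  fixes f :: "real^2 \<Rightarrow> real"
  assumes "AE x in lebesgue_on S. f x = 0" "S \<in> sets lebesgue" "open U" "U \<subseteq> S" "continuous_on U f" "x \<in> U"
  shows "f x = 0"
proof (rule ccontr)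
  assume "f x \<noteq> 0"
  let ?V = "U \<inter> f -` (- {0})"
  have "open ?V"
    by (rule continuous_open_preimage) (use assms in auto)
  moreover have "x \<in> ?V" using assms \<open>f x \<noteq> 0\<close> by auto
  ultimately have nn: "\<not> negligible ?V" using open_not_negligible by blast
  have "AE x in lebesgue. x \<in> S \<longrightarrow> f x = 0"
    using assms(1,2) by (simp add: AE_restrict_space_iff)
  then have "negligible {x. \<not> (x \<in> S \<longrightarrow> f x = 0)}"
    unfolding completion.AE_iff_null_sets[of _ lborel] negligible_iff_null_sets
    by (simp add: completion.AE_iff_null_sets Compl_eq)
  then have "negligible ?V"
    by (rule negligible_subset) (use assms in auto)
  with nn show False by simp
qed

lemma continuous_on_affine: "q \<in> polys 1 \<Longrightarrow> continuous_on S q"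
  unfolding polys_1_iff by (auto intro!: continuous_intros)

text \<open>The swaps of vertices make the three coordinates have equal integrals, and they add up
  to the area, which is half of the absolute orientation.\<close>

lemma triangle_integral_bary:
  assumes "orient a b c \<noteq> 0"
  shows "(LINT x|lebesgue_on (convex hull {a, b, c}). bary a b c x) = \<bar>orient a b c\<bar> / 6"
proof -
  let ?T = "convex hull {a, b, c}"
  have T: "compact ?T" by (simp add: finite_imp_compact_convex_hull)
  then have T': "?T \<in> lmeasurable" by (rule lmeasurable_compact)
  have r: "orient b c a \<noteq> 0" "orient c a b \<noteq> 0" "{b, c, a} = {a, b, c}"
    using assms orient_rotate by auto
  have ab: "(LINT x|lebesgue_on ?T. bary b c a x) = (LINT x|lebesgue_on ?T. bary a b c x)"
    using triangle_swap_integral(1)[OF assms continuous_on_bary[of UNIV a b c]]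
    unfolding triangle_swap_integral(2)[OF assms continuous_on_bary[of UNIV a b c]] .
  have bc: "(LINT x|lebesgue_on ?T. bary c a b x) = (LINT x|lebesgue_on ?T. bary b c a x)"
    using triangle_swap_integral(1)[OF r(1) continuous_on_bary[of UNIV b c a]]
    unfolding triangle_swap_integral(2)[OF r(1) continuous_on_bary[of UNIV b c a]] r(3) .
  have i: "integrable (lebesgue_on ?T) (bary p q r)" for p q r
    by (rule integrable_lebesgue_on_compact[OF T continuous_on_bary])
  have "(LINT x|lebesgue_on ?T. bary a b c x) + (LINT x|lebesgue_on ?T. bary b c a x) +
      (LINT x|lebesgue_on ?T. bary c a b x) = (LINT x|lebesgue_on ?T. 1)"
    using i by (simp add: bary_sum[OF assms] flip: Bochner_Integration.integral_add)
  also have "\<dots> = \<bar>orient a b c\<bar> / 2"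
    using T' by (simp add: measure_triangle[symmetric] measure_restrict_space fmeasurableD)
  finally show ?thesis using ab bc by simp
qed

text \<open>Replacing \<open>q\<close> by its antisymmetrization under the swap of \<open>a\<close> and \<open>b\<close> leaves only the
  component of \<open>q\<close> along \<open>bary a - bary b\<close>.\<close>

lemma triangle_edge_moment:
  assumes o: "orient a b c \<noteq> 0" and q: "q \<in> polys 1"
  defines "d \<equiv> \<lambda>x. bary a b c x - bary b c a x"
  shows "(LINT x|lebesgue_on (convex hull {a, b, c}). d x * q x)
    = (q a - q b) / 2 * (LINT x|lebesgue_on (convex hull {a, b, c}). (d x)\<^sup>2)"
proof -
  let ?T = "convex hull {a, b, c}"
  have T: "compact ?T" by (simp add: finite_imp_compact_convex_hull)
  define s where "s x = x + (bary a b c x - bary b c a x) *\<^sub>R (b - a)" for x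
  have cd: "continuous_on S d" for S
    unfolding d_def by (intro continuous_intros)
  have cs: "continuous_on S s" for S
    unfolding s_def by (intro continuous_intros)
  have f: "continuous_on UNIV (\<lambda>x. d x * q x)"
    by (intro continuous_on_mult cd continuous_on_affine q)
  note sw = triangle_swap_integral[OF o f, folded s_def]
  have ds: "d (s x) = - d x" for x
    unfolding d_def sw(2,3) by simp
  have qs: "q x - q (s x) = (q a - q b) * d x" for x
  proof -
    obtain \<alpha> \<beta> where "q = (\<lambda>x. \<alpha> + \<beta> \<bullet> x)" using q polys_1_iff by blast
    then show ?thesis by (simp add: s_def d_def algebra_simps)
  qed
  have i: "integrable (lebesgue_on ?T) (\<lambda>x. d x * q x)" "integrable (lebesgue_on ?T) (\<lambda>x. d (s x) * q (s x))"
    "integrable (lebesgue_on ?T) (\<lambda>x. (d x)\<^sup>2)"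
    by (intro integrable_lebesgue_on_compact[OF T] continuous_on_subset[OF f subset_UNIV]
        continuous_on_subset[OF sw(5) subset_UNIV] continuous_on_power cd)+
  have "2 * (LINT x|lebesgue_on ?T. d x * q x) =
      (LINT x|lebesgue_on ?T. d x * q x) + (LINT x|lebesgue_on ?T. d (s x) * q (s x))"
    using sw(1) by simp
  also have "\<dots> = (LINT x|lebesgue_on ?T. d x * q x + d (s x) * q (s x))"
    using i by simp
  also have "\<dots> = (LINT x|lebesgue_on ?T. (q a - q b) * (d x)\<^sup>2)"
  proof (rule arg_cong[where f = "integral\<^sup>L _"], rule ext)
    fix x
    show "d x * q x + d (s x) * q (s x) = (q a - q b) * (d x)\<^sup>2"
      using qs[of x] unfolding ds power2_eq_square by algebra
  qed
  finally show ?thesis by simp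
qed

lemma triangle_edge_moment_pos:
  assumes o: "orient a b c \<noteq> 0"
  shows "(LINT x|lebesgue_on (convex hull {a, b, c}). (bary a b c x - bary b c a x)\<^sup>2) > 0"
proof -
  let ?T = "convex hull {a, b, c}"
  let ?d = "\<lambda>x. (bary a b c x - bary b c a x)\<^sup>2"
  have T: "compact ?T" by (simp add: finite_imp_compact_convex_hull)
  then have T': "?T \<in> sets lebesgue" by (intro fmeasurableD lmeasurable_compact)
  have c: "continuous_on S ?d" for S
    by (intro continuous_intros)
  have r: "orient b c a \<noteq> 0" "orient c a b \<noteq> 0"
    using o orient_rotate by auto
  \<comment> \<open>An interior point at which the coordinates of a and b differ, so the integrand
    is not zero there.\<close>
  define x where "x = (1/2) *\<^sub>R a + (1/4) *\<^sub>R b + (1/4) *\<^sub>R c"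
  have x: "bary a b c x = 1/2" "bary b c a x = 1/4" "bary c a b x = 1/4"
    using bary_of_comb[OF o, of "1/2" "1/4" "1/4"] bary_of_comb[OF r(1), of "1/4" "1/4" "1/2"]
      bary_of_comb[OF r(2), of "1/4" "1/2" "1/4"]
    by (simp_all add: x_def algebra_simps)
  then have xi: "x \<in> interior ?T"
    by (intro in_interior_triangle[OF o]) auto
  have "\<not> (AE x in lebesgue_on ?T. ?d x = 0)"
  proof
    assume "AE x in lebesgue_on ?T. ?d x = 0"
    from AE_eq_0_imp_eq_0_on_open[OF this T' open_interior interior_subset c xi] x
    show False by simp
  qed
  then have "(LINT x|lebesgue_on ?T. ?d x) \<noteq> 0"
    using integral_nonneg_eq_0_iff_AE[OF integrable_lebesgue_on_compact[OF T c]] by auto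
  moreover have "(LINT x|lebesgue_on ?T. ?d x) \<ge> 0"
    by (intro integral_nonneg_AE) auto
  ultimately show ?thesis by linarith
qed

lemma orient_eq_0_iff_collinear: "orient a b c = 0 \<longleftrightarrow> collinear {a, b, c}"
proof
  assume "collinear {a, b, c}"
  then obtain u where u: "\<And>x y. x \<in> {a, b, c} \<Longrightarrow> y \<in> {a, b, c} \<Longrightarrow> \<exists>t. x - y = t *\<^sub>R u"
    unfolding collinear_def by blast
  obtain s t where "b - a = s *\<^sub>R u" "c - a = t *\<^sub>R u"
    using u[of b a] u[of c a] by auto
  then show "orient a b c = 0" by (simp add: orient_def cross2_def)
qed (rule orient_eq_0_imp_collinear)

lemma vertices_triangle:
  assumes "orient a b c \<noteq> 0"
  shows "{v. v extreme_point_of (convex hull {a, b, c})} = {a, b, c}"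
proof -
  have "a \<noteq> b" "b \<noteq> c" "a \<noteq> c"
    using assms by (auto simp: orient_def cross2_def)
  moreover have "\<not> collinear {a, b, c}"
    using assms orient_eq_0_iff_collinear by blast
  ultimately have "\<not> affine_dependent {a, b, c}"
    using collinear_3_eq_affine_dependent by blast
  then show ?thesis
    using extreme_point_of_convex_hull_affine_independent by blast
qed

lemma orient_add: "orient a b (y + w) = orient a b y + cross2 (b - a) w"
  by (simp add: orient_def cross2_def algebra_simps)

lemma orient_open_segment:
  assumes "y \<in> open_segment a b"
  shows "orient a b y = 0"
proof -
  obtain u where "y = (1 - u) *\<^sub>R a + u *\<^sub>R b" using assms by (auto simp: in_segment)
  then have "y - a = u *\<^sub>R (b - a)" by (simp add: algebra_simps)
  then show ?thesis by (simp add: orient_def cross2_def)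
qed

lemma cross2_scaleR_right: "cross2 u (t *\<^sub>R v) = t * cross2 u v"
  by (simp add: cross2_def algebra_simps)

lemma orient_cycle: "orient a b c = orient b c a" "orient a b c = orient c a b" "orient a b c = - orient b a c"
  by (simp_all add: orient_def cross2_def algebra_simps)

lemma scaleR_small:
  fixes w :: "'a::real_normed_vector"
  assumes "r > 0"
  obtains t where "t > 0" "t \<le> 1" "norm (t *\<^sub>R w) < r"
proof
  define N where "N = norm w"
  have N: "N \<ge> 0" by (simp add: N_def)
  define t where "t = min 1 (r / (N + 1))"
  show t: "t > 0" "t \<le> 1" using assms N by (auto simp: t_def)
  have "t * (N + 1) \<le> r" using N by (simp add: t_def pos_le_divide_eq[symmetric])
  then have "t * N < r" using t by (simp add: algebra_simps)
  then show "norm (t *\<^sub>R w) < r" using t by (simp add: N_def)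
qed

subsection \<open>Geometry of the triangulation\<close>

text \<open>The condition \<open>regular_domain\<close> puts the interior of every cell into
  \<Omega> and excludes slits: an edge with cells on both sides belongs to \<Omega>.\<close>

locale triangulated_domain =
  fixes \<Omega> :: "(real^2) set" and \<T> :: "(real^2) set set"
  assumes open_domain: "open \<Omega>" and connected_domain: "connected \<Omega>"
    and nonempty_domain: "\<Omega> \<noteq> {}"
    and regular_domain: "interior (closure \<Omega>) = \<Omega>"
    and mesh: "mesh_of \<Omega> \<T>"
begin

text \<open>Ordered vertex triples: every triangle of the mesh occurs as six of them, so facts about
  a vertex or an edge can always be phrased for the leading arguments.\<close>

definition cell :: "real^2 \<Rightarrow> real^2 \<Rightarrow> real^2 \<Rightarrow> bool" where
  "cell a b c \<longleftrightarrow> convex hull {a, b, c} \<in> \<T> \<and> orient a b c \<noteq> 0"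

definition edge :: "real^2 \<Rightarrow> real^2 \<Rightarrow> bool" where
  "edge a b \<longleftrightarrow> a \<noteq> b \<and> (\<exists>T\<in>\<T>. a extreme_point_of T \<and> b extreme_point_of T)"

lemma finite_mesh: "finite \<T>"
  and mesh_face: "T \<in> \<T> \<Longrightarrow> T' \<in> \<T> \<Longrightarrow> (T \<inter> T') face_of T"
  and mesh_simplex: "T \<in> \<T> \<Longrightarrow> 2 simplex T"
  and mesh_covers: "\<Union>\<T> = closure \<Omega>"
  and mesh_inner_vertex: "T \<in> \<T> \<Longrightarrow> \<exists>v. v extreme_point_of T \<and> v \<notin> frontier \<Omega>"
  using mesh unfolding mesh_of_def triangulation_def by auto

lemma cell_cases:
  assumes "T \<in> \<T>"
  obtains a b c where "cell a b c" "T = convex hull {a, b, c}"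
  using simplex_2_triangle[OF mesh_simplex[OF assms]] assms unfolding cell_def by metis

lemma cell_rotate: "cell a b c \<Longrightarrow> cell b c a"
  and cell_swap: "cell a b c \<Longrightarrow> cell b a c"
  and cell_orient: "cell a b c \<Longrightarrow> orient a b c \<noteq> 0"
  and cell_in: "cell a b c \<Longrightarrow> convex hull {a, b, c} \<in> \<T>"
  unfolding cell_def using orient_cycle[of a b c]
  by (auto simp: insert_commute)

lemma cell_vertices: "cell a b c \<Longrightarrow> {v. v extreme_point_of (convex hull {a, b, c})} = {a, b, c}"
  using vertices_triangle cell_orient by blast

lemma cell_extreme: "cell a b c \<Longrightarrow> v extreme_point_of (convex hull {a, b, c}) \<longleftrightarrow> v \<in> {a, b, c}"
  using cell_vertices by blast

lemma cell_distinct: "cell a b c \<Longrightarrow> a \<noteq> b \<and> b \<noteq> c \<and> a \<noteq> c"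
  using cell_orient[of a b c] by (auto simp: orient_def cross2_def)

lemma cell_of_vertex:
  assumes "T \<in> \<T>" "a extreme_point_of T"
  obtains b c where "cell a b c" "T = convex hull {a, b, c}"
proof -
  obtain p q r where c: "cell p q r" "T = convex hull {p, q, r}" using cell_cases assms(1) by blast
  then have "a \<in> {p, q, r}" using assms(2) cell_extreme by blast
  then consider "a = p" | "a = q" | "a = r" by auto
  then show ?thesis
  proof cases
    case 1 then show ?thesis using that c by blast
  next
    case 2 then show ?thesis using that[of r p] c cell_rotate[of p q r] by (simp add: insert_commute)
  next
    case 3 then show ?thesis using that[of p q] c cell_rotate[of p q r] cell_rotate[of q r p]
      by (simp add: insert_commute)
  qed
qed

lemma cell_of_edge:
  assumes "T \<in> \<T>" "a extreme_point_of T" "b extreme_point_of T" "a \<noteq> b"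
  obtains c where "cell a b c" "T = convex hull {a, b, c}"
proof -
  obtain p q where c: "cell a p q" "T = convex hull {a, p, q}" using cell_of_vertex assms(1,2) by blast
  then have "b = p \<or> b = q" using assms(3,4) cell_extreme[OF c(1), of b] by auto
  then show ?thesis
  proof
    assume "b = q" then show ?thesis
      using that[of p] c cell_rotate[of a p q] cell_rotate[of p q a] cell_swap[of q a p] by (simp add: insert_commute)
  qed (use that c in blast)
qed

lemma edge_cell:
  assumes "edge a b" obtains c where "cell a b c"
  using assms unfolding edge_def by (metis cell_of_edge)

lemma cell_edge: "cell a b c \<Longrightarrow> edge a b"
  unfolding edge_def using cell_extreme[of a b c] cell_in[of a b c] cell_distinct[of a b c] by blast

lemma edge_sym: "edge a b \<Longrightarrow> edge b a"
  unfolding edge_def by auto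

lemma cell_compact: "T \<in> \<T> \<Longrightarrow> compact T"
  and cell_convex: "T \<in> \<T> \<Longrightarrow> convex T"
  by (metis cell_cases finite_imp_compact_convex_hull finite.emptyI finite.insertI)
    (metis cell_cases convex_convex_hull)

lemma extreme_in: "T \<in> \<T> \<Longrightarrow> v extreme_point_of T \<Longrightarrow> v \<in> T"
  by (simp add: extreme_point_of_def)

lemma cell_subset: "T \<in> \<T> \<Longrightarrow> T \<subseteq> closure \<Omega>"
  and interior_cell_subset: "T \<in> \<T> \<Longrightarrow> interior T \<subseteq> \<Omega>"
proof -
  assume "T \<in> \<T>"
  then show *: "T \<subseteq> closure \<Omega>" using mesh_covers by blast
  then show "interior T \<subseteq> \<Omega>" using interior_mono regular_domain by blast
qed

lemma in_closure_cell:
  assumes "x \<in> closure \<Omega>" obtains T where "T \<in> \<T>" "x \<in> T"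
  using assms mesh_covers by blast

lemma compact_closure_domain: "compact (closure \<Omega>)"
  using mesh_covers finite_mesh cell_compact by (metis compact_Union)

lemma frontier_iff: "x \<in> frontier \<Omega> \<longleftrightarrow> x \<in> closure \<Omega> \<and> x \<notin> \<Omega>"
  using open_domain by (simp add: frontier_def interior_open)

text \<open>This excludes hanging nodes. The intersection of two cells is a face of both, and being
  an extreme point passes from a cell to its face and back.\<close>

lemma vertex_in_cell:
  assumes "v \<in> mesh_vertices \<T>" "T \<in> \<T>" "v \<in> T"
  shows "v extreme_point_of T"
proof -
  obtain T' where T': "T' \<in> \<T>" "v extreme_point_of T'"
    using assms(1) unfolding mesh_vertices_def by blast
  have "v \<in> T'" using T' extreme_in by blast
  then have "v extreme_point_of (T' \<inter> T)"
    using extreme_point_of_face[OF mesh_face[OF T'(1) assms(2)]] T' assms by blast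
  then show ?thesis
    using extreme_point_of_face[OF mesh_face[OF assms(2) T'(1)]] by (simp add: Int_commute)
qed

text \<open>A face of a cell that contains an inner point of a segment of the cell contains both
  endpoints; the face is the intersection of T with a cell that has the edge.\<close>

lemma edge_in_cell:
  assumes "edge a b" "y \<in> open_segment a b" "T \<in> \<T>" "y \<in> T"
  shows "a extreme_point_of T" "b extreme_point_of T"
proof -
  obtain T0 where T0: "T0 \<in> \<T>" "a extreme_point_of T0" "b extreme_point_of T0"
    using assms(1) unfolding edge_def by blast
  have ab: "a \<in> T0" "b \<in> T0" using T0 extreme_in by auto
  have "open_segment a b \<subseteq> T0"
    using ab cell_convex[OF T0(1)] open_closed_segment closed_segment_subset by blast
  then have "y \<in> T0 \<inter> T" using assms by auto
  with mesh_face[OF T0(1) assms(3)] ab assms(2) have "a \<in> T" "b \<in> T"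
    unfolding face_of_def by blast+
  moreover have "a \<in> mesh_vertices \<T>" "b \<in> mesh_vertices \<T>"
    using T0 unfolding mesh_vertices_def by auto
  ultimately show "a extreme_point_of T" "b extreme_point_of T"
    using vertex_in_cell assms(3) by auto
qed

lemma edge_not_vertex:
  assumes "edge a b" "y \<in> open_segment a b"
  shows "y \<notin> mesh_vertices \<T>"
proof
  assume y: "y \<in> mesh_vertices \<T>"
  then obtain T where T: "T \<in> \<T>" "y extreme_point_of T" unfolding mesh_vertices_def by blast
  then have "a extreme_point_of T" "b extreme_point_of T"
    using edge_in_cell[OF assms T(1)] extreme_in by auto
  then have "a \<in> T" "b \<in> T" using extreme_in T by auto
  then show False using T(2) assms(2) unfolding extreme_point_of_def by blast
qed

lemma edge_subset_closure: "edge a b \<Longrightarrow> closed_segment a b \<subseteq> closure \<Omega>"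
  unfolding edge_def
  by (metis cell_convex cell_subset closed_segment_subset extreme_in subset_trans)

text \<open>The finitely many cells that miss x have a closed union, and x has a ball outside
  it.\<close>

lemma locally_cells:
  obtains r where "r > 0" "\<And>z T. z \<in> ball x r \<Longrightarrow> T \<in> \<T> \<Longrightarrow> z \<in> T \<Longrightarrow> x \<in> T"
proof -
  let ?U = "\<Union>{T\<in>\<T>. x \<notin> T}"
  have "closed ?U"
    using finite_mesh cell_compact by (intro closed_Union) (auto intro: compact_imp_closed)
  then have "open (- ?U)" by (rule open_Compl)
  moreover have "x \<in> - ?U" by blast
  ultimately obtain r where r: "r > 0" "ball x r \<subseteq> - ?U"
    by (rule openE)
  show ?thesis
  proof (rule that[OF r(1)])
    fix z T assume "z \<in> ball x r" "T \<in> \<T>" "z \<in> T"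
    then show "x \<in> T" using r(2) by auto
  qed
qed

text \<open>Near an inner point of the edge the coordinates of a and b stay positive, so membership
  in the triangle is decided by the third coordinate, that is, by the side of the line on which z
  lies.\<close>

lemma cell_side_near:
  assumes "cell a b c" "y \<in> open_segment a b"
  obtains r where "r > 0"
    "\<And>z. z \<in> ball y r \<Longrightarrow> orient a b z * orient a b c \<ge> 0 \<Longrightarrow> z \<in> convex hull {a, b, c}"
    "\<And>z. z \<in> ball y r \<Longrightarrow> orient a b z * orient a b c > 0 \<Longrightarrow> z \<in> interior (convex hull {a, b, c})"
proof -
  have o: "orient a b c \<noteq> 0" "orient b c a \<noteq> 0" using cell_orient[OF assms(1)] orient_cycle[of a b c] by auto
  obtain u where u: "0 < u" "u < 1" "y = (1 - u) *\<^sub>R a + u *\<^sub>R b"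
    using assms(2) by (auto simp: in_segment)
  have "bary a b c y = 1 - u" "bary b c a y = u"
    using bary_of_comb[OF o(1), of "1 - u" u 0] bary_of_comb[OF o(2), of u 0 "1 - u"] u
    by (simp_all add: add.commute)
  then have y: "y \<in> {z. 0 < bary a b c z \<and> 0 < bary b c a z}" using u by simp
  have "open {z. 0 < bary a b c z \<and> 0 < bary b c a z}"
    by (intro open_Collect_conj open_Collect_less continuous_on_bary continuous_on_const)
  then obtain r where r: "r > 0" "ball y r \<subseteq> {z. 0 < bary a b c z \<and> 0 < bary b c a z}"
    using y by (meson open_contains_ball)
  have c: "bary c a b z = orient a b z * orient a b c / (orient a b c)\<^sup>2" for z
    using o unfolding bary_def orient_cycle(2)[of a b z] orient_cycle(2)[of a b c] by (simp add: power2_eq_square orient_cycle(2)[of b c a, symmetric])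
  show ?thesis
  proof
    show "r > 0" by fact
    show "z \<in> convex hull {a, b, c}" if "z \<in> ball y r" "orient a b z * orient a b c \<ge> 0" for z
      unfolding in_triangle_iff[OF o(1)] c using that r by (auto intro!: divide_nonneg_nonneg dest!: subsetD)
    show "z \<in> interior (convex hull {a, b, c})" if "z \<in> ball y r" "orient a b z * orient a b c > 0" for z
      by (rule in_interior_triangle[OF o(1)]) (use c that r o in \<open>auto intro!: divide_pos_pos\<close>)
  qed
qed

lemma cell_side_in:
  assumes "cell a b c" "z \<in> convex hull {a, b, c}"
  shows "orient a b z * orient a b c \<ge> 0"
proof -
  have "bary c a b z \<ge> 0" using assms in_triangle_iff cell_orient by blast
  then show ?thesis
    unfolding orient_cycle(2)[of a b z] orient_cycle(2)[of a b c]
    by (auto simp: bary_def zero_le_divide_iff zero_le_mult_iff)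
qed

text \<open>A small step from the midpoint of the edge towards c enters the interior of both
  triangles. Their intersection is a face of each that meets the interior, so it is the whole of
  each.\<close>

lemma cell_side_unique:
  assumes "cell a b c" "cell a b c'" "orient a b c * orient a b c' > 0"
  shows "c = c'"
proof -
  let ?T = "convex hull {a, b, c}" and ?T' = "convex hull {a, b, c'}"
  define y where "y = midpoint a b"
  have y: "y \<in> open_segment a b" using cell_distinct[OF assms(1)] by (simp add: y_def)
  obtain r where r: "r > 0" "\<And>z. z \<in> ball y r \<Longrightarrow> orient a b z * orient a b c > 0 \<Longrightarrow> z \<in> interior ?T"
    using cell_side_near[OF assms(1) y] by metis
  obtain r' where r': "r' > 0" "\<And>z. z \<in> ball y r' \<Longrightarrow> orient a b z * orient a b c' > 0 \<Longrightarrow> z \<in> interior ?T'"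
    using cell_side_near[OF assms(2) y] by metis
  obtain t where t: "t > 0" "norm (t *\<^sub>R (c - y)) < min r r'"
    using scaleR_small[of "min r r'" "c - y"] r(1) r'(1) by auto
  define z where "z = y + t *\<^sub>R (c - y)"
have z: "z \<in> ball y r" "z \<in> ball y r'"
    using t by (auto simp: z_def dist_norm)
  have "orient a b z = t * orient a b c"
    using orient_add[of a b y "c - y"] orient_open_segment[OF y]
    by (simp add: z_def orient_add cross2_scaleR_right)
  then have "z \<in> interior ?T" "z \<in> interior ?T'"
    using r(2)[OF z(1)] r'(2)[OF z(2)] t assms(3) cell_orient[OF assms(1)]
    by (auto simp: mult.assoc zero_less_mult_iff not_less)
  then have zz: "z \<in> ?T \<inter> ?T'" "z \<in> interior ?T" "z \<in> interior ?T'" using interior_subset by auto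
  have "?T \<inter> ?T' = ?T" "?T' \<inter> ?T = ?T'"
    using zz face_of_disjoint_interior[OF mesh_face[OF cell_in[OF assms(1)] cell_in[OF assms(2)]]]
      face_of_disjoint_interior[OF mesh_face[OF cell_in[OF assms(2)] cell_in[OF assms(1)]]]
    by blast+
  then have "?T = ?T'" by blast
  then have "{a, b, c} = {a, b, c'}"
    using cell_vertices assms by metis
  then have "c \<in> {a, b, c'}" by auto
  then show ?thesis using cell_distinct[OF assms(1)] by auto
qed

text \<open>Only the sign of s matters; it selects a side of the line. Points of the domain close to
  y on that side lie in cells that contain y, hence have the edge, and the third vertex of such a
  cell must lie on the same side.\<close>

lemma cell_side_exists:
  assumes "edge a b" "y \<in> open_segment a b"
    and "\<And>r. r > 0 \<Longrightarrow> \<exists>z \<in> ball y r \<inter> closure \<Omega>. orient a b z * s > 0"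
  obtains c where "cell a b c" "orient a b c * s > 0"
proof -
  obtain r where r: "r > 0" "\<And>z T. z \<in> ball y r \<Longrightarrow> T \<in> \<T> \<Longrightarrow> z \<in> T \<Longrightarrow> y \<in> T"
    using locally_cells by blast
  obtain z where z: "z \<in> ball y r" "z \<in> closure \<Omega>" "orient a b z * s > 0" using assms(3)[OF r(1)] by blast
  obtain T where T: "T \<in> \<T>" "z \<in> T" using z(2) in_closure_cell by blast
  then have "y \<in> T" using r z by blast
  obtain c where c: "cell a b c" "T = convex hull {a, b, c}"
    using cell_of_edge[OF T(1) edge_in_cell[OF assms(1,2) T(1) \<open>y \<in> T\<close>]] assms(1) edge_def by blast
  have "orient a b z * orient a b c \<ge> 0" using cell_side_in c T by blast
  then have "orient a b c * s > 0"
    using z(3) cell_orient[OF c(1)] by (auto simp: zero_less_mult_iff zero_le_mult_iff)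
  then show ?thesis using that c by blast
qed

lemma edge_two_sides:
  assumes "edge a b" "y \<in> open_segment a b" "y \<in> \<Omega>" "s \<noteq> 0"
  obtains c where "cell a b c" "orient a b c * s > 0"
proof (rule cell_side_exists[OF assms(1,2), of s])
  fix r :: real assume r: "r > 0"
  obtain e where e: "e > 0" "ball y e \<subseteq> \<Omega>" using assms(3) open_domain by (meson open_contains_ball)
  \<comment> \<open>The edge vector turned by a right angle; moving along \<open>sgn s\<close> times
    \<open>p\<close> leaves the line to the prescribed side.\<close>
  define p :: "real^2" where "p = vector [- (b - a) $ 2, (b - a) $ 1]"
  have p: "cross2 (b - a) p = (norm (b - a))\<^sup>2"
    by (simp add: cross2_def p_def power2_norm_eq_inner inner_vec_def sum_2 algebra_simps)
  obtain t where t: "t > 0" "norm (t *\<^sub>R p) < min r e"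
    using scaleR_small[of "min r e" p] r e(1) by auto
  define z where "z = y + (sgn s * t) *\<^sub>R p"
  have "dist y z = norm (t *\<^sub>R p)"
    using t assms(4) by (simp add: z_def dist_norm abs_mult abs_sgn_eq)
  then have "z \<in> ball y r" "z \<in> ball y e" using t by auto
  then have "z \<in> ball y r \<inter> closure \<Omega>"
    using e closure_subset by blast
  moreover have "orient a b z = sgn s * t * (norm (b - a))\<^sup>2"
    by (simp add: z_def orient_add orient_open_segment[OF assms(2)] p cross2_scaleR_right)
  then have "orient a b z * s = \<bar>s\<bar> * t * (norm (b - a))\<^sup>2"
    by (simp add: abs_sgn[of s] mult_ac)
  then have "orient a b z * s > 0"
    using t assms by (auto simp: edge_def)
  ultimately show "\<exists>z \<in> ball y r \<inter> closure \<Omega>. orient a b z * s > 0" by blast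
qed (use that in blast)

text \<open>The triangles on the two sides of the edge together cover a neighbourhood of each of its
  inner points. Such points are interior to the closure of \<Omega>, hence in \<Omega>.\<close>

lemma edge_open_in_domain:
  assumes "edge a b" "y \<in> open_segment a b" "y \<in> \<Omega>" "y' \<in> open_segment a b"
  shows "y' \<in> \<Omega>"
proof -
  obtain c where c: "cell a b c" "orient a b c * 1 > 0" using edge_two_sides[OF assms(1-3), of 1] by auto
  obtain c' where c': "cell a b c'" "orient a b c' * (-1) > 0" using edge_two_sides[OF assms(1-3), of "-1"] by auto
  obtain r where r: "r > 0"
    "\<And>z. z \<in> ball y' r \<Longrightarrow> orient a b z * orient a b c \<ge> 0 \<Longrightarrow> z \<in> convex hull {a, b, c}"
    using cell_side_near[OF c(1) assms(4)] by metis
  obtain r' where r': "r' > 0"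
    "\<And>z. z \<in> ball y' r' \<Longrightarrow> orient a b z * orient a b c' \<ge> 0 \<Longrightarrow> z \<in> convex hull {a, b, c'}"
    using cell_side_near[OF c'(1) assms(4)] by metis
  have "ball y' (min r r') \<subseteq> closure \<Omega>"
  proof
    fix z assume z: "z \<in> ball y' (min r r')"
    show "z \<in> closure \<Omega>"
    proof (cases "orient a b z \<ge> 0")
      case True
      then have "z \<in> convex hull {a, b, c}" using r z c by (auto intro!: mult_nonneg_nonneg)
      then show ?thesis using cell_subset[OF cell_in[OF c(1)]] by blast
    next
      case False
      then have "orient a b z * orient a b c' \<ge> 0" using c'(2) by (intro mult_nonpos_nonpos) auto
      then have "z \<in> convex hull {a, b, c'}" using r'(2) z by auto
      then show ?thesis using cell_subset[OF cell_in[OF c'(1)]] by blast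
    qed
  qed
  then have "y' \<in> interior (closure \<Omega>)"
    using r r' by (intro interiorI[of "ball y' (min r r')"]) auto
  then show ?thesis using regular_domain by simp
qed

lemma edge_from_interior:
  assumes "edge a b" "a \<in> \<Omega>" "y \<in> open_segment a b"
  shows "y \<in> \<Omega>"
proof -
  obtain e where e: "e > 0" "ball a e \<subseteq> \<Omega>" using assms(2) open_domain by (meson open_contains_ball)
  have "a \<noteq> b" using assms(1) edge_def by blast
  then have "a \<in> closure (open_segment a b)" by simp
  then obtain z where "z \<in> open_segment a b" "dist z a < e" using e(1) closure_approachable by blast
  moreover from this have "z \<in> \<Omega>" using e(2) by (auto simp: dist_commute)
  ultimately show ?thesis using edge_open_in_domain[OF assms(1)] assms(3) by blast
qed

end

text \<open>Two affine functions agree on a convex set.\<close>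

lemma polys_1_eq_on_hull:
  assumes "q \<in> polys 1" "q' \<in> polys 1" "\<And>v. v \<in> S \<Longrightarrow> q v = q' v" "x \<in> convex hull S"
  shows "q x = q' x"
proof -
  obtain \<alpha> \<beta> \<alpha>' \<beta>' where q: "q = (\<lambda>x. \<alpha> + \<beta> \<bullet> x)" "q' = (\<lambda>x. \<alpha>' + \<beta>' \<bullet> x)"
    using assms polys_1_iff by meson
  have "{x. q x = q' x} = {x. (\<beta> - \<beta>') \<bullet> x = \<alpha>' - \<alpha>}"
    unfolding q by (auto simp: inner_diff_left)
  then have "convex {x. q x = q' x}" by (simp add: convex_hyperplane)
  then have "convex hull S \<subseteq> {x. q x = q' x}"
    using assms(3) by (intro hull_minimal) auto
  then show ?thesis using assms(4) by blast
qed

text \<open>The triangle may be degenerate: \<open>eq_0_on_side\<close> applies this to a segment,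
  with one endpoint doubled.\<close>

lemma poly_on_2_interpolation:
  assumes p: "poly_on 2 (convex hull {a, b, c}) p" and x: "x \<in> convex hull {a, b, c}"
    and "p a = 0" "p b = 0" "p c = 0" "p (midpoint a b) = 0" "p (midpoint b c) = 0" "p (midpoint c a) = 0"
  shows "p x = 0"
proof -
  let ?T = "convex hull {a, b, c}"
  obtain q where q: "q \<in> polys 2" "\<And>x. x \<in> ?T \<Longrightarrow> p x = q x"
    using p unfolding poly_on_def by blast
  have "a \<in> ?T" "b \<in> ?T" "c \<in> ?T" by (auto intro: hull_inc)
  moreover have "midpoint a b \<in> ?T" "midpoint b c \<in> ?T" "midpoint c a \<in> ?T"
    using calculation by (auto intro: midpoints_in_convex_hull)
  ultimately have z: "q a = 0" "q b = 0" "q c = 0" "q (midpoint a b) = 0" "q (midpoint b c) = 0" "q (midpoint c a) = 0"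
    using q(2) assms by auto
  obtain u v w where uvw: "x = u *\<^sub>R a + v *\<^sub>R b + w *\<^sub>R c" "u + v + w = 1"
    using x unfolding convex_hull_3 by blast
  have "q x = 0" unfolding uvw(1) polys_2_interpolation[OF q(1) uvw(2)] z by simp
  then show ?thesis using q(2) x by simp
qed

subsection \<open>Finite element functions\<close>

context triangulated_domain
begin

text \<open>The continuous piecewise affine nodal function of the vertex a. The value is read off
  from any cell that contains x; that the choice of the cell is immaterial is
  \<open>hat_eq\<close>.\<close>

definition hat :: "real^2 \<Rightarrow> real^2 \<Rightarrow> real" where
  "hat a x = (THE t. \<exists>T\<in>\<T>. x \<in> T \<and>
     (\<exists>q\<in>polys 1. (\<forall>v. v extreme_point_of T \<longrightarrow> q v = of_bool (v = a)) \<and> t = q x))"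

text \<open>Two cells meet in a common face whose extreme points are vertices of both cells. The two
  affine functions agree there, hence on the convex hull of these points, which is the face.\<close>

lemma hat_eq:
  assumes "T \<in> \<T>" "x \<in> T" "q \<in> polys 1" "\<And>v. v extreme_point_of T \<Longrightarrow> q v = of_bool (v = a)"
  shows "hat a x = q x"
  unfolding hat_def
proof (rule the_equality)
  fix t assume "\<exists>T\<in>\<T>. x \<in> T \<and> (\<exists>q\<in>polys 1. (\<forall>v. v extreme_point_of T \<longrightarrow> q v = of_bool (v = a)) \<and> t = q x)"
  then obtain T' q' where T': "T' \<in> \<T>" "x \<in> T'" "q' \<in> polys 1"
    "\<And>v. v extreme_point_of T' \<Longrightarrow> q' v = of_bool (v = a)" "t = q' x" by blast
  let ?F = "T \<inter> T'"
  have "compact ?F" "convex ?F"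
    using assms(1) T'(1) cell_compact cell_convex by (auto intro: compact_Int convex_Int)
  then have "x \<in> convex hull {v. v extreme_point_of ?F}"
    using Krein_Milman_Minkowski assms(2) T'(2) by blast
  moreover have "v extreme_point_of T" "v extreme_point_of T'" if "v extreme_point_of ?F" for v
    using that extreme_point_of_face[OF mesh_face[OF assms(1) T'(1)]]
      extreme_point_of_face[OF mesh_face[OF T'(1) assms(1)]] by (auto simp: Int_commute)
  ultimately show "t = q x"
    unfolding T'(5) using polys_1_eq_on_hull[OF T'(3) assms(3)] T'(4) assms(4)
    by (metis (mono_tags, lifting) mem_Collect_eq)
qed (use assms in blast)

lemma hat_bary:
  assumes "cell a b c" "x \<in> convex hull {a, b, c}"
  shows "hat a x = bary a b c x"
  using assms cell_extreme[OF assms(1)] bary_vertex[OF cell_orient[OF assms(1)]] cell_distinct[OF assms(1)]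
  by (intro hat_eq[OF cell_in[OF assms(1)] assms(2) bary_polys]) auto

lemma hat_outside:
  assumes "T \<in> \<T>" "x \<in> T" "\<not> a extreme_point_of T"
  shows "hat a x = 0"
proof -
  have z: "(\<lambda>x. 0 :: real) \<in> polys 1"
    unfolding polys_1_iff by (rule exI[of _ 0], rule exI[of _ 0]) simp
  have v: "(0::real) = of_bool (v = a)" if "v extreme_point_of T" for v
    using that assms(3) by (cases "v = a") simp_all
  show ?thesis
    using hat_eq[OF assms(1,2) z v] .
qed

lemma hat_poly_on: "T \<in> \<T> \<Longrightarrow> poly_on 1 T (hat a)"
proof -
  assume T: "T \<in> \<T>"
  show ?thesis
  proof (cases "a extreme_point_of T")
    case True
    then obtain b c where "cell a b c" "T = convex hull {a, b, c}" using cell_of_vertex T by blast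
    then show ?thesis using hat_bary bary_polys[of a b c] unfolding poly_on_def by auto
  next
    case False
    then show ?thesis
      using poly_on_0[of 1 T] hat_outside[OF T _ False] by (simp add: poly_on_def)
  qed
qed

lemma continuous_on_piecewise_poly:
  assumes "\<And>T. T \<in> \<T> \<Longrightarrow> poly_on 1 T p"
  shows "continuous_on (closure \<Omega>) p"
proof -
  have "continuous_on (\<Union>T\<in>\<T>. T) p"
  proof (rule continuous_on_closed_Union[OF finite_mesh])
    show "closed T" if "T \<in> \<T>" for T using cell_compact[OF that] by (rule compact_imp_closed)
    show "continuous_on T p" if "T \<in> \<T>" for T
      using assms[OF that] continuous_on_affine unfolding poly_on_def
      by (metis continuous_on_cong)
  qed
  then show ?thesis using mesh_covers by simp
qed

lemma hat_continuous: "continuous_on (closure \<Omega>) (hat a)"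
  using continuous_on_piecewise_poly hat_poly_on by blast

lemma hat_vertex:
  assumes "v \<in> mesh_vertices \<T>"
  shows "hat a v = of_bool (v = a)"
proof -
  obtain T where T: "T \<in> \<T>" "v extreme_point_of T" using assms unfolding mesh_vertices_def by blast
  obtain b c where vbc: "cell v b c" "T = convex hull {v, b, c}" using cell_of_vertex T by blast
  then have v: "v \<in> T" by (simp add: hull_inc)
  show ?thesis
  proof (cases "a = v")
    case True
    then show ?thesis using hat_bary[OF vbc(1), of v] v vbc bary_vertex(1)[OF cell_orient[OF vbc(1)]] by simp
  next
    case False
    show ?thesis
    proof (cases "a extreme_point_of T")
      case True
      then obtain c' where c': "cell a v c'" "T = convex hull {a, v, c'}"
        using cell_of_edge[OF T(1) True T(2) False] by blast
      then show ?thesis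
        using hat_bary[OF c'(1), of v] v bary_vertex(2)[OF cell_orient[OF c'(1)]] False by simp
    qed (use hat_outside[OF T(1) v] False in simp)
  qed
qed

lemma hat_segment:
  assumes "edge c d" "y = (1 - u) *\<^sub>R c + u *\<^sub>R d" "0 \<le> u" "u \<le> 1"
  shows "hat a y = (1 - u) * of_bool (c = a) + u * of_bool (d = a)"
proof -
  obtain e where e: "cell c d e" using edge_cell assms(1) by blast
  let ?T = "convex hull {c, d, e}"
  have y: "y \<in> ?T"
    unfolding assms(2) using assms(3,4) by (intro convexD convex_convex_hull hull_inc) auto
  obtain q where q: "q \<in> polys 1" "\<And>x. x \<in> ?T \<Longrightarrow> hat a x = q x"
    using hat_poly_on[OF cell_in[OF e]] unfolding poly_on_def by blast
  have v: "c \<in> mesh_vertices \<T>" "d \<in> mesh_vertices \<T>"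
    using assms(1) unfolding mesh_vertices_def edge_def by auto
  have "q y = (1 - u) * q c + u * q d"
    using polys_1_convex_comb[OF q(1), of "1 - u" u 0 c d e] assms(2) by simp
  then show ?thesis
    using q(2)[OF y] q(2)[of c] q(2)[of d] hat_vertex[OF v(1)] hat_vertex[OF v(2)] by (simp add: hull_inc)
qed

lemma hat_midpoint:
  assumes "edge c d"
  shows "hat a (midpoint c d) = (of_bool (c = a) + of_bool (d = a)) / 2"
  by (subst hat_segment[OF assms, of _ "1/2"]) (simp_all add: midpoint_def scaleR_right_distrib)

lemma mesh_nodes_eq: "mesh_nodes \<T> = mesh_vertices \<T> \<union> {midpoint a b | a b. edge a b}"
  unfolding mesh_nodes_def edge_def by blast

lemma finite_vertices: "finite (mesh_vertices \<T>)"
proof -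
  have "mesh_vertices \<T> = (\<Union>T\<in>\<T>. {v. v extreme_point_of T})"
    unfolding mesh_vertices_def by auto
  moreover have "finite {v. v extreme_point_of T}" if "T \<in> \<T>" for T
    using cell_cases[OF that] cell_vertices by (metis finite.emptyI finite.insertI)
  ultimately show ?thesis using finite_mesh by simp
qed

lemma edge_vertices: "edge a b \<Longrightarrow> a \<in> mesh_vertices \<T> \<and> b \<in> mesh_vertices \<T>"
  unfolding edge_def mesh_vertices_def by blast

lemma finite_nodes: "finite (mesh_nodes \<T>)"
proof (rule finite_subset)
  show "mesh_nodes \<T> \<subseteq> mesh_vertices \<T> \<union> case_prod midpoint ` (mesh_vertices \<T> \<times> mesh_vertices \<T>)"
    unfolding mesh_nodes_eq using edge_vertices by force
qed (use finite_vertices in simp)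

lemma nodes_subset: "mesh_nodes \<T> \<subseteq> closure \<Omega>"
proof -
  have "mesh_vertices \<T> \<subseteq> closure \<Omega>"
    unfolding mesh_vertices_def using extreme_in cell_subset by blast
  moreover have "midpoint a b \<in> closure \<Omega>" if "edge a b" for a b
    using edge_subset_closure[OF that] midpoint_in_closed_segment by blast
  ultimately show ?thesis unfolding mesh_nodes_eq by blast
qed

text \<open>The quadratic Lagrange basis of the mesh. For a midpoint the edge is recovered by
  choice; it is unique up to the order of its endpoints, and the product does not depend on the
  order, see \<open>shape_midpoint\<close>.\<close>

definition shape :: "real^2 \<Rightarrow> real^2 \<Rightarrow> real" where
  "shape z x = (if z \<in> mesh_vertices \<T> then hat z x * (2 * hat z x - 1)
     else let (a, b) = SOME (a, b). edge a b \<and> z = midpoint a b in 4 * (hat a x * hat b x))"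

lemma shape_vertex: "z \<in> mesh_vertices \<T> \<Longrightarrow> shape z x = hat z x * (2 * hat z x - 1)"
  unfolding shape_def by simp

text \<open>The midpoint of an edge remembers its endpoints: they are the vertices whose hat
  function takes the value 1/2 there.\<close>

lemma hat_half_iff: "edge c d \<Longrightarrow> hat a (midpoint c d) = 1/2 \<longleftrightarrow> a = c \<or> a = d"
  unfolding edge_def[of c d] by (subst hat_midpoint) (auto simp: edge_def)

lemma shape_midpoint:
  assumes "edge a b"
  shows "shape (midpoint a b) x = 4 * (hat a x * hat b x)"
proof -
  have "a \<noteq> b" using assms edge_def by blast
  then have "midpoint a b \<notin> mesh_vertices \<T>"
    using edge_not_vertex[OF assms] by simp
  define p where "p = (SOME p. (case p of (c, d) \<Rightarrow> edge c d \<and> midpoint a b = midpoint c d))"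
  obtain c d where p: "p = (c, d)" by (cases p)
  have "case p of (c, d) \<Rightarrow> edge c d \<and> midpoint a b = midpoint c d"
    unfolding p_def by (rule someI[of _ "(a, b)"]) (use assms in simp)
  then have cd: "edge c d" "midpoint a b = midpoint c d" using p by auto
  have "a \<in> {c, d}" "b \<in> {c, d}"
    using hat_half_iff[OF cd(1)] hat_half_iff[OF assms] cd(2) by auto
  then have "(c = a \<and> d = b) \<or> (c = b \<and> d = a)" using \<open>a \<noteq> b\<close> by auto
  moreover have "shape (midpoint a b) x = 4 * (hat c x * hat d x)"
    using \<open>midpoint a b \<notin> _\<close> p unfolding shape_def p_def by simp
  ultimately show ?thesis by (auto simp: mult.commute)
qed

lemma shape_node:
  assumes "z \<in> mesh_nodes \<T>" "z' \<in> mesh_nodes \<T>"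
  shows "shape z z' = of_bool (z = z')"
proof -
  consider "z \<in> mesh_vertices \<T>" | a b where "edge a b" "z = midpoint a b"
    using assms(1) unfolding mesh_nodes_eq by blast
  then show ?thesis
  proof cases
    case 1
    consider "z' \<in> mesh_vertices \<T>" | a b where "edge a b" "z' = midpoint a b"
      using assms(2) unfolding mesh_nodes_eq by blast
    then show ?thesis
    proof cases
      case 1
      then show ?thesis using \<open>z \<in> mesh_vertices \<T>\<close> by (auto simp: shape_vertex hat_vertex)
    next
      case (2 a b)
      have "a \<noteq> b" using 2 edge_def by blast
      then have "z' \<notin> mesh_vertices \<T>" using 2 edge_not_vertex by simp
      then show ?thesis using \<open>z \<in> mesh_vertices \<T>\<close> 2 \<open>a \<noteq> b\<close>
        by (auto simp: shape_vertex hat_midpoint)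
    qed
  next
    case (2 a b)
    have ab: "a \<noteq> b" using 2 edge_def by blast
    then have nz: "z \<notin> mesh_vertices \<T>" using 2 edge_not_vertex by simp
    consider "z' \<in> mesh_vertices \<T>" | c d where "edge c d" "z' = midpoint c d"
      using assms(2) unfolding mesh_nodes_eq by blast
    then show ?thesis
    proof cases
      case 1
      then show ?thesis using 2 ab nz by (auto simp: shape_midpoint hat_vertex)
    next
      case (2 c d)
      have cd: "c \<noteq> d" using 2 edge_def by blast
      show ?thesis
      proof (cases "{a, b} = {c, d}")
        case True
        then have "(c = a \<and> d = b) \<or> (c = b \<and> d = a)" by (auto simp: doubleton_eq_iff)
        then have "z = z'" using \<open>z = midpoint a b\<close> 2(2) by (auto simp: midpoint_sym)
        moreover have "hat a z = 1/2" "hat b z = 1/2"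
          using hat_half_iff[OF \<open>edge a b\<close>] \<open>z = midpoint a b\<close> by auto
        moreover have "shape z z = 4 * (hat a z * hat b z)"
          using shape_midpoint[OF \<open>edge a b\<close>] \<open>z = midpoint a b\<close> by simp
        ultimately have "shape z z = 4 * (1/2 * (1/2))" by (simp only:)
        then show ?thesis using \<open>z = z'\<close> by simp
      next
        case False
        then have "\<not> (a \<in> {c, d} \<and> b \<in> {c, d})" using ab cd by auto
        then have "shape z z' = 0"
          using \<open>edge a b\<close> \<open>z = midpoint a b\<close> 2 by (auto simp: shape_midpoint hat_midpoint)
        moreover have "z \<noteq> z'"
        proof
          assume "z = z'"
          then have "a \<in> {c, d}" "b \<in> {c, d}"
            using hat_half_iff[OF 2(1)] hat_half_iff[OF \<open>edge a b\<close>] 2(2) \<open>z = midpoint a b\<close> by auto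
          then show False using \<open>\<not> (a \<in> {c, d} \<and> b \<in> {c, d})\<close> by blast
        qed
        ultimately show ?thesis by simp
      qed
    qed
  qed
qed

lemma hat_in_Q: "hat a \<in> Q_space \<Omega> \<T>"
  unfolding Q_space_def using hat_continuous hat_poly_on by blast

text \<open>One formula for both kinds of nodes: s = 2, t = -1 and b = a for a vertex, s = 4 and t =
  0 for a midpoint. Membership in the spaces and divergences are then treated only once.\<close>

lemma shape_cases:
  assumes "z \<in> mesh_nodes \<T>"
  obtains a b s t where "shape z = (\<lambda>x. s * (hat a x * hat b x) + t * hat a x)"
proof -
  consider "z \<in> mesh_vertices \<T>" | a b where "edge a b" "z = midpoint a b"
    using assms unfolding mesh_nodes_eq by blast
  then show ?thesis
  proof cases
    case 1
    then have "shape z = (\<lambda>x. 2 * (hat z x * hat z x) + (-1) * hat z x)"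
      by (auto simp: shape_vertex algebra_simps)
    then show ?thesis using that by blast
  next
    case (2 a b)
    then have "shape z = (\<lambda>x. 4 * (hat a x * hat b x) + 0 * hat a x)"
      by (auto simp: shape_midpoint)
    then show ?thesis using that by blast
  qed
qed

lemma shape_continuous:
  assumes "z \<in> mesh_nodes \<T>"
  shows "continuous_on (closure \<Omega>) (shape z)"
proof -
  obtain a b s t where s: "shape z = (\<lambda>x. s * (hat a x * hat b x) + t * hat a x)"
    using shape_cases assms by blast
  show ?thesis unfolding s by (intro continuous_intros hat_continuous)
qed

lemma shape_poly_on:
  assumes "z \<in> mesh_nodes \<T>" "T \<in> \<T>"
  shows "poly_on 2 T (shape z)"
proof -
  obtain a b s t where s: "shape z = (\<lambda>x. s * (hat a x * hat b x) + t * hat a x)"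
    using shape_cases assms(1) by blast
  have "poly_on 2 T (hat a)" using hat_poly_on[OF assms(2), of a] polys_1_subset_2 unfolding poly_on_def by blast
  then show ?thesis
    unfolding s by (intro poly_on_add poly_on_scale poly_on_mult hat_poly_on assms(2))
qed

end

lemma polys_2_has_derivative:
  assumes "p \<in> polys 2"
  shows "\<exists>d1\<in>polys 1. \<exists>d2\<in>polys 1. \<forall>x. (p has_derivative (\<lambda>w. d1 x * w $ 1 + d2 x * w $ 2)) (at x)"
proof -
  obtain c0 c1 c2 c3 c4 c5 where p:
    "p = (\<lambda>x. c0 + c1 * x $ 1 + c2 * x $ 2 + c3 * (x $ 1)\<^sup>2 + c4 * (x $ 1 * x $ 2) + c5 * (x $ 2)\<^sup>2)"
    using assms polys_2_iff by blast
  define d1 :: "real^2 \<Rightarrow> real" where "d1 = (\<lambda>x. c1 + (vector [2 * c3, c4] :: real^2) \<bullet> x)"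
  define d2 :: "real^2 \<Rightarrow> real" where "d2 = (\<lambda>x. c2 + (vector [c4, 2 * c5] :: real^2) \<bullet> x)"
  show ?thesis
  proof (rule bexI[of _ d1], rule bexI[of _ d2], rule allI)
    show "d1 \<in> polys 1" "d2 \<in> polys 1" unfolding d1_def d2_def polys_1_iff by blast+
    have h: "((\<lambda>x::real^2. x $ i) has_derivative (\<lambda>w. w $ i)) (at x)" for i x
      by (rule bounded_linear.has_derivative[OF bounded_linear_vec_nth has_derivative_ident])
    show "(p has_derivative (\<lambda>w. d1 x * w $ 1 + d2 x * w $ 2)) (at x)" for x
      unfolding p d1_def d2_def inner_vec_def sum_2 vector_2 inner_real_def power2_eq_square
      by (rule has_derivative_eq_rhs, (rule has_derivative_add has_derivative_const has_derivative_mult h)+)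
        (auto simp: fun_eq_iff algebra_simps)
  qed
qed

lemma integrable_lebesgue_on_iff:
  fixes F :: "'a::euclidean_space \<Rightarrow> real"
  assumes "S \<in> sets lebesgue"
  shows "integrable (lebesgue_on S) F \<longleftrightarrow> F absolutely_integrable_on S"
  using assms by (simp add: integrable_restrict_space set_integrable_def)

subsection \<open>Piecewise continuous functions and the bilinear forms\<close>

context triangulated_domain
begin

text \<open>The continuous representative is taken on the whole plane, so it is bounded on the
  compact cell and integrability follows. On the cell frontiers F is left free, which accommodates
  the arbitrary values of derivatives there.\<close>

definition piecewise :: "(real^2 \<Rightarrow> real) \<Rightarrow> bool" where
  "piecewise F \<longleftrightarrow> (\<forall>T\<in>\<T>. \<exists>G. continuous_on UNIV G \<and> (\<forall>x\<in>interior T. F x = G x))"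

lemma piecewiseI: "(\<And>T. T \<in> \<T> \<Longrightarrow> \<exists>G. continuous_on UNIV G \<and> (\<forall>x\<in>interior T. F x = G x)) \<Longrightarrow> piecewise F"
  unfolding piecewise_def by blast

lemma piecewise_add:
  assumes "piecewise F" "piecewise G"
  shows "piecewise (\<lambda>x. F x + G x)"
proof (rule piecewiseI)
  fix T assume T: "T \<in> \<T>"
  obtain F' where "continuous_on UNIV F'" "\<forall>x\<in>interior T. F x = F' x"
    using assms(1) T unfolding piecewise_def by blast
  moreover obtain G' where "continuous_on UNIV G'" "\<forall>x\<in>interior T. G x = G' x"
    using assms(2) T unfolding piecewise_def by blast
  ultimately show "\<exists>H. continuous_on UNIV H \<and> (\<forall>x\<in>interior T. F x + G x = H x)"
    by (intro exI[of _ "\<lambda>x. F' x + G' x"]) (auto intro: continuous_intros)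
qed

lemma piecewise_mult:
  assumes "piecewise F" "piecewise G"
  shows "piecewise (\<lambda>x. F x * G x)"
proof (rule piecewiseI)
  fix T assume T: "T \<in> \<T>"
  obtain F' where "continuous_on UNIV F'" "\<forall>x\<in>interior T. F x = F' x"
    using assms(1) T unfolding piecewise_def by blast
  moreover obtain G' where "continuous_on UNIV G'" "\<forall>x\<in>interior T. G x = G' x"
    using assms(2) T unfolding piecewise_def by blast
  ultimately show "\<exists>H. continuous_on UNIV H \<and> (\<forall>x\<in>interior T. F x * G x = H x)"
    by (intro exI[of _ "\<lambda>x. F' x * G' x"]) (auto intro: continuous_intros)
qed

lemma piecewise_const: "piecewise (\<lambda>x. c)"
  unfolding piecewise_def by (intro ballI exI[of _ "\<lambda>_. c"]) auto

lemma piecewise_cong: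
  assumes "piecewise F" "\<And>T x. T \<in> \<T> \<Longrightarrow> x \<in> interior T \<Longrightarrow> F x = G x"
  shows "piecewise G"
proof (rule piecewiseI)
  fix T assume T: "T \<in> \<T>"
  obtain F' where "continuous_on UNIV F'" "\<forall>x\<in>interior T. F x = F' x"
    using assms(1) T unfolding piecewise_def by blast
  then show "\<exists>H. continuous_on UNIV H \<and> (\<forall>x\<in>interior T. G x = H x)"
    using assms(2)[OF T] by (intro exI[of _ F']) simp
qed

lemma cell_sets: "T \<in> \<T> \<Longrightarrow> T \<in> sets lebesgue"
  using cell_compact by (blast intro: fmeasurableD lmeasurable_compact)

lemma domain_sets: "\<Omega> \<in> sets lebesgue"
  using open_domain by auto

lemma negligible_frontier_cell: "T \<in> \<T> \<Longrightarrow> negligible (frontier T)"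
  using cell_convex negligible_convex_frontier by blast

lemma negligible_skeleton: "negligible (\<Union>T\<in>\<T>. frontier T)"
  using finite_mesh negligible_frontier_cell by (intro negligible_Union) auto

lemma not_interior_skeleton:
  assumes "x \<in> closure \<Omega>" "\<And>T. T \<in> \<T> \<Longrightarrow> x \<notin> interior T"
  shows "x \<in> (\<Union>T\<in>\<T>. frontier T)"
proof -
  obtain T where T: "T \<in> \<T>" "x \<in> T" by (rule in_closure_cell[OF assms(1)])
  then have "x \<in> frontier T"
    using assms(2)[OF T(1)] closure_subset[of T] by (auto simp: frontier_def)
  with T(1) show ?thesis by blast
qed

lemma AE_interior_cell: "AE x in lebesgue_on \<Omega>. \<exists>T\<in>\<T>. x \<in> interior T"
proof -
  have "AE x in lebesgue. x \<notin> (\<Union>T\<in>\<T>. frontier T)"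
    using negligible_skeleton unfolding negligible_iff_null_sets by (rule AE_not_in)
  then have "AE x in lebesgue. x \<in> \<Omega> \<longrightarrow> (\<exists>T\<in>\<T>. x \<in> interior T)"
    by eventually_elim (use not_interior_skeleton closure_subset in blast)
  then show ?thesis using domain_sets by (simp add: AE_restrict_space_iff)
qed

text \<open>A face that meets the interior of its cell is the whole cell. Distinct cells therefore
  meet only in their frontiers.\<close>

lemma negligible_cell_overlap:
  assumes "T \<in> \<T>" "T' \<in> \<T>" "T \<noteq> T'"
  shows "negligible (T \<inter> T')"
proof (rule negligible_subset)
  show "negligible (frontier T \<union> frontier T')"
    using assms negligible_frontier_cell by simp
  have "T \<inter> T' \<inter> interior T = {} \<or> T' \<inter> T \<inter> interior T' = {}"
    using face_of_disjoint_interior[OF mesh_face[OF assms(1,2)]]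
      face_of_disjoint_interior[OF mesh_face[OF assms(2,1)]] assms(3) by (metis Int_commute)
  then show "T \<inter> T' \<subseteq> frontier T \<union> frontier T'"
    using closure_subset unfolding frontier_def by blast
qed

lemma piecewise_integrable_cell:
  assumes "piecewise F" "T \<in> \<T>"
  shows "integrable (lebesgue_on T) F"
proof -
  obtain G where G: "continuous_on UNIV G" "\<And>x. x \<in> interior T \<Longrightarrow> F x = G x"
    using assms unfolding piecewise_def by blast
  have "integrable (lebesgue_on T) G"
    using cell_compact[OF assms(2)] G(1) by (intro integrable_lebesgue_on_compact) (auto elim: continuous_on_subset)
  then have "G absolutely_integrable_on T"
    using integrable_lebesgue_on_iff cell_sets assms(2) by blast
  then have "F absolutely_integrable_on T"
    by (rule absolutely_integrable_spike[OF _ negligible_frontier_cell[OF assms(2)]])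
      (use G(2) closure_subset[of T] in \<open>auto simp: frontier_def\<close>)
  then show ?thesis
    using integrable_lebesgue_on_iff cell_sets assms(2) by blast
qed

text \<open>The frontier of \<Omega> is contained in the union of the frontiers of the cells and
  hence is negligible. So \<Omega> may be replaced by its closure, which is the union of cells with
  negligible overlaps.\<close>

lemma piecewise_integral:
  assumes F: "piecewise F"
  shows "integrable (lebesgue_on \<Omega>) F"
    and "(LINT x|lebesgue_on \<Omega>. F x) = (\<Sum>T\<in>\<T>. LINT x|lebesgue_on T. F x)"
proof -
  have i: "F absolutely_integrable_on T" if "T \<in> \<T>" for T
    using piecewise_integrable_cell[OF F that] integrable_lebesgue_on_iff cell_sets[OF that] by blast
  have "F absolutely_integrable_on \<Union>\<S>" if "\<S> \<subseteq> \<T>" for \<S>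
    using finite_subset[OF that finite_mesh] that
  proof (induction \<S> rule: finite_induct)
    case (insert T \<S>)
    then show ?case using i by (auto intro!: absolutely_integrable_Un)
  qed simp
  then have c: "F absolutely_integrable_on closure \<Omega>" using mesh_covers by force
  have sub: "frontier \<Omega> \<subseteq> (\<Union>T\<in>\<T>. frontier T)"
    using not_interior_skeleton interior_cell_subset frontier_iff by blast
  have n: "negligible (frontier \<Omega>)"
    by (rule negligible_subset[OF negligible_skeleton sub])
  have o: "F absolutely_integrable_on \<Omega>"
    by (rule absolutely_integrable_spike_set[OF c])
      (rule negligible_subset[OF n], use frontier_iff closure_subset in blast)+
  then show "integrable (lebesgue_on \<Omega>) F"
    using integrable_lebesgue_on_iff domain_sets by blast
  then have "(LINT x|lebesgue_on \<Omega>. F x) = integral \<Omega> F"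
    using domain_sets by (rule lebesgue_integral_eq_integral)
  also have "\<dots> = integral (closure \<Omega>) F"
    by (rule integral_spike_set)
      (rule negligible_subset[OF n], use frontier_iff closure_subset in blast)+
  also have "\<dots> = (\<Sum>T\<in>\<T>. integral T F)"
    unfolding mesh_covers[symmetric]
  proof (rule integral_unique, rule has_integral_Union[OF finite_mesh])
    show "(F has_integral integral T F) T" if "T \<in> \<T>" for T
      using i[OF that] by (meson absolutely_integrable_on_def integrable_integral)
    show "pairwise (\<lambda>S S'. negligible (S \<inter> S')) \<T>"
      using negligible_cell_overlap by (simp add: pairwise_def)
  qed
  also have "\<dots> = (\<Sum>T\<in>\<T>. LINT x|lebesgue_on T. F x)"
    using piecewise_integrable_cell[OF F] cell_sets by (intro sum.cong refl lebesgue_integral_eq_integral[symmetric]) auto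
  finally show "(LINT x|lebesgue_on \<Omega>. F x) = (\<Sum>T\<in>\<T>. LINT x|lebesgue_on T. F x)" .
qed

lemma piecewise_integral_cong:
  assumes "piecewise F" "\<And>T x. T \<in> \<T> \<Longrightarrow> x \<in> interior T \<Longrightarrow> F x = G x"
  shows "(LINT x|lebesgue_on \<Omega>. F x) = (LINT x|lebesgue_on \<Omega>. G x)"
proof (rule integral_cong_AE)
  show "F \<in> borel_measurable (lebesgue_on \<Omega>)" "G \<in> borel_measurable (lebesgue_on \<Omega>)"
    using piecewise_integral(1)[OF assms(1)] piecewise_integral(1)[OF piecewise_cong[OF assms]] by auto
  show "AE x in lebesgue_on \<Omega>. F x = G x"
    using AE_interior_cell by eventually_elim (use assms(2) in blast)
qed

lemma V_space_add: "u \<in> V_space \<Omega> \<T> \<Longrightarrow> v \<in> V_space \<Omega> \<T> \<Longrightarrow> (\<lambda>x. u x + v x) \<in> V_space \<Omega> \<T>"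
  unfolding V_space_def by (auto intro: continuous_on_add poly_on_add)

lemma V_space_scale: "u \<in> V_space \<Omega> \<T> \<Longrightarrow> (\<lambda>x. c *\<^sub>R u x) \<in> V_space \<Omega> \<T>"
  unfolding V_space_def by (auto intro: continuous_on_scaleR poly_on_scale)

lemma Q_space_add: "p \<in> Q_space \<Omega> \<T> \<Longrightarrow> q \<in> Q_space \<Omega> \<T> \<Longrightarrow> (\<lambda>x. p x + q x) \<in> Q_space \<Omega> \<T>"
  unfolding Q_space_def by (auto intro: continuous_on_add poly_on_add)

lemma Q_space_scale: "p \<in> Q_space \<Omega> \<T> \<Longrightarrow> (\<lambda>x. c * p x) \<in> Q_space \<Omega> \<T>"
  unfolding Q_space_def by (auto intro: continuous_on_mult poly_on_scale)

lemma Q_space_piecewise: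
  assumes "q \<in> Q_space \<Omega> \<T>" shows "piecewise q"
proof (rule piecewiseI)
  fix T assume "T \<in> \<T>"
  then obtain p where "p \<in> polys 1" "\<forall>x\<in>T. q x = p x"
    using assms unfolding Q_space_def poly_on_def by blast
  then show "\<exists>G. continuous_on UNIV G \<and> (\<forall>x\<in>interior T. q x = G x)"
    using continuous_on_affine interior_subset by blast
qed

text \<open>Inside a cell the partial derivatives coincide with affine polynomials
  \<open>P i j\<close> defined on the whole plane; these serve as the representatives demanded by
  \<open>piecewise\<close>.\<close>

lemma V_space_derivative:
  assumes "u \<in> V_space \<Omega> \<T>" "T \<in> \<T>"
  shows "\<exists>P. (\<forall>i j. P i j \<in> polys 1) \<and>
    (\<forall>x\<in>interior T. (u has_derivative (\<lambda>w. \<chi> i. P i 1 x * w $ 1 + P i 2 x * w $ 2)) (at x)) \<and>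
    (\<forall>x\<in>interior T. \<forall>i j. pderiv_comp u i j x = P i j x)"
proof -
  have "\<exists>p. p \<in> polys 2 \<and> (\<forall>x\<in>T. u x $ i = p x)" for i
    using assms unfolding V_space_def poly_on_def by blast
  then obtain p where p: "\<And>i. p i \<in> polys 2" "\<And>i x. x \<in> T \<Longrightarrow> u x $ i = p i x" by metis
  have "\<forall>i. \<exists>d. fst d \<in> polys 1 \<and> snd d \<in> polys 1 \<and>
      (\<forall>x. (p i has_derivative (\<lambda>w. fst d x * w $ 1 + snd d x * w $ 2)) (at x))"
    using polys_2_has_derivative[OF p(1)] by (simp add: split_paired_Ex Bex_def)
  from choice[OF this] obtain d where d': "\<forall>i. fst (d i) \<in> polys 1 \<and> snd (d i) \<in> polys 1 \<and>
      (\<forall>x. (p i has_derivative (\<lambda>w. fst (d i) x * w $ 1 + snd (d i) x * w $ 2)) (at x))" ..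
  define d1 where "d1 i = fst (d i)" for i
  define d2 where "d2 i = snd (d i)" for i
  have d: "d1 i \<in> polys 1" "d2 i \<in> polys 1"
      "(p i has_derivative (\<lambda>w. d1 i x * w $ 1 + d2 i x * w $ 2)) (at x)" for i x
    using d' unfolding d1_def d2_def by auto
  define P where "P i j = (if j = 1 then d1 i else d2 i)" for i j :: 2
  have D: "(u has_derivative (\<lambda>w. \<chi> i. P i 1 x * w $ 1 + P i 2 x * w $ 2)) (at x)" if "x \<in> interior T" for x
  proof (rule has_derivative_transform_within_open[OF _ open_interior that])
    show "((\<lambda>x. \<chi> i. p i x) has_derivative (\<lambda>w. \<chi> i. P i 1 x * w $ 1 + P i 2 x * w $ 2)) (at x)"
      unfolding has_derivative_componentwise_within[of "\<lambda>x. \<chi> i. p i x"]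
      using d(3) by (auto simp: Basis_vec_def inner_axis P_def)
    show "(\<chi> i. p i y) = u y" if "y \<in> interior T" for y
      using p(2) subsetD[OF interior_subset that] by (simp add: vec_eq_iff)
  qed
  show ?thesis
  proof (intro exI[of _ P] conjI ballI allI)
    show "P i j \<in> polys 1" for i j using d by (simp add: P_def)
    show "pderiv_comp u i j x = P i j x" if "x \<in> interior T" for x i j
      using frechet_derivative_at[OF D[OF that], symmetric] exhaust_2[of j]
      by (auto simp: pderiv_comp_def axis_def)
  qed (use D in blast)
qed

lemma V_space_differentiable:
  assumes "u \<in> V_space \<Omega> \<T>" "T \<in> \<T>" "x \<in> interior T"
  shows "u differentiable (at x)"
proof -
  obtain P :: "2 \<Rightarrow> 2 \<Rightarrow> real^2 \<Rightarrow> real" where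
    "(u has_derivative (\<lambda>w. \<chi> i. P i 1 x * w $ 1 + P i 2 x * w $ 2)) (at x)"
    using V_space_derivative[OF assms(1,2)] assms(3) by blast
  then show ?thesis by (rule differentiableI)
qed

lemma pderiv_comp_piecewise:
  assumes "u \<in> V_space \<Omega> \<T>" shows "piecewise (pderiv_comp u i j)"
proof (rule piecewiseI)
  fix T assume "T \<in> \<T>"
  then obtain P where "\<And>i j. P i j \<in> polys 1"
    "\<And>x i j. x \<in> interior T \<Longrightarrow> pderiv_comp u i j x = P i j x"
    using V_space_derivative[OF assms] by blast
  then show "\<exists>G. continuous_on UNIV G \<and> (\<forall>x\<in>interior T. pderiv_comp u i j x = G x)"
    by (intro exI[of _ "P i j"]) (simp add: continuous_on_affine)
qed

lemma pderiv_comp_add: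
  assumes "u \<in> V_space \<Omega> \<T>" "v \<in> V_space \<Omega> \<T>" "T \<in> \<T>" "x \<in> interior T"
  shows "pderiv_comp (\<lambda>x. u x + v x) i j x = pderiv_comp u i j x + pderiv_comp v i j x"
proof -
  have "frechet_derivative (\<lambda>x. u x + v x) (at x)
      = (\<lambda>w. frechet_derivative u (at x) w + frechet_derivative v (at x) w)"
    using V_space_differentiable assms
    by (intro frechet_derivative_at[symmetric] has_derivative_add) (auto simp: frechet_derivative_works)
  then show ?thesis by (simp add: pderiv_comp_def)
qed

lemma pderiv_comp_scale:
  assumes "u \<in> V_space \<Omega> \<T>" "T \<in> \<T>" "x \<in> interior T"
  shows "pderiv_comp (\<lambda>x. c *\<^sub>R u x) i j x = c * pderiv_comp u i j x"
proof -
  have "frechet_derivative (\<lambda>x. c *\<^sub>R u x) (at x) = (\<lambda>w. c *\<^sub>R frechet_derivative u (at x) w)"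
    using V_space_differentiable assms
    by (intro frechet_derivative_at[symmetric] has_derivative_scaleR_right) (auto simp: frechet_derivative_works)
  then show ?thesis by (simp add: pderiv_comp_def)
qed

lemma pderiv_comp_cong:
  assumes "u \<in> V_space \<Omega> \<T>" "\<And>x. x \<in> closure \<Omega> \<Longrightarrow> u x = v x" "T \<in> \<T>" "x \<in> interior T"
  shows "pderiv_comp u i j x = pderiv_comp v i j x"
proof -
  have "(v has_derivative frechet_derivative u (at x)) (at x)"
  proof (rule has_derivative_transform_within_open[OF _ open_interior assms(4)])
    show "(u has_derivative frechet_derivative u (at x)) (at x)"
      using V_space_differentiable[OF assms(1,3,4)] frechet_derivative_works by blast
    show "u y = v y" if "y \<in> interior T" for y
      using that assms(2) cell_subset[OF assms(3)] interior_subset by blast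
  qed
  then show ?thesis using frechet_derivative_at unfolding pderiv_comp_def by metis
qed

lemma strain_piecewise: "u \<in> V_space \<Omega> \<T> \<Longrightarrow> piecewise (strain u i j)"
  unfolding strain_def[abs_def] divide_inverse
  by (intro piecewise_mult piecewise_add pderiv_comp_piecewise piecewise_const)

lemma divergence_piecewise: "u \<in> V_space \<Omega> \<T> \<Longrightarrow> piecewise (divergence u)"
  unfolding divergence_def[abs_def] sum_2
  by (intro piecewise_add pderiv_comp_piecewise)

text \<open>Functions are total, so the third condition demands that values outside the closure of
  \<Omega> have no influence. It allows a velocity to be replaced by its nodal expansion, which
  equals it only on that closure.\<close>

definition V_linear :: "((real^2 \<Rightarrow> real^2) \<Rightarrow> real) \<Rightarrow> bool" where
  "V_linear L \<longleftrightarrow>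
     (\<forall>u\<in>V_space \<Omega> \<T>. \<forall>v\<in>V_space \<Omega> \<T>. L (\<lambda>x. u x + v x) = L u + L v) \<and>
     (\<forall>u\<in>V_space \<Omega> \<T>. \<forall>c. L (\<lambda>x. c *\<^sub>R u x) = c * L u) \<and>
     (\<forall>u\<in>V_space \<Omega> \<T>. \<forall>v. (\<forall>x\<in>closure \<Omega>. u x = v x) \<longrightarrow> L u = L v)"

lemma V_linear_sum_scale:
  assumes "finite I" "\<And>i. i \<in> I \<Longrightarrow> V_linear (L i)"
  shows "V_linear (\<lambda>u. \<Sum>i\<in>I. c i * L i u)"
  using assms(2) unfolding V_linear_def
  by (auto simp: distrib_left sum.distrib sum_distrib_left mult.left_commute intro!: sum.cong)

text \<open>The differential expression E has to be linear only in the interiors of the cells, where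
  the velocities are differentiable; the remaining points form a null set.\<close>

lemma V_linear_integral:
  assumes E: "\<And>u. u \<in> V_space \<Omega> \<T> \<Longrightarrow> piecewise (E u)" and F: "piecewise F"
    and add: "\<And>u v T x. u \<in> V_space \<Omega> \<T> \<Longrightarrow> v \<in> V_space \<Omega> \<T> \<Longrightarrow> T \<in> \<T> \<Longrightarrow> x \<in> interior T \<Longrightarrow>
      E (\<lambda>x. u x + v x) x = E u x + E v x"
    and scale: "\<And>u c T x. u \<in> V_space \<Omega> \<T> \<Longrightarrow> T \<in> \<T> \<Longrightarrow> x \<in> interior T \<Longrightarrow> E (\<lambda>x. c *\<^sub>R u x) x = c * E u x"
    and cong: "\<And>u v T x. u \<in> V_space \<Omega> \<T> \<Longrightarrow> (\<And>x. x \<in> closure \<Omega> \<Longrightarrow> u x = v x) \<Longrightarrow>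
      T \<in> \<T> \<Longrightarrow> x \<in> interior T \<Longrightarrow> E u x = E v x"
  shows "V_linear (\<lambda>u. LINT x|lebesgue_on \<Omega>. E u x * F x)"
proof -
  have "(LINT x|lebesgue_on \<Omega>. E (\<lambda>x. u x + v x) x * F x) =
      (LINT x|lebesgue_on \<Omega>. E u x * F x) + (LINT x|lebesgue_on \<Omega>. E v x * F x)"
    if "u \<in> V_space \<Omega> \<T>" "v \<in> V_space \<Omega> \<T>" for u v
  proof -
    have "(LINT x|lebesgue_on \<Omega>. E (\<lambda>x. u x + v x) x * F x) = (LINT x|lebesgue_on \<Omega>. E u x * F x + E v x * F x)"
      using that by (intro piecewise_integral_cong piecewise_mult E F V_space_add) (auto simp: add distrib_right)
    also have "\<dots> = (LINT x|lebesgue_on \<Omega>. E u x * F x) + (LINT x|lebesgue_on \<Omega>. E v x * F x)"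
      by (intro Bochner_Integration.integral_add piecewise_integral(1) piecewise_mult E F that)
    finally show ?thesis .
  qed
  moreover have "(LINT x|lebesgue_on \<Omega>. E (\<lambda>x. c *\<^sub>R u x) x * F x) = c * (LINT x|lebesgue_on \<Omega>. E u x * F x)"
    if "u \<in> V_space \<Omega> \<T>" for u c
  proof -
    have "(LINT x|lebesgue_on \<Omega>. E (\<lambda>x. c *\<^sub>R u x) x * F x) = (LINT x|lebesgue_on \<Omega>. c * (E u x * F x))"
      using that by (intro piecewise_integral_cong piecewise_mult E F V_space_scale) (auto simp: scale)
    then show ?thesis by simp
  qed
  moreover have "(LINT x|lebesgue_on \<Omega>. E u x * F x) = (LINT x|lebesgue_on \<Omega>. E v x * F x)"
    if "u \<in> V_space \<Omega> \<T>" "\<forall>x\<in>closure \<Omega>. u x = v x" for u v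
    using that by (intro piecewise_integral_cong piecewise_mult E F) (auto simp: cong[of u v])
  ultimately show ?thesis unfolding V_linear_def by blast
qed

lemma V_linear_form_a:
  assumes "v \<in> V_space \<Omega> \<T>"
  shows "V_linear (\<lambda>u. form_a \<nu> \<Omega> u v)"
proof -
  have "V_linear (\<lambda>u. LINT x|lebesgue_on \<Omega>. strain u i j x * strain v i j x)" for i j
  proof (rule V_linear_integral[OF strain_piecewise strain_piecewise[OF assms]])
    fix u v :: "real^2 \<Rightarrow> real^2" and T x and c :: real
    assume u: "u \<in> V_space \<Omega> \<T>" and T: "T \<in> \<T>" "x \<in> interior T"
    show "strain (\<lambda>x. u x + v x) i j x = strain u i j x + strain v i j x" if "v \<in> V_space \<Omega> \<T>"
      unfolding strain_def pderiv_comp_add[OF u that T] by (simp add: field_simps)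
    show "strain (\<lambda>x. c *\<^sub>R u x) i j x = c * strain u i j x"
      unfolding strain_def pderiv_comp_scale[OF u T] by (simp add: field_simps)
    show "strain u i j x = strain v i j x" if "\<And>x. x \<in> closure \<Omega> \<Longrightarrow> u x = v x"
      by (simp add: strain_def pderiv_comp_cong[OF u that T])
  qed auto
  then have "V_linear (\<lambda>u. \<Sum>i\<in>UNIV. 1 * (\<Sum>j\<in>UNIV. (2 * \<nu>) * (LINT x|lebesgue_on \<Omega>. strain u i j x * strain v i j x)))"
    by (intro V_linear_sum_scale) auto
  then show ?thesis by (simp add: form_a_def sum_distrib_left)
qed

lemma form_a_commute: "form_a \<nu> \<Omega> u v = form_a \<nu> \<Omega> v u"
  by (simp add: form_a_def mult.commute)

lemma V_linear_form_b:
  assumes "q \<in> Q_space \<Omega> \<T>"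
  shows "V_linear (\<lambda>u. form_b \<Omega> u q)"
proof -
  have "V_linear (\<lambda>u. LINT x|lebesgue_on \<Omega>. divergence u x * q x)"
  proof (rule V_linear_integral[OF divergence_piecewise Q_space_piecewise[OF assms]])
    fix u v :: "real^2 \<Rightarrow> real^2" and T x and c :: real
    assume u: "u \<in> V_space \<Omega> \<T>" and T: "T \<in> \<T>" "x \<in> interior T"
    show "divergence (\<lambda>x. u x + v x) x = divergence u x + divergence v x" if "v \<in> V_space \<Omega> \<T>"
      unfolding divergence_def pderiv_comp_add[OF u that T] by (rule sum.distrib)
    show "divergence (\<lambda>x. c *\<^sub>R u x) x = c * divergence u x"
      unfolding divergence_def pderiv_comp_scale[OF u T] by (rule sum_distrib_left[symmetric])
    show "divergence u x = divergence v x" if "\<And>x. x \<in> closure \<Omega> \<Longrightarrow> u x = v x"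
      by (simp add: divergence_def pderiv_comp_cong[OF u that T])
  qed auto
  from V_linear_sum_scale[of "{()}" "\<lambda>_. _" "\<lambda>_. -1", OF _ this]
  show ?thesis by (simp add: form_b_def)
qed

lemma form_b_add:
  assumes "u \<in> V_space \<Omega> \<T>" "p \<in> Q_space \<Omega> \<T>" "q \<in> Q_space \<Omega> \<T>"
  shows "form_b \<Omega> u (\<lambda>x. p x + q x) = form_b \<Omega> u p + form_b \<Omega> u q"
  using piecewise_integral(1)[OF piecewise_mult[OF divergence_piecewise[OF assms(1)] Q_space_piecewise[OF assms(2)]]]
    piecewise_integral(1)[OF piecewise_mult[OF divergence_piecewise[OF assms(1)] Q_space_piecewise[OF assms(3)]]]
  by (simp add: form_b_def distrib_left)

lemma form_b_scale: "form_b \<Omega> u (\<lambda>x. c * q x) = c * form_b \<Omega> u q"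
  by (simp add: form_b_def mult.left_commute)

lemma form_b_cong: "(\<And>x. x \<in> closure \<Omega> \<Longrightarrow> p x = q x) \<Longrightarrow> form_b \<Omega> u p = form_b \<Omega> u q"
  unfolding form_b_def using closure_subset[of \<Omega>]
  by (intro arg_cong[where f = uminus] Bochner_Integration.integral_cong) (auto simp: space_restrict_space)

lemma V_linear_L2_inner:
  assumes "L2_vec \<Omega> f"
  shows "V_linear (\<lambda>u. L2_inner \<Omega> f u)"
proof -
  have i: "integrable (lebesgue_on \<Omega>) (\<lambda>x. f x \<bullet> u x)" if u: "u \<in> V_space \<Omega> \<T>" for u
  proof -
    have c: "continuous_on (closure \<Omega>) u" using u unfolding V_space_def by blast
    then have "bounded (u ` closure \<Omega>)"
      using compact_closure_domain compact_continuous_image compact_imp_bounded by blast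
    then obtain C where C: "C > 0" "\<And>x. x \<in> closure \<Omega> \<Longrightarrow> norm (u x) \<le> C"
      unfolding bounded_pos by blast
    have m: "u \<in> borel_measurable (lebesgue_on \<Omega>)"
      using continuous_on_subset[OF c closure_subset] domain_sets
      by (rule continuous_imp_measurable_on_sets_lebesgue)
    have f: "f \<in> borel_measurable (lebesgue_on \<Omega>)" "integrable (lebesgue_on \<Omega>) (\<lambda>x. (norm (f x))\<^sup>2)"
      using assms unfolding L2_vec_def by auto
    \<comment> \<open>A dominating function: u is bounded by C on the compact closure, and the
      product of norms is estimated by the sum of squares.\<close>
    have "integrable (lebesgue_on \<Omega>) (\<lambda>x. (norm (f x))\<^sup>2 + C\<^sup>2)"
      using f(2) piecewise_integral(1)[OF piecewise_const[of "C\<^sup>2"]] by (rule Bochner_Integration.integrable_add)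
    then show ?thesis
    proof (rule Bochner_Integration.integrable_bound)
      show "(\<lambda>x. f x \<bullet> u x) \<in> borel_measurable (lebesgue_on \<Omega>)"
        using f(1) m by (rule borel_measurable_inner)
      have "norm (f x \<bullet> u x) \<le> norm ((norm (f x))\<^sup>2 + C\<^sup>2)" if "x \<in> \<Omega>" for x
      proof -
        have "\<bar>f x \<bullet> u x\<bar> \<le> norm (f x) * norm (u x)" by (rule Cauchy_Schwarz_ineq2)
        also have "\<dots> \<le> norm (f x) * C"
          using C that closure_subset by (intro mult_left_mono) auto
        also have "2 * (norm (f x) * C) \<le> (norm (f x))\<^sup>2 + C\<^sup>2"
          using sum_squares_bound[of "norm (f x)" C] by simp
        finally have "\<bar>f x \<bullet> u x\<bar> \<le> ((norm (f x))\<^sup>2 + C\<^sup>2)"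
          using C(1) by (smt (verit) mult_nonneg_nonneg norm_ge_zero)
        then show ?thesis by simp
      qed
      then show "AE x in lebesgue_on \<Omega>. norm (f x \<bullet> u x) \<le> norm ((norm (f x))\<^sup>2 + C\<^sup>2)"
        by (intro AE_I2) (auto simp: space_restrict_space)
    qed
  qed
  show ?thesis
    unfolding V_linear_def
  proof (intro conjI ballI allI impI)
    show "L2_inner \<Omega> f (\<lambda>x. u x + v x) = L2_inner \<Omega> f u + L2_inner \<Omega> f v"
      if "u \<in> V_space \<Omega> \<T>" "v \<in> V_space \<Omega> \<T>" for u v
      using i[OF that(1)] i[OF that(2)] by (simp add: L2_inner_def inner_add_right)
    show "L2_inner \<Omega> f (\<lambda>x. c *\<^sub>R u x) = c * L2_inner \<Omega> f u" for u c
      by (simp add: L2_inner_def)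
    show "L2_inner \<Omega> f u = L2_inner \<Omega> f v" if "\<forall>x\<in>closure \<Omega>. u x = v x" for u v
      using that closure_subset[of \<Omega>] unfolding L2_inner_def
      by (intro Bochner_Integration.integral_cong) (auto simp: space_restrict_space)
  qed
qed

lemma V_space_eq_of_nodes:
  assumes "u \<in> V_space \<Omega> \<T>" "v \<in> V_space \<Omega> \<T>" "\<And>z. z \<in> mesh_nodes \<T> \<Longrightarrow> u z = v z" "x \<in> closure \<Omega>"
  shows "u x = v x"
proof -
  obtain T where T: "T \<in> \<T>" "x \<in> T" using assms(4) in_closure_cell by blast
  obtain a b c where c: "cell a b c" "T = convex hull {a, b, c}" using cell_cases T by blast
  have e: "edge a b" "edge b c" "edge c a"
    using cell_edge c cell_rotate by blast+
  then have "{a, b, c, midpoint a b, midpoint b c, midpoint c a} \<subseteq> mesh_nodes \<T>"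
    unfolding mesh_nodes_eq using edge_vertices by blast
  then have z: "u z = v z" if "z \<in> {a, b, c, midpoint a b, midpoint b c, midpoint c a}" for z
    using assms(3) that by blast
  have "u x $ i + (-1) * v x $ i = 0" for i
  proof (rule poly_on_2_interpolation[of a b c "\<lambda>x. u x $ i + (-1) * v x $ i"])
    show "poly_on 2 (convex hull {a, b, c}) (\<lambda>x. u x $ i + (-1) * v x $ i)"
      using assms(1,2) T(1) c(2) unfolding V_space_def by (intro poly_on_add poly_on_scale) blast+
    show "x \<in> convex hull {a, b, c}" using T c by blast
  qed (simp_all add: z)
  then show ?thesis by (simp add: vec_eq_iff)
qed

end

section \<open>Divergence integrals of shape functions, and sums over the cells at an edge or a
  vertex\<close>

context triangulated_domain
begin

lemma cell_integral_cong:
  assumes "piecewise F" "T \<in> \<T>" "continuous_on UNIV G" "\<And>x. x \<in> interior T \<Longrightarrow> F x = G x"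
  shows "(LINT x|lebesgue_on T. F x) = (LINT x|lebesgue_on T. G x)"
proof (rule integral_cong_AE)
  have "integrable (lebesgue_on T) G"
    using cell_compact[OF assms(2)] continuous_on_subset[OF assms(3)] by (intro integrable_lebesgue_on_compact) auto
  then show "G \<in> borel_measurable (lebesgue_on T)" by auto
  show "F \<in> borel_measurable (lebesgue_on T)"
    using piecewise_integrable_cell[OF assms(1,2)] by auto
  have "AE x in lebesgue. x \<notin> frontier T"
    using negligible_frontier_cell[OF assms(2)] unfolding negligible_iff_null_sets by (rule AE_not_in)
  then have "AE x in lebesgue. x \<in> T \<longrightarrow> F x = G x"
  proof eventually_elim
    fix x assume "x \<notin> frontier T"
    then show "x \<in> T \<longrightarrow> F x = G x"
      using assms(4)[of x] closure_subset[of T] by (auto simp: frontier_def)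
  qed
  then show "AE x in lebesgue_on T. F x = G x"
    using cell_sets[OF assms(2)] by (simp add: AE_restrict_space_iff)
qed

lemma hat_combination_in_V:
  "(\<lambda>y. (s * (hat a y * hat b y) + t * hat a y) *\<^sub>R w) \<in> V_space \<Omega> \<T>"
proof -
  have "poly_on 2 T (hat a)" if "T \<in> \<T>" for T
    using hat_poly_on[OF that, of a] polys_1_subset_2 unfolding poly_on_def by blast
  then have p: "poly_on 2 T (\<lambda>y. s * (hat a y * hat b y) + t * hat a y)" if "T \<in> \<T>" for T
    using that by (intro poly_on_add poly_on_scale poly_on_mult hat_poly_on)
  have "poly_on 2 T (\<lambda>y. ((s * (hat a y * hat b y) + t * hat a y) *\<^sub>R w) $ i)" if "T \<in> \<T>" for T i
    using poly_on_scale[OF p[OF that], of "w $ i"] by (simp add: mult.commute)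
  moreover have "continuous_on (closure \<Omega>) (\<lambda>y. (s * (hat a y * hat b y) + t * hat a y) *\<^sub>R w)"
    by (intro continuous_intros hat_continuous)
  ultimately show ?thesis unfolding V_space_def by blast
qed

text \<open>For an affine p the difference \<open>p w - p 0\<close> is its derivative in direction
  w. The divergence of a scalar function times the constant vector w is the derivative in direction
  w, so the product rule gives the formula.\<close>

lemma divergence_hat_combination:
  assumes T: "T \<in> \<T>" "x \<in> interior T" and pq: "p \<in> polys 1" "q \<in> polys 1"
    and hat: "\<And>y. y \<in> T \<Longrightarrow> hat a y = p y" "\<And>y. y \<in> T \<Longrightarrow> hat b y = q y"
  shows "divergence (\<lambda>y. (s * (hat a y * hat b y) + t * hat a y) *\<^sub>R w) x =
    s * (p x * (q w - q 0) + (p w - p 0) * q x) + t * (p w - p 0)"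
proof -
  obtain \<alpha> \<beta> \<alpha>' \<beta>' where e: "p = (\<lambda>x. \<alpha> + \<beta> \<bullet> x)" "q = (\<lambda>x. \<alpha>' + \<beta>' \<bullet> x)"
    using pq polys_1_iff by meson
  define D where "D h = (s * (p x * (\<beta>' \<bullet> h) + (\<beta> \<bullet> h) * q x) + t * (\<beta> \<bullet> h)) *\<^sub>R w" for h
  have i: "((\<lambda>y. \<gamma> \<bullet> y) has_derivative (\<lambda>h. \<gamma> \<bullet> h)) (at x)" for \<gamma> :: "real^2"
    by (intro has_derivative_inner_right has_derivative_ident)
  have dp: "(p has_derivative (\<lambda>h. \<beta> \<bullet> h)) (at x)" "(q has_derivative (\<lambda>h. \<beta>' \<bullet> h)) (at x)"
    using has_derivative_add[OF has_derivative_const[of \<alpha>] i[of \<beta>]]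
      has_derivative_add[OF has_derivative_const[of \<alpha>'] i[of \<beta>']] unfolding e by simp_all
  have "((\<lambda>y. (s * (p y * q y) + t * p y) *\<^sub>R w) has_derivative D) (at x)"
    unfolding D_def
    by (intro has_derivative_scaleR_left has_derivative_add has_derivative_mult_right has_derivative_mult dp)
  then have "((\<lambda>y. (s * (hat a y * hat b y) + t * hat a y) *\<^sub>R w) has_derivative D) (at x)"
  proof (rule has_derivative_transform_within_open[OF _ open_interior T(2)])
    fix y assume "y \<in> interior T"
    then have "y \<in> T" using interior_subset by blast
    then show "(s * (p y * q y) + t * p y) *\<^sub>R w = (s * (hat a y * hat b y) + t * hat a y) *\<^sub>R w"
      by (simp add: hat)
  qed
  then have f: "frechet_derivative (\<lambda>y. (s * (hat a y * hat b y) + t * hat a y) *\<^sub>R w) (at x) = D"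
    by (rule frechet_derivative_at[symmetric])
  have "D (axis 1 1) $ 1 + D (axis 2 1) $ 2 =
      s * (p x * (\<beta>' \<bullet> w) + (\<beta> \<bullet> w) * q x) + t * (\<beta> \<bullet> w)"
    by (simp add: D_def inner_axis inner_vec_def[of _ w] sum_2 algebra_simps)
  then show ?thesis
    unfolding divergence_def pderiv_comp_def f sum_2 by (simp add: e)
qed

lemma bary_increment: "bary a b c w - bary a b c 0 = cross2 w (b - c) / orient a b c"
  using bary_add[of a b c 0 w] by simp

lemma measure_cell: "cell a b c \<Longrightarrow> (LINT x|lebesgue_on (convex hull {a, b, c}). k) = k * (\<bar>orient a b c\<bar> / 2)"
proof -
  assume c: "cell a b c"
  let ?T = "convex hull {a, b, c}"
  have "?T \<in> lmeasurable" using cell_compact[OF cell_in[OF c]] by (rule lmeasurable_compact)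
  then show ?thesis
    by (simp add: measure_triangle[symmetric] measure_restrict_space fmeasurableD)
qed

text \<open>With \<delta> the derivative of the coordinate \<lambda> of a in direction w, the
  divergence is 4 \<delta> \<lambda> - \<delta>. The factors 1/6 and 1/2 of the two integrals leave
  \<delta>/6 times the absolute orientation, which involves only the edge opposite to a.\<close>

lemma integral_divergence_vertex_cell:
  assumes c: "cell a b c"
  shows "(LINT x|lebesgue_on (convex hull {a, b, c}). divergence (\<lambda>y. (2 * (hat a y * hat a y) + (-1) * hat a y) *\<^sub>R w) x)
    = sgn (orient a b c) * cross2 w (b - c) / 6"
proof -
  let ?T = "convex hull {a, b, c}"
  define \<delta> where "\<delta> = cross2 w (b - c) / orient a b c"
  note T = cell_in[OF c]
  have ib: "integrable (lebesgue_on ?T) (bary a b c)" "integrable (lebesgue_on ?T) (\<lambda>x. - \<delta>)"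
    by (intro integrable_lebesgue_on_compact cell_compact[OF T] continuous_on_bary continuous_on_const)+
  have "(LINT x|lebesgue_on ?T. divergence (\<lambda>y. (2 * (hat a y * hat a y) + (-1) * hat a y) *\<^sub>R w) x)
      = (LINT x|lebesgue_on ?T. 4 * \<delta> * bary a b c x + (- \<delta>))"
  proof (rule cell_integral_cong[OF divergence_piecewise[OF hat_combination_in_V] T])
    show "continuous_on UNIV (\<lambda>x. 4 * \<delta> * bary a b c x + (- \<delta>))"
      by (intro continuous_intros)
    fix x assume x: "x \<in> interior ?T"
    have "divergence (\<lambda>y. (2 * (hat a y * hat a y) + (-1) * hat a y) *\<^sub>R w) x
        = 2 * (bary a b c x * (bary a b c w - bary a b c 0) + (bary a b c w - bary a b c 0) * bary a b c x)
          + (-1) * (bary a b c w - bary a b c 0)"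
      by (rule divergence_hat_combination[OF T x bary_polys bary_polys]) (use hat_bary[OF c] in auto)
    then show "divergence (\<lambda>y. (2 * (hat a y * hat a y) + (-1) * hat a y) *\<^sub>R w) x = 4 * \<delta> * bary a b c x + (- \<delta>)"
      unfolding bary_increment \<delta>_def[symmetric] by (simp only:) (simp add: algebra_simps)
  qed
  also have "\<dots> = (LINT x|lebesgue_on ?T. 4 * \<delta> * bary a b c x) + (LINT x|lebesgue_on ?T. - \<delta>)"
    by (intro Bochner_Integration.integral_add integrable_mult_right ib)
  also have "\<dots> = 4 * \<delta> * (\<bar>orient a b c\<bar> / 6) + - \<delta> * (\<bar>orient a b c\<bar> / 2)"
    by (simp only: integral_mult_right_zero measure_cell[OF c] triangle_integral_bary[OF cell_orient[OF c]])
  also have "\<dots> = \<delta> * \<bar>orient a b c\<bar> / 6" by (simp add: field_simps)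
  also have "\<dots> = sgn (orient a b c) * cross2 w (b - c) / 6"
    using cell_orient[OF c] by (simp add: \<delta>_def abs_sgn)
  finally show ?thesis .
qed

text \<open>The integrals of the two coordinates are equal, so only the sum \<epsilon> + \<delta> of
  their derivatives survives. It is minus the derivative of the third coordinate and depends on the
  edge vector \<open>b - a\<close>.\<close>

lemma integral_divergence_midpoint_cell:
  assumes c: "cell a b c"
  shows "(LINT x|lebesgue_on (convex hull {a, b, c}). divergence (\<lambda>y. (4 * (hat a y * hat b y) + 0 * hat a y) *\<^sub>R w) x)
    = 2 / 3 * (sgn (orient a b c) * cross2 w (b - a))"
proof -
  let ?T = "convex hull {a, b, c}"
  have c': "cell b c a" using cell_rotate[OF c] .
  have T': "convex hull {b, c, a} = ?T" by (simp add: insert_commute)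
  define \<delta> where "\<delta> = cross2 w (b - c) / orient a b c"
  define \<epsilon> where "\<epsilon> = cross2 w (c - a) / orient a b c"
  note T = cell_in[OF c]
  have ib: "integrable (lebesgue_on ?T) (bary a b c)" "integrable (lebesgue_on ?T) (bary b c a)"
    by (intro integrable_lebesgue_on_compact cell_compact[OF T] continuous_on_bary)+
  have "(LINT x|lebesgue_on ?T. divergence (\<lambda>y. (4 * (hat a y * hat b y) + 0 * hat a y) *\<^sub>R w) x)
      = (LINT x|lebesgue_on ?T. 4 * \<epsilon> * bary a b c x + 4 * \<delta> * bary b c a x)"
  proof (rule cell_integral_cong[OF divergence_piecewise[OF hat_combination_in_V] T])
    show "continuous_on UNIV (\<lambda>x. 4 * \<epsilon> * bary a b c x + 4 * \<delta> * bary b c a x)"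
      by (intro continuous_intros)
    fix x assume x: "x \<in> interior ?T"
    have "divergence (\<lambda>y. (4 * (hat a y * hat b y) + 0 * hat a y) *\<^sub>R w) x
        = 4 * (bary a b c x * (bary b c a w - bary b c a 0) + (bary a b c w - bary a b c 0) * bary b c a x)
          + 0 * (bary a b c w - bary a b c 0)"
      by (rule divergence_hat_combination[OF T x bary_polys bary_polys])
        (use hat_bary[OF c] hat_bary[OF c'] T' in auto)
    then show "divergence (\<lambda>y. (4 * (hat a y * hat b y) + 0 * hat a y) *\<^sub>R w) x = 4 * \<epsilon> * bary a b c x + 4 * \<delta> * bary b c a x"
      unfolding bary_increment orient_cycle(1)[of a b c, symmetric] \<delta>_def[symmetric] \<epsilon>_def[symmetric]
      by (simp only:) (simp add: algebra_simps)
  qed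
  also have "\<dots> = (LINT x|lebesgue_on ?T. 4 * \<epsilon> * bary a b c x) + (LINT x|lebesgue_on ?T. 4 * \<delta> * bary b c a x)"
    by (intro Bochner_Integration.integral_add integrable_mult_right ib)
  also have "\<dots> = 4 * \<epsilon> * (\<bar>orient a b c\<bar> / 6) + 4 * \<delta> * (\<bar>orient a b c\<bar> / 6)"
    by (simp only: integral_mult_right_zero triangle_integral_bary[OF cell_orient[OF c]]
      triangle_integral_bary[OF cell_orient[OF c'], unfolded T' orient_cycle(1)[of a b c, symmetric]])
  also have "\<dots> = 2 / 3 * ((\<epsilon> + \<delta>) * \<bar>orient a b c\<bar>)" by (simp add: field_simps)
  also have "\<epsilon> + \<delta> = cross2 w (b - a) / orient a b c"
    unfolding \<epsilon>_def \<delta>_def add_divide_distrib[symmetric] by (simp add: cross2_def algebra_simps)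
  also have "\<dots> * \<bar>orient a b c\<bar> = sgn (orient a b c) * cross2 w (b - a)"
    using cell_orient[OF c] by (simp add: abs_sgn)
  finally show ?thesis .
qed

text \<open>Along \<open>b - a\<close> the coordinates of a and b change at rates -1 and 1, so the
  divergence is 4 times their difference and \<open>triangle_edge_moment\<close> applies. The factor
  of \<open>r a - r b\<close> is positive for either orientation of the triangle.\<close>

lemma integral_divergence_edge_cell:
  assumes c: "cell a b c" and r: "r \<in> Q_space \<Omega> \<T>"
  shows "(LINT x|lebesgue_on (convex hull {a, b, c}).
      divergence (\<lambda>y. (4 * (hat a y * hat b y) + 0 * hat a y) *\<^sub>R (b - a)) x * r x)
    = 2 * (r a - r b) * (LINT x|lebesgue_on (convex hull {a, b, c}). (bary a b c x - bary b c a x)\<^sup>2)"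
proof -
  let ?T = "convex hull {a, b, c}"
  have c': "cell b c a" using cell_rotate[OF c] .
  have T': "convex hull {b, c, a} = ?T" by (simp add: insert_commute)
  note T = cell_in[OF c] and o = cell_orient[OF c]
  obtain q where q: "q \<in> polys 1" "\<And>x. x \<in> ?T \<Longrightarrow> r x = q x"
    using r T unfolding Q_space_def poly_on_def by blast
  have ab: "r a = q a" "r b = q b" using q(2) by (simp_all add: hull_inc)
  have inc: "cross2 (b - a) (b - c) / orient a b c = -1" "cross2 (b - a) (c - a) / orient b c a = 1"
    using o unfolding orient_cycle(1)[of a b c, symmetric]
    by (auto simp: divide_eq_eq) (simp_all add: orient_def cross2_def algebra_simps)
  have "(LINT x|lebesgue_on ?T. divergence (\<lambda>y. (4 * (hat a y * hat b y) + 0 * hat a y) *\<^sub>R (b - a)) x * r x)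
      = (LINT x|lebesgue_on ?T. 4 * ((bary a b c x - bary b c a x) * q x))"
  proof (rule cell_integral_cong[OF piecewise_mult[OF divergence_piecewise[OF hat_combination_in_V]
      Q_space_piecewise[OF r]] T])
    show "continuous_on UNIV (\<lambda>x. 4 * ((bary a b c x - bary b c a x) * q x))"
      by (intro continuous_on_mult continuous_on_diff continuous_on_bary continuous_on_const continuous_on_affine[OF q(1)])
    fix x assume x: "x \<in> interior ?T"
    then have "r x = q x" using q(2) interior_subset by blast
    moreover have "divergence (\<lambda>y. (4 * (hat a y * hat b y) + 0 * hat a y) *\<^sub>R (b - a)) x
        = 4 * (bary a b c x * (bary b c a (b - a) - bary b c a 0) + (bary a b c (b - a) - bary a b c 0) * bary b c a x)
          + 0 * (bary a b c (b - a) - bary a b c 0)"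
      by (rule divergence_hat_combination[OF T x bary_polys bary_polys])
        (use hat_bary[OF c] hat_bary[OF c'] T' in auto)
    ultimately show "divergence (\<lambda>y. (4 * (hat a y * hat b y) + 0 * hat a y) *\<^sub>R (b - a)) x * r x
        = 4 * ((bary a b c x - bary b c a x) * q x)"
      unfolding bary_increment inc by (simp only:) (simp add: algebra_simps)
  qed
  also have "\<dots> = 4 * (LINT x|lebesgue_on ?T. (bary a b c x - bary b c a x) * q x)"
    by simp
  finally show ?thesis unfolding triangle_edge_moment[OF o q(1)] ab by simp
qed

text \<open>The quadratic part vanishes on a cell that misses a or b. The linear part needs the cell
  to miss a itself, which the alternative \<open>t = 0 \<or> a = b\<close> takes care of; both kinds
  of shape functions satisfy it.\<close>

lemma divergence_outside_cell:
  assumes T: "T \<in> \<T>" "x \<in> interior T" and "\<not> (a extreme_point_of T \<and> b extreme_point_of T)"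
    and "t = 0 \<or> a = b"
  shows "divergence (\<lambda>y. (s * (hat a y * hat b y) + t * hat a y) *\<^sub>R w) x = 0"
proof -
  obtain p where p: "p \<in> polys 1" "\<And>y. y \<in> T \<Longrightarrow> hat a y = p y"
    using hat_poly_on[OF T(1)] unfolding poly_on_def by blast
  obtain q where q: "q \<in> polys 1" "\<And>y. y \<in> T \<Longrightarrow> hat b y = q y"
    using hat_poly_on[OF T(1)] unfolding poly_on_def by blast
  have z: "(\<lambda>x. 0) \<in> polys 1"
    unfolding polys_1_iff by (rule exI[of _ 0], rule exI[of _ 0]) simp
  consider "\<not> a extreme_point_of T" | "\<not> b extreme_point_of T" "t = 0" using assms(3,4) by blast
  then show ?thesis
  proof cases
    case 1
    have "divergence (\<lambda>y. (s * (hat a y * hat b y) + t * hat a y) *\<^sub>R w) x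
        = s * (0 * (q w - q 0) + (0 - 0) * q x) + t * (0 - 0)"
      by (rule divergence_hat_combination[OF T z q(1)]) (use hat_outside[OF T(1) _ 1] q(2) in auto)
    then show ?thesis by simp
  next
    case 2
    have "divergence (\<lambda>y. (s * (hat a y * hat b y) + t * hat a y) *\<^sub>R w) x
        = s * (p x * (0 - 0) + (p w - p 0) * 0) + t * (p w - p 0)"
      by (rule divergence_hat_combination[OF T p(1) z]) (use hat_outside[OF T(1) _ 2(1)] p(2) in auto)
    then show ?thesis using 2(2) by simp
  qed
qed

lemma integral_divergence_outside_cell:
  assumes "T \<in> \<T>" "\<not> (a extreme_point_of T \<and> b extreme_point_of T)" "t = 0 \<or> a = b" "piecewise r"
  shows "(LINT x|lebesgue_on T. divergence (\<lambda>y. (s * (hat a y * hat b y) + t * hat a y) *\<^sub>R w) x * r x) = 0"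
proof -
  have "(LINT x|lebesgue_on T. divergence (\<lambda>y. (s * (hat a y * hat b y) + t * hat a y) *\<^sub>R w) x * r x)
      = (LINT x|lebesgue_on T. 0)"
    by (rule cell_integral_cong[OF piecewise_mult[OF divergence_piecewise[OF hat_combination_in_V] assms(4)] assms(1)])
      (use divergence_outside_cell assms in auto)
  then show ?thesis by simp
qed

lemma finite_cell_set: "finite {c. cell a b c}"
proof (rule finite_subset)
  show "{c. cell a b c} \<subseteq> mesh_vertices \<T>"
    using cell_rotate cell_edge edge_vertices by blast
qed (rule finite_vertices)

text \<open>The cells at an edge correspond bijectively to their third vertices.\<close>

lemma sum_edge_cells:
  assumes "edge a b" "\<And>T. T \<in> \<T> \<Longrightarrow> \<not> (a extreme_point_of T \<and> b extreme_point_of T) \<Longrightarrow> F T = 0"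
  shows "(\<Sum>T\<in>\<T>. F T) = (\<Sum>c | cell a b c. F (convex hull {a, b, c}))"
proof -
  have ab: "a \<noteq> b" using assms(1) edge_def by blast
  have inj: "inj_on (\<lambda>c. convex hull {a, b, c}) {c. cell a b c}"
  proof (rule inj_onI)
    fix c d assume cd: "c \<in> {c. cell a b c}" "d \<in> {c. cell a b c}" "convex hull {a, b, c} = convex hull {a, b, d}"
    have c: "cell a b c" and d: "cell a b d" using cd(1,2) by simp_all
    have "{a, b, c} = {a, b, d}" using cell_vertices[OF c] cell_vertices[OF d] cd(3) by metis
    then have "c \<in> {a, b, d}" by auto
    then show "c = d" using cell_distinct[OF c] by auto
  qed
  have im: "(\<lambda>c. convex hull {a, b, c}) ` {c. cell a b c} = {T\<in>\<T>. a extreme_point_of T \<and> b extreme_point_of T}"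
  proof safe
    fix T assume T: "T \<in> \<T>" "a extreme_point_of T" "b extreme_point_of T"
    obtain c where "cell a b c" "T = convex hull {a, b, c}" by (rule cell_of_edge[OF T ab])
    then show "T \<in> (\<lambda>c. convex hull {a, b, c}) ` {c. cell a b c}" by blast
  qed (use cell_in cell_extreme in auto)
  have "(\<Sum>T\<in>\<T>. F T) = (\<Sum>T\<in>{T\<in>\<T>. a extreme_point_of T \<and> b extreme_point_of T}. F T)"
    by (rule sum.mono_neutral_right[OF finite_mesh]) (use assms(2) in auto)
  also have "\<dots> = (\<Sum>c | cell a b c. F (convex hull {a, b, c}))"
    unfolding im[symmetric] by (simp add: sum.reindex[OF inj])
  finally show ?thesis .
qed

text \<open>Each triangle at a arises from the two ordered pairs (b, c) and (c, b). When its
  contribution splits accordingly, the sum over triangles can be regrouped by the edges that start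
  at a.\<close>

lemma sum_vertex_cells:
  assumes "\<And>T. T \<in> \<T> \<Longrightarrow> \<not> a extreme_point_of T \<Longrightarrow> F T = 0"
    and "\<And>b c. cell a b c \<Longrightarrow> F (convex hull {a, b, c}) = h b c + h c b"
  shows "(\<Sum>T\<in>\<T>. F T) = (\<Sum>b | edge a b. \<Sum>c | cell a b c. h b c)"
proof -
  define P where "P = (SIGMA b:{b. edge a b}. {c. cell a b c})"
  define T where "T = (\<lambda>(b, c). convex hull {a, b, c})"
  have fe: "finite {b. edge a b}"
    by (rule finite_subset[OF _ finite_vertices]) (use edge_vertices in blast)
  then have fP: "finite P" unfolding P_def using finite_cell_set by blast
  have P: "(b, c) \<in> P \<longleftrightarrow> cell a b c" for b c unfolding P_def using cell_edge by blast
  have im: "T ` P = {T\<in>\<T>. a extreme_point_of T}"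
  proof safe
    fix b c assume "(b, c) \<in> P"
    then show "T (b, c) \<in> \<T>" "a extreme_point_of T (b, c)"
      unfolding P T_def using cell_in cell_extreme by auto
  next
    fix S assume S: "S \<in> \<T>" "a extreme_point_of S"
    obtain b c where "cell a b c" "S = convex hull {a, b, c}" by (rule cell_of_vertex[OF S])
    then show "S \<in> T ` P" using P unfolding T_def by force
  qed
  have fib: "(\<Sum>x\<in>{x\<in>P. T x = S}. case_prod h x) = F S" if S: "S \<in> {T\<in>\<T>. a extreme_point_of T}" for S
  proof -
    obtain b c where bc: "cell a b c" "S = convex hull {a, b, c}" using cell_of_vertex S by blast
    have "x \<in> {(b, c), (c, b)}" if x: "x \<in> P" "T x = S" for x
    proof -
      obtain b' c' where bc': "x = (b', c')" by (cases x)
      have c: "cell a b' c'" "convex hull {a, b', c'} = convex hull {a, b, c}"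
        using x bc P unfolding bc' T_def by simp_all
      then have "{a, b', c'} = {a, b, c}" using cell_vertices[OF c(1)] cell_vertices[OF bc(1)] by metis
      then have "b' \<in> {a, b, c}" "c' \<in> {a, b, c}" by auto
      then show ?thesis unfolding bc'
        using cell_distinct[OF c(1)] cell_distinct[OF bc(1)] by auto
    qed
    moreover have "(b, c) \<in> P" "T (b, c) = S" using bc P by (auto simp: T_def)
    moreover have "(c, b) \<in> P" "T (c, b) = S"
      using bc P cell_swap[OF cell_rotate[OF cell_rotate[OF bc(1)]]] by (auto simp: T_def insert_commute)
    ultimately have "{x\<in>P. T x = S} = {(b, c), (c, b)}" by blast
    moreover have "b \<noteq> c" using cell_distinct[OF bc(1)] by blast
    ultimately show ?thesis using assms(2)[OF bc(1)] bc(2) by simp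
  qed
  have "(\<Sum>S\<in>\<T>. F S) = (\<Sum>S\<in>{T\<in>\<T>. a extreme_point_of T}. F S)"
    by (rule sum.mono_neutral_right[OF finite_mesh]) (use assms(1) in auto)
  also have "\<dots> = (\<Sum>S\<in>T ` P. \<Sum>x\<in>{x\<in>P. T x = S}. case_prod h x)"
    unfolding im by (rule sum.cong[OF refl]) (use fib in simp)
  also have "\<dots> = (\<Sum>x\<in>P. case_prod h x)"
    by (rule sum.image_gen[OF fP, symmetric])
  also have "\<dots> = (\<Sum>b | edge a b. \<Sum>c | cell a b c. h b c)"
    unfolding P_def by (rule sum.Sigma[symmetric]) (use fe finite_cell_set in auto)
  finally show ?thesis .
qed

text \<open>There are exactly two cells at such an edge, one on each side, and their signs are
  opposite.\<close>

lemma sum_sides_interior: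
  assumes "edge a b" "midpoint a b \<in> \<Omega>"
  shows "(\<Sum>c | cell a b c. sgn (orient a b c)) = 0"
proof -
  have y: "midpoint a b \<in> open_segment a b" using assms(1) by (simp add: edge_def)
  obtain c where c: "cell a b c" "orient a b c * 1 > 0" by (rule edge_two_sides[OF assms(1) y assms(2), of 1]) auto
  obtain d where d: "cell a b d" "orient a b d * (-1) > 0" by (rule edge_two_sides[OF assms(1) y assms(2), of "-1"]) auto
  have "e = c" if e: "cell a b e" "e \<noteq> d" for e
  proof (cases "orient a b e > 0")
    case True
    then show ?thesis using cell_side_unique[OF e(1) c(1)] c(2) by simp
  next
    case False
    then have "orient a b e < 0" using cell_orient[OF e(1)] by simp
    then have "orient a b e * orient a b d > 0" using d(2) by (simp add: mult_neg_neg)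
    then show ?thesis using cell_side_unique[OF e(1) d(1)] e(2) by simp
  qed
  then have "{c. cell a b c} = {c, d}" using c(1) d(1) by auto
  moreover have "c \<noteq> d" using c(2) d(2) by auto
  ultimately show ?thesis using c(2) d(2) by simp
qed

end

section \<open>Geometry of the side \<Gamma>1 and of the mesh edges along it\<close>

text \<open>In the plane d is a multiple of n turned by a right angle, with factor
  \<open>cross2 n d\<close>.\<close>

lemma cross2_orthogonal:
  assumes "d \<bullet> n = 0" "norm n = 1"
  shows "cross2 d w = - (cross2 n d * (w \<bullet> n))" "\<bar>cross2 n d\<bar> = norm d"
proof -
  have nn: "n $ 1 * n $ 1 + n $ 2 * n $ 2 = 1"
    using assms(2) by (simp add: norm_eq_1 inner_vec_def sum_2)
  have dn: "d $ 1 * n $ 1 + d $ 2 * n $ 2 = 0"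
    using assms(1) by (simp add: inner_vec_def sum_2)
  show "cross2 d w = - (cross2 n d * (w \<bullet> n))"
    unfolding cross2_def inner_vec_def sum_2 inner_real_def using nn dn by algebra
  have "(cross2 n d)\<^sup>2 = d \<bullet> d"
    unfolding cross2_def inner_vec_def sum_2 inner_real_def power2_eq_square using nn dn by algebra
  then show "\<bar>cross2 n d\<bar> = norm d"
    by (metis norm_eq_sqrt_inner real_sqrt_abs)
qed

lemma orthogonal_parallel:
  fixes n :: "real^2"
  assumes "d \<bullet> n = 0" "w \<bullet> n = 0" "norm n = 1" "d \<noteq> 0"
  obtains t where "w = t *\<^sub>R d"
proof
  have "cross2 d w = 0" using cross2_orthogonal(1)[OF assms(1,3)] assms(2) by simp
  then have c: "d $ 1 * w $ 2 = d $ 2 * w $ 1" by (simp add: cross2_def)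
  have "(d \<bullet> d) *\<^sub>R w = (w \<bullet> d) *\<^sub>R d"
    unfolding vec_eq_iff forall_2 inner_vec_def sum_2 vector_scaleR_component inner_real_def real_scaleR_def
    using c by algebra
  then show "w = (w \<bullet> d / (d \<bullet> d)) *\<^sub>R d"
    using assms(4) by (metis divide_inverse_commute inner_eq_zero_iff left_inverse scaleR_one scaleR_scaleR)
qed

locale slip_domain = triangulated_domain \<Omega> \<T>
  for \<Omega> :: "(real^2) set" and \<T> :: "(real^2) set set" +
  fixes \<Gamma>0 \<Gamma>1 :: "(real^2) set" and Ps :: "(real^2) list set" and A B n :: "real^2"
    and m :: nat and M :: "nat \<Rightarrow> real^2"
  assumes polygonal: "polygonal_domain \<Omega> Ps"
    and partition: "boundary_partition \<Omega> Ps \<Gamma>0 \<Gamma>1 A B"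
    and normal: "outer_unit_normal \<Omega> A B n"
    and side: "side_nodes \<T> \<Gamma>1 A B m M"
begin

lemma \<Gamma>1_eq: "\<Gamma>1 = open_segment A B"
  and AB: "A \<noteq> B"
  and closure_\<Gamma>1: "closure \<Gamma>1 = closed_segment A B"
  and frontier_eq: "frontier \<Omega> = closure \<Gamma>0 \<union> closed_segment A B"
  using partition unfolding boundary_partition_def by auto

lemma \<Gamma>1_frontier: "x \<in> \<Gamma>1 \<Longrightarrow> x \<in> frontier \<Omega>"
  unfolding frontier_eq \<Gamma>1_eq using open_closed_segment by blast

lemma normal_n: "norm n = 1" "(B - A) \<bullet> n = 0"
  using normal unfolding outer_unit_normal_def by (auto simp: inner_commute)

lemma side_ball:
  assumes "x \<in> \<Gamma>1"
  obtains r where "r > 0" "ball x r \<inter> frontier \<Omega> \<subseteq> \<Gamma>1"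
proof -
  have "openin (top_of_set (frontier \<Omega>)) \<Gamma>1"
    using partition unfolding boundary_partition_def by blast
  then obtain U where U: "open U" "\<Gamma>1 = frontier \<Omega> \<inter> U" using openin_open by blast
  then have "x \<in> U" using assms by blast
  then obtain r where "r > 0" "ball x r \<subseteq> U" by (rule openE[OF U(1)])
  then show ?thesis using that U by blast
qed

lemma closure_\<Gamma>0_disjoint: "closure \<Gamma>0 \<inter> \<Gamma>1 = {}"
proof -
  have o: "openin (top_of_set (frontier \<Omega>)) \<Gamma>1" "\<Gamma>0 \<inter> \<Gamma>1 = {}" "openin (top_of_set (frontier \<Omega>)) \<Gamma>0"
    using partition unfolding boundary_partition_def by blast+
  obtain U where U: "open U" "\<Gamma>1 = frontier \<Omega> \<inter> U" using o(1) openin_open by blast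
  have "\<Gamma>0 \<subseteq> frontier \<Omega>" using o(3) by (rule openin_imp_subset)
  then have "U \<inter> \<Gamma>0 = {}" using U(2) o(2) by blast
  then have "U \<inter> closure \<Gamma>0 = {}" using open_Int_closure_eq_empty[OF U(1)] by blast
  then show ?thesis using U(2) by blast
qed

lemma inner_\<Gamma>1:
  assumes "x \<in> \<Gamma>1" "y \<in> \<Gamma>1"
  shows "(y - x) \<bullet> n = 0"
proof -
  obtain s t where xy: "x = (1 - s) *\<^sub>R A + s *\<^sub>R B" "y = (1 - t) *\<^sub>R A + t *\<^sub>R B"
    using assms unfolding \<Gamma>1_eq by (auto simp: in_segment)
  have "y - x = (t - s) *\<^sub>R (B - A)" unfolding xy by (simp add: algebra_simps)
  then show ?thesis using normal_n(2) by simp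
qed

text \<open>The outer normal gives information only along a line through x. A small disc meets the
  frontier of \<Omega> only in the line of the side, so each open half disc is connected and misses
  the frontier; one point on the normal then decides for all of it.\<close>

lemma half_disc:
  assumes x: "x \<in> \<Gamma>1"
  shows "\<exists>r>0. \<forall>y\<in>ball x r. ((y - x) \<bullet> n < 0 \<longrightarrow> y \<in> \<Omega>) \<and> ((y - x) \<bullet> n > 0 \<longrightarrow> y \<notin> closure \<Omega>)"
proof -
  obtain r where r: "r > 0" "ball x r \<inter> frontier \<Omega> \<subseteq> \<Gamma>1" by (rule side_ball[OF x])
  obtain \<epsilon> where e: "\<epsilon> > 0" "\<And>t. 0 < t \<Longrightarrow> t < \<epsilon> \<Longrightarrow> x - t *\<^sub>R n \<in> \<Omega> \<and> x + t *\<^sub>R n \<notin> closure \<Omega>"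
    using normal x unfolding outer_unit_normal_def \<Gamma>1_eq by blast
  define t where "t = min r \<epsilon> / 2"
  have t: "0 < t" "t < \<epsilon>" "t < r" using r(1) e(1) by (auto simp: t_def)
  have nn: "n \<bullet> n = 1" using normal_n(1) by (simp add: norm_eq_1)
  let ?H = "\<lambda>s. ball x r \<inter> {y. (s *\<^sub>R n) \<bullet> y > (s *\<^sub>R n) \<bullet> x}"
  have conn: "connected (?H s)" for s
    by (intro convex_connected convex_Int convex_ball convex_halfspace_gt)
  have off: "?H s \<inter> frontier \<Omega> = {}" for s
  proof -
    have "\<not> (s *\<^sub>R n) \<bullet> y > (s *\<^sub>R n) \<bullet> x" if "y \<in> ball x r" "y \<in> frontier \<Omega>" for y
    proof -
      have "y \<in> \<Gamma>1" using r(2) that by blast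
      then have "(y - x) \<bullet> n = 0" by (rule inner_\<Gamma>1[OF x])
      then have "n \<bullet> y = n \<bullet> x" by (simp add: inner_diff_left inner_diff_right inner_commute)
      then show ?thesis by simp
    qed
    then show ?thesis by blast
  qed
  have eq: "(y - x) \<bullet> n < 0 \<longleftrightarrow> ((-1) *\<^sub>R n) \<bullet> y > ((-1) *\<^sub>R n) \<bullet> x"
    "(y - x) \<bullet> n > 0 \<longleftrightarrow> (1 *\<^sub>R n) \<bullet> y > (1 *\<^sub>R n) \<bullet> x" for y
    by (auto simp: inner_diff_left inner_diff_right inner_commute)
  have lower: "?H (-1) - \<Omega> = {}"
  proof (rule ccontr)
    assume ne: "?H (-1) - \<Omega> \<noteq> {}"
    have "x - t *\<^sub>R n \<in> ?H (-1) \<inter> \<Omega>"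
      using t e(2)[of t] nn normal_n(1) by (auto simp: dist_norm inner_diff_right)
    then have "?H (-1) \<inter> frontier \<Omega> \<noteq> {}"
      using connected_Int_frontier[OF conn _ ne] by blast
    then show False using off by blast
  qed
  have upper: "?H 1 \<inter> \<Omega> = {}"
  proof (rule ccontr)
    assume ne: "?H 1 \<inter> \<Omega> \<noteq> {}"
    have "x + t *\<^sub>R n \<in> ?H 1 - \<Omega>"
      using t e(2)[of t] nn normal_n(1) closure_subset[of \<Omega>] by (auto simp: dist_norm inner_add_right)
    then have "?H 1 \<inter> frontier \<Omega> \<noteq> {}"
      using connected_Int_frontier[OF conn ne] by blast
    then show False using off by blast
  qed
  show ?thesis
  proof (intro exI[of _ r] conjI ballI impI r(1))
    show "y \<in> \<Omega>" if "y \<in> ball x r" "(y - x) \<bullet> n < 0" for y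
      using lower that unfolding eq by blast
    show "y \<notin> closure \<Omega>" if "y \<in> ball x r" "(y - x) \<bullet> n > 0" for y
    proof -
      have "y \<in> ?H 1" using that unfolding eq by blast
      then have "y \<notin> \<Omega>" "y \<notin> frontier \<Omega>" using upper off[of 1] by blast+
      then show ?thesis using frontier_iff by blast
    qed
  qed
qed

text \<open>A segment pointing outwards would begin in the outer half disc, which misses the closure
  of \<Omega>.\<close>

lemma segment_inside:
  assumes x: "x \<in> \<Gamma>1" and s: "closed_segment x a \<subseteq> closure \<Omega>"
  shows "(a - x) \<bullet> n \<le> 0"
proof (rule ccontr)
  assume p: "\<not> (a - x) \<bullet> n \<le> 0"
  obtain r where r: "r > 0" "\<And>y. y \<in> ball x r \<Longrightarrow> (y - x) \<bullet> n < 0 \<Longrightarrow> y \<in> \<Omega>"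
    "\<And>y. y \<in> ball x r \<Longrightarrow> (y - x) \<bullet> n > 0 \<Longrightarrow> y \<notin> closure \<Omega>"
    using half_disc[OF x] by blast
  obtain t where t: "t > 0" "t \<le> 1" "norm (t *\<^sub>R (a - x)) < r" by (rule scaleR_small[OF r(1)])
  define y where "y = x + t *\<^sub>R (a - x)"
  have "y = (1 - t) *\<^sub>R x + t *\<^sub>R a" by (simp add: y_def algebra_simps)
  then have "y \<in> closed_segment x a" unfolding in_segment using t by (intro exI[of _ t]) simp
  moreover have "y \<in> ball x r" using t by (simp add: y_def dist_norm)
  moreover have "(y - x) \<bullet> n > 0" using t p by (simp add: y_def)
  ultimately show False using r(3) s by blast
qed

text \<open>Both endpoints have nonpositive height over the side, and a convex combination of the
  heights with positive weights is 0.\<close>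

lemma edge_through_side:
  assumes "edge a b" "x \<in> \<Gamma>1" "x \<in> open_segment a b"
  shows "(a - x) \<bullet> n = 0" "(b - x) \<bullet> n = 0"
proof -
  have "closed_segment x a \<subseteq> closed_segment a b" "closed_segment x b \<subseteq> closed_segment a b"
    using open_closed_segment[OF assms(3)] by (simp_all add: subset_closed_segment)
  then have ab: "(a - x) \<bullet> n \<le> 0" "(b - x) \<bullet> n \<le> 0"
    using edge_subset_closure[OF assms(1)] segment_inside[OF assms(2)] by blast+
  obtain u where u: "0 < u" "u < 1" "x = (1 - u) *\<^sub>R a + u *\<^sub>R b"
    using assms(3) by (auto simp: in_segment)
  have "(1 - u) *\<^sub>R (a - x) + u *\<^sub>R (b - x) = 0" using u(3) by (simp add: algebra_simps)
  then have "((1 - u) *\<^sub>R (a - x) + u *\<^sub>R (b - x)) \<bullet> n = 0" by simp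
  then have e: "(1 - u) * ((a - x) \<bullet> n) + u * ((b - x) \<bullet> n) = 0" by (simp add: inner_add_left)
  have "(1 - u) * ((a - x) \<bullet> n) \<le> 0" "u * ((b - x) \<bullet> n) \<le> 0"
    using ab u by (auto intro: mult_nonneg_nonpos)
  with e have "(1 - u) * ((a - x) \<bullet> n) = 0" "u * ((b - x) \<bullet> n) = 0" by linarith+
  then show "(a - x) \<bullet> n = 0" "(b - x) \<bullet> n = 0" using u by auto
qed

definition pt :: "real \<Rightarrow> real^2" where "pt t = A + t *\<^sub>R (B - A)"

text \<open>The parameter of the node on the side: \<open>M i = pt (pos i)\<close> by
  \<open>M_at\<close>, with A at 0 and B at 1.\<close>

definition pos :: "nat \<Rightarrow> real" where "pos i = dist A (M i) / dist A B"

lemma pt_inj: "pt s = pt t \<longleftrightarrow> s = t"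
  using AB by (auto simp: pt_def)

lemma pt_closed: "x \<in> closed_segment A B \<longleftrightarrow> (\<exists>t. 0 \<le> t \<and> t \<le> 1 \<and> x = pt t)"
  and pt_open: "x \<in> \<Gamma>1 \<longleftrightarrow> (\<exists>t. 0 < t \<and> t < 1 \<and> x = pt t)"
proof -
  have "(1 - t) *\<^sub>R A + t *\<^sub>R B = pt t" for t by (simp add: pt_def algebra_simps)
  then show "x \<in> closed_segment A B \<longleftrightarrow> (\<exists>t. 0 \<le> t \<and> t \<le> 1 \<and> x = pt t)"
    "x \<in> \<Gamma>1 \<longleftrightarrow> (\<exists>t. 0 < t \<and> t < 1 \<and> x = pt t)"
    unfolding \<Gamma>1_eq using AB by (auto simp: in_segment)
qed

lemma pt_between:
  assumes "\<alpha> < \<xi>" "\<xi> < \<beta>"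
  shows "pt \<xi> \<in> open_segment (pt \<alpha>) (pt \<beta>)"
proof -
  define u where "u = (\<xi> - \<alpha>) / (\<beta> - \<alpha>)"
  have u: "0 < u" "u < 1" "\<xi> = \<alpha> + u * (\<beta> - \<alpha>)" using assms by (auto simp: u_def)
  have "pt \<xi> = (1 - u) *\<^sub>R pt \<alpha> + u *\<^sub>R pt \<beta>"
    unfolding pt_def u(3) by (simp add: algebra_simps)
  then show ?thesis unfolding in_segment using u assms pt_inj by auto
qed

lemma on_line:
  assumes "x \<in> \<Gamma>1" "(y - x) \<bullet> n = 0"
  obtains t where "y = pt t"
proof -
  obtain s where s: "x = pt s" using assms(1) pt_open by blast
  obtain t where "y - x = t *\<^sub>R (B - A)"
    using orthogonal_parallel[OF normal_n(2) assms(2) normal_n(1)] AB by auto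
  then have "y = x + t *\<^sub>R (B - A)" by (metis add.commute diff_add_cancel)
  then have "y = pt (s + t)" unfolding s pt_def by (simp add: scaleR_add_left)
  then show ?thesis using that by blast
qed

lemma M_vertices: "closed_segment A B \<inter> mesh_vertices \<T> = M ` {1..m + 1}"
  and M_nodes: "closed_segment A B \<inter> mesh_nodes \<T> = M ` {1..m + 1} \<union> Mhalf M ` {1..m}"
  and M_ends: "M 1 = A" "M (m + 1) = B"
  using side unfolding side_nodes_def closure_\<Gamma>1 by auto

lemma pos_mono: "1 \<le> i \<Longrightarrow> i < j \<Longrightarrow> j \<le> m + 1 \<Longrightarrow> pos i < pos j"
  using side AB unfolding side_nodes_def pos_def by (simp add: divide_strict_right_mono)

lemma M_at:
  assumes "i \<in> {1..m + 1}"
  shows "M i = pt (pos i)" "0 \<le> pos i" "pos i \<le> 1"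
proof -
  have "M i \<in> closed_segment A B" using M_vertices assms by blast
  then obtain t where t: "0 \<le> t" "t \<le> 1" "M i = pt t" using pt_closed by blast
  have "dist A (M i) = t * dist A B" using t by (simp add: pt_def dist_norm norm_minus_commute)
  then have "pos i = t" using AB by (simp add: pos_def)
  then show "M i = pt (pos i)" "0 \<le> pos i" "pos i \<le> 1" using t by auto
qed

lemma pos_ends: "pos 1 = 0" "pos (m + 1) = 1"
  using M_ends AB by (simp_all add: pos_def)

lemma m_pos: "1 \<le> m"
  using M_ends AB by (cases m) auto

lemma pos_less_iff: "i \<in> {1..m + 1} \<Longrightarrow> j \<in> {1..m + 1} \<Longrightarrow> pos i < pos j \<longleftrightarrow> i < j"
  using pos_mono by (metis atLeastAtMost_iff linorder_neqE_nat not_less_iff_gr_or_eq)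

text \<open>The last two assumptions say that the open parameter intervals overlap. No vertex lies
  inside an edge, so the edge cannot reach beyond the two nodes; its endpoints are themselves nodes,
  and the order of the indices identifies them.\<close>

lemma edge_on_side:
  assumes "edge (pt \<alpha>) (pt \<beta>)" "\<alpha> < \<beta>" "i \<in> {1..m}" "\<alpha> < pos (i + 1)" "pos i < \<beta>"
  shows "\<alpha> = pos i" "\<beta> = pos (i + 1)"
proof -
  have i: "i \<in> {1..m + 1}" "i + 1 \<in> {1..m + 1}" using assms(3) by auto
  have mv: "M j \<in> mesh_vertices \<T>" if "j \<in> {1..m + 1}" for j using M_vertices that by blast
  have no: "\<not> (\<alpha> < pos j \<and> pos j < \<beta>)" if "j \<in> {1..m + 1}" for j
  proof
    assume "\<alpha> < pos j \<and> pos j < \<beta>"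
    then have "M j \<in> open_segment (pt \<alpha>) (pt \<beta>)" using pt_between M_at(1)[OF that] by auto
    then show False using edge_not_vertex[OF assms(1)] mv[OF that] by blast
  qed
  have b: "pos i \<le> \<alpha>" "\<beta> \<le> pos (i + 1)" using no[OF i(1)] no[OF i(2)] assms(4,5) by auto
  then have "0 \<le> \<alpha>" "\<beta> \<le> 1" using M_at(2)[OF i(1)] M_at(3)[OF i(2)] by auto
  then have "0 \<le> \<alpha> \<and> \<alpha> \<le> 1" "0 \<le> \<beta> \<and> \<beta> \<le> 1" using assms(2) by auto
  then have "pt \<alpha> \<in> closed_segment A B" "pt \<beta> \<in> closed_segment A B"
    unfolding pt_closed by blast+
  then have "pt \<alpha> \<in> M ` {1..m + 1}" "pt \<beta> \<in> M ` {1..m + 1}"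
    using edge_vertices[OF assms(1)] M_vertices by blast+
  then obtain j k where j: "j \<in> {1..m + 1}" "pt \<alpha> = M j" and k: "k \<in> {1..m + 1}" "pt \<beta> = M k" by auto
  then have jk: "\<alpha> = pos j" "\<beta> = pos k" using M_at(1) pt_inj by auto
  have "\<not> j < i" "j < i + 1" using b assms pos_less_iff[OF j(1) i(1)] pos_less_iff[OF j(1) i(2)] jk by auto
  then show "\<alpha> = pos i" using jk by (simp add: less_Suc_eq)
  have "i < k" "\<not> i + 1 < k" using b assms pos_less_iff[OF i(1) k(1)] pos_less_iff[OF i(2) k(1)] jk by auto
  then have "k = i + 1" by simp
  then show "\<beta> = pos (i + 1)" using jk by simp
qed

text \<open>A boundary point is not interior to its cell, so one of its coordinates vanishes. It
  then lies on the opposite edge, and not at an end because it is no vertex.\<close>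

lemma point_on_edge:
  assumes "x \<in> closure \<Omega>" "x \<notin> \<Omega>" "x \<notin> mesh_vertices \<T>"
  obtains a b where "edge a b" "x \<in> open_segment a b"
proof -
  obtain T where T: "T \<in> \<T>" "x \<in> T" by (rule in_closure_cell[OF assms(1)])
  have key: "\<exists>a b. edge a b \<and> x \<in> open_segment a b" if c: "cell a b c" "T = convex hull {a, b, c}" "bary c a b x = 0" for a b c
  proof -
    note o = cell_orient[OF c(1)]
    have ge: "0 \<le> bary a b c x" "0 \<le> bary b c a x"
      using in_triangle_iff[OF o] T c by auto
    have sm: "bary a b c x + bary b c a x = 1" using bary_sum[OF o, of x] c(3) by simp
    have x: "x = bary a b c x *\<^sub>R a + bary b c a x *\<^sub>R b" using bary_comb[OF o, of x] c(3) by simp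
    have v: "a \<in> mesh_vertices \<T>" "b \<in> mesh_vertices \<T>" using cell_edge[OF c(1)] edge_vertices by blast+
    have ne: "bary a b c x \<noteq> 0" "bary b c a x \<noteq> 0"
    proof -
      show "bary a b c x \<noteq> 0"
      proof
        assume "bary a b c x = 0"
        then have "x = b" using x sm by simp
        then show False using v assms(3) by simp
      qed
      show "bary b c a x \<noteq> 0"
      proof
        assume "bary b c a x = 0"
        then have "x = a" using x sm by simp
        then show False using v assms(3) by simp
      qed
    qed
    have sm': "bary a b c x = 1 - bary b c a x" using sm by simp
    have "x = (1 - bary b c a x) *\<^sub>R a + bary b c a x *\<^sub>R b" using x[unfolded sm'] .
    moreover have "0 < bary b c a x" "bary b c a x < 1" using ne ge sm by linarith+
    ultimately have "x \<in> open_segment a b"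
      unfolding in_segment using cell_distinct[OF c(1)] by blast
    then show ?thesis using cell_edge[OF c(1)] by blast
  qed
  obtain a b c where c: "cell a b c" "T = convex hull {a, b, c}" by (rule cell_cases[OF T(1)])
  have "x \<notin> interior T" using assms(2) interior_cell_subset[OF T(1)] by blast
  then have "\<not> (0 < bary a b c x \<and> 0 < bary b c a x \<and> 0 < bary c a b x)"
    using in_interior_triangle[OF cell_orient[OF c(1)]] c(2) by blast
  moreover have "0 \<le> bary a b c x \<and> 0 \<le> bary b c a x \<and> 0 \<le> bary c a b x"
    using in_triangle_iff[OF cell_orient[OF c(1)]] T c by auto
  ultimately consider "bary a b c x = 0" | "bary b c a x = 0" | "bary c a b x = 0" by linarith
  then have "\<exists>a b. edge a b \<and> x \<in> open_segment a b"
  proof cases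
    case 1
    then show ?thesis using key[of b c a] cell_rotate[OF c(1)] c(2) by (simp add: insert_commute)
  next
    case 2
    then show ?thesis using key[of c a b] cell_rotate[OF cell_rotate[OF c(1)]] c(2) by (simp add: insert_commute)
  next
    case 3
    then show ?thesis using key[OF c] by blast
  qed
  then show ?thesis using that by blast
qed

lemma Mhalf_at: "i \<in> {1..m} \<Longrightarrow> Mhalf M i = pt ((pos i + pos (i + 1)) / 2)"
proof -
  assume i: "i \<in> {1..m}"
  have M: "M i = pt (pos i)" "M (i + 1) = pt (pos (i + 1))" using M_at(1)[of i] M_at(1)[of "i + 1"] i by auto
  show ?thesis
    unfolding Mhalf_def M midpoint_def pt_def
    by (simp add: vec_eq_iff field_simps)
qed

text \<open>The point halfway between the two nodes is a boundary point and no vertex, hence inside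
  some edge. By \<open>edge_through_side\<close> this edge runs along the side, and
  \<open>edge_on_side\<close> identifies its endpoints.\<close>

lemma side_edge:
  assumes i: "i \<in> {1..m}"
  shows "edge (M i) (M (i + 1))"
proof -
  have i': "i \<in> {1..m + 1}" "i + 1 \<in> {1..m + 1}" using i by auto
  define \<xi> where "\<xi> = (pos i + pos (i + 1)) / 2"
  have lt: "pos i < pos (i + 1)" using pos_less_iff[OF i'] by simp
  have xi: "pos i < \<xi>" "\<xi> < pos (i + 1)" using lt by (auto simp: \<xi>_def)
  then have "0 < \<xi> \<and> \<xi> < 1" using M_at(2)[OF i'(1)] M_at(3)[OF i'(2)] by linarith
  then have x: "pt \<xi> \<in> \<Gamma>1" unfolding pt_open by blast
  have xv: "pt \<xi> \<notin> mesh_vertices \<T>"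
  proof
    assume "pt \<xi> \<in> mesh_vertices \<T>"
    then have "pt \<xi> \<in> M ` {1..m + 1}" using M_vertices x closure_\<Gamma>1 closure_subset by blast
    then obtain j where j: "j \<in> {1..m + 1}" "pt \<xi> = M j" by blast
    then have "\<xi> = pos j" using M_at(1)[OF j(1)] pt_inj by simp
    then have "i < j" "j < i + 1" using xi pos_less_iff[OF i'(1) j(1)] pos_less_iff[OF j(1) i'(2)] by auto
    then show False by simp
  qed
  have "pt \<xi> \<in> closure \<Omega>" "pt \<xi> \<notin> \<Omega>" using \<Gamma>1_frontier[OF x] frontier_iff by blast+
  then obtain a b where ab: "edge a b" "pt \<xi> \<in> open_segment a b" by (rule point_on_edge[OF _ _ xv])
  obtain \<alpha> where \<alpha>: "a = pt \<alpha>" by (rule on_line[OF x edge_through_side(1)[OF ab(1) x ab(2)]])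
  obtain \<beta> where \<beta>: "b = pt \<beta>" by (rule on_line[OF x edge_through_side(2)[OF ab(1) x ab(2)]])
  obtain u where u: "0 < u" "u < 1" "pt \<xi> = (1 - u) *\<^sub>R pt \<alpha> + u *\<^sub>R pt \<beta>"
    using ab(2) unfolding \<alpha> \<beta> by (auto simp: in_segment)
  have "(1 - u) *\<^sub>R pt \<alpha> + u *\<^sub>R pt \<beta> = pt ((1 - u) * \<alpha> + u * \<beta>)"
    by (simp add: pt_def algebra_simps)
  then have \<xi>: "\<xi> = (1 - u) * \<alpha> + u * \<beta>" using u(3) pt_inj by simp
  have ne: "\<alpha> \<noteq> \<beta>" using ab(1) \<alpha> \<beta> edge_def by auto
  show ?thesis
  proof (cases "\<alpha> < \<beta>")
    case True
    have "\<xi> = \<alpha> + u * (\<beta> - \<alpha>)" "\<xi> = \<beta> - (1 - u) * (\<beta> - \<alpha>)" using \<xi> by (simp_all add: algebra_simps)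
    moreover have "u * (\<beta> - \<alpha>) > 0" "(1 - u) * (\<beta> - \<alpha>) > 0" using u True by simp_all
    ultimately have "\<alpha> < \<xi>" "\<xi> < \<beta>" by linarith+
    then show ?thesis
      using edge_on_side[OF ab(1)[unfolded \<alpha> \<beta>] True i] xi ab(1) \<alpha> \<beta> M_at(1)[OF i'(1)] M_at(1)[OF i'(2)] by simp
  next
    case False
    then have lt: "\<beta> < \<alpha>" using ne by simp
    have "\<xi> = \<alpha> - u * (\<alpha> - \<beta>)" "\<xi> = \<beta> + (1 - u) * (\<alpha> - \<beta>)" using \<xi> by (simp_all add: algebra_simps)
    moreover have "u * (\<alpha> - \<beta>) > 0" "(1 - u) * (\<alpha> - \<beta>) > 0" using u lt by simp_all
    ultimately have "\<beta> < \<xi>" "\<xi> < \<alpha>" by linarith+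
    then show ?thesis
      using edge_on_side[OF edge_sym[OF ab(1)[unfolded \<alpha> \<beta>]] lt i] xi edge_sym[OF ab(1)] \<alpha> \<beta>
        M_at(1)[OF i'(1)] M_at(1)[OF i'(2)] by simp
  qed
qed

text \<open>An edge that leaves \<open>M j\<close> inwards starts in the inner half disc, so by
  \<open>edge_open_in_domain\<close> all its inner points are in \<Omega>. An edge whose midpoint is
  not in \<Omega> therefore runs along the side.\<close>

lemma side_neighbour:
  assumes j: "1 < j" "j \<le> m" and e: "edge (M j) v" and mid: "midpoint (M j) v \<notin> \<Omega>"
  shows "v = M (j + 1) \<or> v = M (j - 1)"
proof -
  have j': "j \<in> {1..m + 1}" "j + 1 \<in> {1..m + 1}" "j - 1 \<in> {1..m + 1}" using j by auto
  have "pos 1 < pos j" "pos j < pos (m + 1)" using j by (auto intro: pos_mono)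
  then have "0 < pos j" "pos j < 1" using pos_ends by auto
  then have x: "M j \<in> \<Gamma>1" using M_at(1)[OF j'(1)] pt_open by blast
  have Mv: "M j \<noteq> v" using e edge_def by blast
  have le: "(v - M j) \<bullet> n \<le> 0" using segment_inside[OF x] edge_subset_closure[OF e] by blast
  have "\<not> (v - M j) \<bullet> n < 0"
  proof
    assume neg: "(v - M j) \<bullet> n < 0"
    obtain r where r: "r > 0" "\<And>y. y \<in> ball (M j) r \<Longrightarrow> (y - M j) \<bullet> n < 0 \<Longrightarrow> y \<in> \<Omega>"
      "\<And>y. y \<in> ball (M j) r \<Longrightarrow> (y - M j) \<bullet> n > 0 \<Longrightarrow> y \<notin> closure \<Omega>"
      using half_disc[OF x] by blast
    obtain t where t: "t > 0" "t \<le> 1" "norm (t *\<^sub>R (v - M j)) < r" by (rule scaleR_small[OF r(1)])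
    \<comment> \<open>Halving t keeps y strictly between the endpoints even for t = 1, so that y is
      in the open segment.\<close>
    define y where "y = M j + (t / 2) *\<^sub>R (v - M j)"
    have "y = (1 - t / 2) *\<^sub>R M j + (t / 2) *\<^sub>R v" by (simp add: y_def algebra_simps)
    then have "y \<in> open_segment (M j) v"
      unfolding in_segment using t Mv by (intro conjI exI[of _ "t / 2"]) auto
    moreover have "norm ((t / 2) *\<^sub>R (v - M j)) = norm (t *\<^sub>R (v - M j)) / 2" using t by simp
    then have "norm ((t / 2) *\<^sub>R (v - M j)) < r" using t(3) r(1) by linarith
    then have "y \<in> ball (M j) r" by (simp only: y_def mem_ball dist_norm) (simp add: norm_minus_commute)
    then have "y \<in> \<Omega>" using r(2)[of y] neg t by (simp add: y_def mult_pos_neg)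
    ultimately have "midpoint (M j) v \<in> \<Omega>" using edge_open_in_domain[OF e] Mv by simp
    then show False using mid by simp
  qed
  then have "(v - M j) \<bullet> n = 0" using le by simp
  then obtain \<beta> where \<beta>: "v = pt \<beta>" using on_line[OF x] by blast
  have e': "edge (pt (pos j)) (pt \<beta>)" using e \<beta> M_at(1)[OF j'(1)] by simp
  have "\<beta> \<noteq> pos j" using Mv \<beta> M_at(1)[OF j'(1)] by auto
  then consider "pos j < \<beta>" | "\<beta> < pos j" by linarith
  then show ?thesis
  proof cases
    case 1
    have "\<beta> = pos (j + 1)"
      by (rule edge_on_side(2)[OF e' 1]) (use j 1 pos_mono[of j "j + 1"] in auto)
    then show ?thesis using \<beta> M_at(1)[OF j'(2)] by simp
  next
    case 2
    have "\<beta> = pos (j - 1)"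
      by (rule edge_on_side(1)[OF edge_sym[OF e'] 2]) (use j 2 pos_mono[of "j - 1" j] in auto)
    then show ?thesis using \<beta> M_at(1)[OF j'(3)] by simp
  qed
qed

text \<open>Every cell at the edge lies on the inner side, which fixes its sign to that of
  \<open>cross2 n (b - a)\<close>; so there is only one cell. The product is then the absolute value
  of this cross product, the length of the edge.\<close>

lemma sum_sides_boundary:
  assumes e: "edge a b" and mid: "midpoint a b \<in> \<Gamma>1"
  shows "(\<Sum>c | cell a b c. sgn (orient a b c)) * cross2 n (b - a) = dist a b"
proof -
  let ?y = "midpoint a b"
  have y: "?y \<in> open_segment a b" using e by (simp add: edge_def)
  have "(a - ?y) \<bullet> n = 0" "(b - ?y) \<bullet> n = 0" using edge_through_side[OF e mid y] by auto
  then have d: "(b - a) \<bullet> n = 0" by (simp add: inner_diff_left)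
  have ay: "a \<bullet> n = ?y \<bullet> n" using \<open>(a - ?y) \<bullet> n = 0\<close> by (simp add: inner_diff_left)
  note cr = cross2_orthogonal[OF d normal_n(1)]
  have s: "sgn (orient a b c) = sgn (cross2 n (b - a))" if c: "cell a b c" for c
  proof -
    have T: "a \<in> convex hull {a, b, c}" "b \<in> convex hull {a, b, c}" "c \<in> convex hull {a, b, c}"
      by (auto intro: hull_inc)
    then have "?y \<in> convex hull {a, b, c}" by (auto intro: midpoints_in_convex_hull)
    then have "closed_segment ?y c \<subseteq> convex hull {a, b, c}"
      using T(3) by (intro closed_segment_subset convex_convex_hull)
    then have "(c - ?y) \<bullet> n \<le> 0"
      using segment_inside[OF mid] cell_subset[OF cell_in[OF c]] by blast
    then have le: "(c - a) \<bullet> n \<le> 0" by (simp add: inner_diff_left ay)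
    have o: "orient a b c = - (cross2 n (b - a) * ((c - a) \<bullet> n))" unfolding orient_def by (rule cr(1))
    then have "(c - a) \<bullet> n \<noteq> 0" using cell_orient[OF c] by auto
    then have "(c - a) \<bullet> n < 0" using le by simp
    then show ?thesis unfolding o by (simp add: sgn_mult sgn_minus)
  qed
  obtain c where c: "cell a b c" by (rule edge_cell[OF e])
  have "d = c" if "cell a b d" for d
  proof (rule cell_side_unique[OF that c])
    have "sgn (orient a b d * orient a b c) = sgn (orient a b c) * sgn (orient a b c)"
      using s[OF that] s[OF c] by (simp add: sgn_mult)
    also have "\<dots> = 1" using cell_orient[OF c] by (simp add: sgn_if)
    finally show "orient a b d * orient a b c > 0" by (simp add: sgn_1_pos)
  qed
  then have "{c. cell a b c} = {c}" using c by blast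
  then have "(\<Sum>c | cell a b c. sgn (orient a b c)) * cross2 n (b - a) = \<bar>cross2 n (b - a)\<bar>"
    using s[OF c] by (simp add: abs_sgn mult.commute)
  then show ?thesis unfolding cr(2) by (simp add: dist_norm norm_minus_commute)
qed

end

section \<open>Nodes on the side, Simpson weights, and rigidity of pressure and multiplier\<close>

context slip_domain
begin

text \<open>At a corner the adjacent side of the polygon leaves the line through \<open>A\<close> and \<open>B\<close>, so the corner
  is a limit of points of \<open>closure \<Gamma>0\<close>.\<close>

lemma corner_in_closure_\<Gamma>0:
  assumes "C \<in> {A, B}"
  shows "C \<in> closure \<Gamma>0"
proof -
  obtain vs i where vs: "vs \<in> Ps" "i < length vs" "closed_segment A B = polygon_side vs i"
    using partition unfolding boundary_partition_def by blast
  let ?N = "length vs"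
  have sp: "simple_polygon vs" using polygonal vs(1) unfolding polygonal_domain_def by auto
  then have N: "3 \<le> ?N" "distinct vs" unfolding simple_polygon_def by blast+
  have disj: "polygon_side vs i \<inter> polygon_side vs k \<subseteq> {vs ! i, vs ! (Suc i mod ?N)}" if "k < ?N" "k \<noteq> i" for k
    using sp vs(2) that unfolding simple_polygon_def by blast
  have AB': "{A, B} = {vs ! i, vs ! (Suc i mod ?N)}"
    using vs(3) unfolding polygon_side_def by (simp add: closed_segment_eq doubleton_eq_iff)
  have "\<exists>k D. k < ?N \<and> k \<noteq> i \<and> D \<noteq> C \<and> polygon_side vs k = closed_segment C D"
  proof -
    consider "C = vs ! i" | "C = vs ! (Suc i mod ?N)" using assms AB' by blast
    then show ?thesis
    proof cases
      case 1
      define k where "k = (if i = 0 then ?N - 1 else i - 1)"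
      have k: "k < ?N" "k \<noteq> i" "Suc k mod ?N = i" using N(1) vs(2) by (auto simp: k_def)
      then have "vs ! k \<noteq> C" using 1 N(2) vs(2) by (simp add: nth_eq_iff_index_eq)
      then show ?thesis using k 1 by (auto simp: polygon_side_def closed_segment_commute)
    next
      case 2
      define k where "k = Suc i mod ?N"
      have "0 < ?N" using N(1) by linarith
      then have k: "k < ?N" unfolding k_def by (rule mod_less_divisor)
      have ki: "k \<noteq> i" using N(1) vs(2) by (cases "Suc i = ?N") (auto simp: k_def)
      have k2: "Suc k mod ?N < ?N" using \<open>0 < ?N\<close> by (rule mod_less_divisor)
      have "Suc k mod ?N \<noteq> k" using N(1) k by (cases "Suc k = ?N") auto
      then have "vs ! (Suc k mod ?N) \<noteq> vs ! k" using nth_eq_iff_index_eq[OF N(2) k2 k] by simp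
      then have "vs ! (Suc k mod ?N) \<noteq> C" unfolding 2 k_def[symmetric] .
      then show ?thesis using k ki 2 by (auto simp: polygon_side_def k_def)
    qed
  qed
  then obtain k D where kD: "k < ?N" "k \<noteq> i" "D \<noteq> C" "polygon_side vs k = closed_segment C D" by blast
  have fr: "polygon_side vs k \<subseteq> frontier \<Omega>"
    using polygonal vs(1) kD(1) unfolding polygonal_domain_def polygon_curve_def by auto
  have "C \<in> closure (closure \<Gamma>0)"
    unfolding closure_approachable
  proof (intro allI impI)
    fix e :: real assume "e > 0"
    \<comment> \<open>A distance below \<open>dist A B\<close> keeps the point y away from the other
      corner; as the two sides of the simple polygon meet only in corners, y is then off the side
      from A to B.\<close>
    then have pos: "min e (dist A B) > 0" using AB by simp
    obtain t where t: "t > 0" "t \<le> 1" "norm (t *\<^sub>R (D - C)) < min e (dist A B)" by (rule scaleR_small[OF pos])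
    define y where "y = C + t *\<^sub>R (D - C)"
    have d: "dist y C = norm (t *\<^sub>R (D - C))" by (simp add: y_def dist_norm)
    have "y = (1 - t) *\<^sub>R C + t *\<^sub>R D" by (simp add: y_def algebra_simps)
    then have yk: "y \<in> polygon_side vs k" unfolding kD(4) in_segment using t by (intro exI[of _ t]) simp
    have "y \<notin> {A, B}"
    proof
      assume "y \<in> {A, B}"
      then consider "y = C" | "dist y C = dist A B" using assms by (auto simp: dist_commute)
      then show False
      proof cases
        case 1 then show False using t(1) kD(3) by (simp add: y_def)
      next
        case 2 then show False using d t(3) by simp
      qed
    qed
    then have "y \<notin> closed_segment A B" using disj[OF kD(1,2)] yk AB' vs(3) by blast
    then have "y \<in> closure \<Gamma>0" using fr yk frontier_eq by blast
    moreover have "dist y C < e" using d t(3) by linarith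
    ultimately show "\<exists>y\<in>closure \<Gamma>0. dist y C < e" by blast
  qed
  then show ?thesis by simp
qed

abbreviation "N1 \<equiv> \<Gamma>1 \<inter> mesh_nodes \<T>"

lemma frontier_cases: "frontier \<Omega> = closure \<Gamma>0 \<union> \<Gamma>1"
  using frontier_eq corner_in_closure_\<Gamma>0 unfolding \<Gamma>1_eq open_segment_def by blast

lemma node_cases:
  assumes "z \<in> mesh_nodes \<T>"
  obtains "z \<in> \<Omega>" | "z \<in> closure \<Gamma>0" | "z \<in> N1"
  using assms nodes_subset frontier_cases frontier_iff by blast

lemma finite_N1: "finite N1"
  using finite_nodes by simp

lemma corners_nodes: "A \<in> mesh_nodes \<T>" "B \<in> mesh_nodes \<T>"
  using M_nodes M_ends by force+

lemma M_in_N1: "1 < j \<Longrightarrow> j \<le> m \<Longrightarrow> M j \<in> N1"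
proof -
  assume j: "1 < j" "j \<le> m"
  then have j': "j \<in> {1..m + 1}" by auto
  have "pos 1 < pos j" "pos j < pos (m + 1)" using j by (auto intro: pos_mono)
  then have "0 < pos j \<and> pos j < 1" using pos_ends by auto
  then have "M j \<in> \<Gamma>1" using M_at(1)[OF j'] pt_open by blast
  moreover have "M j \<in> mesh_nodes \<T>" using M_nodes j' by blast
  ultimately show ?thesis by blast
qed

lemma Mhalf_between: "i \<in> {1..m} \<Longrightarrow> pos i < (pos i + pos (i + 1)) / 2 \<and> (pos i + pos (i + 1)) / 2 < pos (i + 1)"
  using pos_mono[of i "i + 1"] by auto

lemma Mhalf_in_N1:
  assumes i: "i \<in> {1..m}"
  shows "Mhalf M i \<in> N1"
proof -
  have i': "i \<in> {1..m + 1}" "i + 1 \<in> {1..m + 1}" using i by auto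
  have "0 < (pos i + pos (i + 1)) / 2 \<and> (pos i + pos (i + 1)) / 2 < 1"
    using Mhalf_between[OF i] M_at(2)[OF i'(1)] M_at(3)[OF i'(2)] by linarith
  then have "Mhalf M i \<in> \<Gamma>1" unfolding Mhalf_at[OF i] pt_open by blast
  moreover have "Mhalf M i \<in> mesh_nodes \<T>" using M_nodes i by blast
  ultimately show ?thesis by blast
qed

lemma N1_cases:
  assumes "z \<in> N1"
  obtains j where "1 < j" "j \<le> m" "z = M j" | i where "i \<in> {1..m}" "z = Mhalf M i"
proof -
  have "z \<in> closed_segment A B" "z \<noteq> A" "z \<noteq> B" using assms unfolding \<Gamma>1_eq open_segment_def by auto
  then have "z \<in> M ` {1..m + 1} \<union> Mhalf M ` {1..m}" using M_nodes assms by blast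
  then consider j where "j \<in> {1..m + 1}" "z = M j" | i where "i \<in> {1..m}" "z = Mhalf M i" by blast
  then show ?thesis
  proof cases
    case (1 j)
    then have "j \<noteq> 1" "j \<noteq> m + 1" using \<open>z \<noteq> A\<close> \<open>z \<noteq> B\<close> M_ends by auto
    then show ?thesis using that(1)[of j] 1 by auto
  next
    case (2 i)
    then show ?thesis using that(2) by blast
  qed
qed

lemma M_inj: "i \<in> {1..m + 1} \<Longrightarrow> j \<in> {1..m + 1} \<Longrightarrow> M i = M j \<longleftrightarrow> i = j"
  using M_at(1) pt_inj pos_less_iff by (metis linorder_neqE_nat less_irrefl)

lemma Mhalf_neq_M:
  assumes "i \<in> {1..m}" "j \<in> {1..m + 1}"
  shows "Mhalf M i \<noteq> M j"
proof
  assume "Mhalf M i = M j"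
  then have e: "(pos i + pos (i + 1)) / 2 = pos j"
    using Mhalf_at[OF assms(1)] M_at(1)[OF assms(2)] pt_inj by simp
  have i: "i \<in> {1..m + 1}" "i + 1 \<in> {1..m + 1}" using assms(1) by auto
  have "i < j" "j < i + 1"
    using Mhalf_between[OF assms(1)] e pos_less_iff[OF i(1) assms(2)] pos_less_iff[OF assms(2) i(2)] by auto
  then show False by simp
qed

lemma Mhalf_inj:
  assumes "i \<in> {1..m}" "j \<in> {1..m}"
  shows "Mhalf M i = Mhalf M j \<longleftrightarrow> i = j"
proof
  have less: "Mhalf M i \<noteq> Mhalf M j" if "i \<in> {1..m}" "j \<in> {1..m}" "i < j" for i j
  proof -
    have "pos (i + 1) \<le> pos j"
      using that pos_mono[of "i + 1" j] by (cases "i + 1 = j") auto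
    then show ?thesis
      using Mhalf_between[OF that(1)] Mhalf_between[OF that(2)] Mhalf_at[OF that(1)] Mhalf_at[OF that(2)] pt_inj by simp
  qed
  assume "Mhalf M i = Mhalf M j"
  then show "i = j" using less[OF assms] less[OF assms(2,1)] by (metis linorder_neqE_nat)
qed simp

text \<open>Composite Simpson rule on the side; a vertex shared by two edges collects both end weights.\<close>

definition weight :: "real^2 \<Rightarrow> real" where
  "weight z = 1 / 6 * (\<Sum>i = 1..m. dist (M i) (M (i + 1)) *
     (of_bool (M i = z) + 4 * of_bool (Mhalf M i = z) + of_bool (M (i + 1) = z)))"

text \<open>The sum over edges is regrouped by nodes. The two ends of the side drop out, since the
  product vanishes there.\<close>

lemma form_Lambda_eq:
  assumes "\<eta> A * \<mu> A = 0" "\<eta> B * \<mu> B = 0"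
  shows "form_Lambda g m M \<eta> \<mu> = (\<Sum>z\<in>N1. weight z * (g z * \<eta> z * \<mu> z))"
proof -
  define F where "F z = g z * \<eta> z * \<mu> z" for z
  have F0: "F A = 0" "F B = 0" using assms by (auto simp: F_def)
  have pick: "F y = (\<Sum>z\<in>N1. of_bool (y = z) * F z)" if "y \<in> N1 \<or> y = A \<or> y = B" for y
  proof (cases "y \<in> N1")
    case True
    have "(\<Sum>z\<in>N1. of_bool (y = z) * F z) = (\<Sum>z\<in>N1. if z = y then F z else 0)"
      by (rule sum.cong) auto
    then show ?thesis using True finite_N1 by simp
  next
    case False
    then have "(\<Sum>z\<in>N1. of_bool (y = z) * F z) = 0" by (intro sum.neutral) auto
    then show ?thesis using False that F0 by auto
  qed
  have M: "M i \<in> N1 \<or> M i = A \<or> M i = B" if "i \<in> {1..m + 1}" for i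
    using that M_in_N1[of i] M_ends by (cases "i = 1 \<or> i = m + 1") auto
  have "form_Lambda g m M \<eta> \<mu> = 1 / 6 * (\<Sum>i = 1..m. dist (M i) (M (i + 1)) *
      (F (M i) + 4 * F (Mhalf M i) + F (M (i + 1))))"
    by (simp add: form_Lambda_def F_def mult.assoc)
  also have "(\<Sum>i = 1..m. dist (M i) (M (i + 1)) * (F (M i) + 4 * F (Mhalf M i) + F (M (i + 1))))
    = (\<Sum>i = 1..m. \<Sum>z\<in>N1. dist (M i) (M (i + 1)) *
     (of_bool (M i = z) + 4 * of_bool (Mhalf M i = z) + of_bool (M (i + 1) = z)) * F z)"
  proof (rule sum.cong[OF refl])
    fix i assume "i \<in> {1..m}"
    then have "i \<in> {1..m + 1}" "i + 1 \<in> {1..m + 1}" "Mhalf M i \<in> N1" using Mhalf_in_N1 by auto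
    then have p: "F (M i) = (\<Sum>z\<in>N1. of_bool (M i = z) * F z)"
      "F (Mhalf M i) = (\<Sum>z\<in>N1. of_bool (Mhalf M i = z) * F z)"
      "F (M (i + 1)) = (\<Sum>z\<in>N1. of_bool (M (i + 1) = z) * F z)"
      using pick M by blast+
    show "dist (M i) (M (i + 1)) * (F (M i) + 4 * F (Mhalf M i) + F (M (i + 1)))
      = (\<Sum>z\<in>N1. dist (M i) (M (i + 1)) *
         (of_bool (M i = z) + 4 * of_bool (Mhalf M i = z) + of_bool (M (i + 1) = z)) * F z)"
      unfolding p by (simp add: sum_distrib_left sum.distrib distrib_left distrib_right mult_ac)
  qed
  also have "\<dots> = (\<Sum>z\<in>N1. \<Sum>i = 1..m. dist (M i) (M (i + 1)) *
     (of_bool (M i = z) + 4 * of_bool (Mhalf M i = z) + of_bool (M (i + 1) = z)) * F z)"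
    by (rule sum.swap)
  finally show ?thesis
    by (simp add: weight_def F_def sum_distrib_left sum_distrib_right mult.assoc)
qed

lemma weight_vertex:
  assumes j: "1 < j" "j \<le> m"
  shows "weight (M j) = (dist (M j) (M (j + 1)) + dist (M j) (M (j - 1))) / 6"
proof -
  have j': "j \<in> {1..m + 1}" using j by auto
  have "dist (M i) (M (i + 1)) * (of_bool (M i = M j) + 4 * of_bool (Mhalf M i = M j) + of_bool (M (i + 1) = M j))
      = (if i = j then dist (M j) (M (j + 1)) else 0) + (if i = j - 1 then dist (M j) (M (j - 1)) else 0)"
    if "i \<in> {1..m}" for i
  proof -
    have i: "i \<in> {1..m + 1}" "i + 1 \<in> {1..m + 1}" using that by auto
    have "M i = M j \<longleftrightarrow> i = j" "Mhalf M i \<noteq> M j" "M (i + 1) = M j \<longleftrightarrow> i = j - 1"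
      using M_inj[OF i(1) j'] Mhalf_neq_M[OF that j'] M_inj[OF i(2) j'] j by auto
    then show ?thesis using j by (auto simp: dist_commute)
  qed
  then have "weight (M j) = 1 / 6 * (\<Sum>i = 1..m. (if i = j then dist (M j) (M (j + 1)) else 0)
      + (if i = j - 1 then dist (M j) (M (j - 1)) else 0))"
    unfolding weight_def by simp
  also have "\<dots> = (dist (M j) (M (j + 1)) + dist (M j) (M (j - 1))) / 6"
    using j by (auto simp: sum.distrib)
  finally show ?thesis .
qed

lemma weight_midpoint:
  assumes i: "i \<in> {1..m}"
  shows "weight (Mhalf M i) = 2 / 3 * dist (M i) (M (i + 1))"
proof -
  have "dist (M k) (M (k + 1)) * (of_bool (M k = Mhalf M i) + 4 * of_bool (Mhalf M k = Mhalf M i)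
      + of_bool (M (k + 1) = Mhalf M i)) = (if k = i then 4 * dist (M i) (M (i + 1)) else 0)"
    if "k \<in> {1..m}" for k
    using Mhalf_neq_M[OF i, of k] Mhalf_neq_M[OF i, of "k + 1"] Mhalf_inj[OF that i] that by auto
  then have "weight (Mhalf M i) = 1 / 6 * (\<Sum>k = 1..m. if k = i then 4 * dist (M i) (M (i + 1)) else 0)"
    unfolding weight_def by simp
  then show ?thesis using i by simp
qed

lemma weight_pos:
  assumes "z \<in> N1"
  shows "weight z > 0"
  using assms
proof (cases rule: N1_cases)
  case (1 j)
  then have "M j \<noteq> M (j + 1)" using M_inj[of j "j + 1"] by simp
  then have "dist (M j) (M (j + 1)) > 0" by simp
  moreover have "dist (M j) (M (j - 1)) \<ge> 0" by simp
  ultimately show ?thesis unfolding 1(3) weight_vertex[OF 1(1,2)] by (intro divide_pos_pos add_pos_nonneg) auto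
next
  case (2 i)
  then have "M i \<noteq> M (i + 1)" using M_inj[of i "i + 1"] by simp
  then show ?thesis unfolding 2(2) weight_midpoint[OF 2(1)] by simp
qed

lemma shape_V_space: "z \<in> mesh_nodes \<T> \<Longrightarrow> (\<lambda>x. shape z x *\<^sub>R w) \<in> V_space \<Omega> \<T>"
proof -
  assume z: "z \<in> mesh_nodes \<T>"
  obtain a b s t where "shape z = (\<lambda>x. s * (hat a x * hat b x) + t * hat a x)"
    by (rule shape_cases[OF z])
  then show ?thesis using hat_combination_in_V[of s a b t w] by simp
qed

abbreviation "V\<tau> \<equiv> V_tau_space \<Omega> \<Gamma>0 \<Gamma>1 n \<T>"

lemma n_tangent: "n \<bullet> tangent n = 0"
  by (simp add: tangent_def inner_vec_def sum_2)

lemma shape_interior_V\<tau>: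
  assumes "z \<in> mesh_nodes \<T>" "z \<in> \<Omega>"
  shows "(\<lambda>x. shape z x *\<^sub>R w) \<in> V\<tau>"
proof -
  have "z \<noteq> x" if "x \<in> closure \<Gamma>0 \<or> x \<in> \<Gamma>1" for x
    using that assms(2) frontier_cases frontier_iff by blast
  then show ?thesis
    unfolding V_tau_space_def using shape_V_space[OF assms(1)] shape_node[OF assms(1)] by auto
qed

lemma shape_N1_V\<tau>:
  assumes "z \<in> N1"
  shows "(\<lambda>x. shape z x *\<^sub>R n) \<in> V\<tau>"
proof -
  have "z \<noteq> x" if "x \<in> closure \<Gamma>0" for x
    using that assms closure_\<Gamma>0_disjoint by blast
  then show ?thesis
    unfolding V_tau_space_def using assms shape_V_space shape_node n_tangent by auto
qed

text \<open>Summing over the fan of triangles at a node of the side, the contributions of the interior edges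
  cancel; what remains is the Simpson weight.\<close>

lemma form_b_shape:
  assumes z: "z \<in> N1"
  shows "form_b \<Omega> (\<lambda>x. shape z x *\<^sub>R n) (\<lambda>x. 1) = - weight z"
  using z
proof (cases rule: N1_cases)
  case (1 j)
  let ?a = "M j"
  have j': "j \<in> {1..m + 1}" "j + 1 \<in> {1..m + 1}" "j - 1 \<in> {1..m}" "j \<in> {1..m}" "j - 1 \<in> {1..m + 1}" using 1 by auto
  have "?a \<in> mesh_vertices \<T>" using M_vertices j'(1) by blast
  then have e: "(\<lambda>x. shape z x *\<^sub>R n) = (\<lambda>y. (2 * (hat ?a y * hat ?a y) + (-1) * hat ?a y) *\<^sub>R n)"
    unfolding 1(3) by (auto simp: shape_vertex algebra_simps)
  define v where "v = (\<lambda>y. (2 * (hat ?a y * hat ?a y) + (-1) * hat ?a y) *\<^sub>R n)"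
  \<comment> \<open>The integral over a triangle contains \<open>cross2 n (b - c)\<close>, which
    splits into the parts of the two edges at \<open>?a\<close>. The minus sign of the second part
    is absorbed by the reversed orientation, which makes it \<open>h c b\<close>.\<close>
  define h where "h b c = sgn (orient ?a b c) * cross2 n (b - ?a) / 6" for b c
  have "(LINT x|lebesgue_on \<Omega>. divergence v x) = (\<Sum>T\<in>\<T>. LINT x|lebesgue_on T. divergence v x)"
    unfolding v_def by (intro piecewise_integral(2) divergence_piecewise hat_combination_in_V)
  also have "\<dots> = (\<Sum>b | edge ?a b. \<Sum>c | cell ?a b c. h b c)"
  proof (rule sum_vertex_cells)
    show "(LINT x|lebesgue_on T. divergence v x) = 0" if "T \<in> \<T>" "\<not> ?a extreme_point_of T" for T
      unfolding v_def using integral_divergence_outside_cell[OF that(1) _ _ piecewise_const[of 1], of ?a ?a "-1" 2 n] that(2) by simp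
    show "(LINT x|lebesgue_on (convex hull {?a, b, c}). divergence v x) = h b c + h c b" if "cell ?a b c" for b c
      unfolding v_def integral_divergence_vertex_cell[OF that] h_def orient_swap[of ?a c b]
      by (simp add: sgn_minus cross2_def algebra_simps diff_divide_distrib add_divide_distrib)
  qed
  also have "\<dots> = (\<Sum>b | edge ?a b. (\<Sum>c | cell ?a b c. sgn (orient ?a b c)) * cross2 n (b - ?a) / 6)"
    unfolding h_def by (simp add: sum_distrib_right sum_divide_distrib)
  \<comment> \<open>Edges with midpoint in \<Omega> have a triangle on either side and cancel; by
    \<open>side_neighbour\<close> only the two edges along the side are left.\<close>
  also have "\<dots> = (\<Sum>b\<in>{M (j + 1), M (j - 1)}. (\<Sum>c | cell ?a b c. sgn (orient ?a b c)) * cross2 n (b - ?a) / 6)"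
  proof (rule sum.mono_neutral_right)
    show "finite {b. edge ?a b}" by (rule finite_subset[OF _ finite_vertices]) (use edge_vertices in blast)
    show "{M (j + 1), M (j - 1)} \<subseteq> {b. edge ?a b}"
      using side_edge[OF j'(4)] edge_sym[OF side_edge[OF j'(3)]] 1(1) by simp
    show "\<forall>b\<in>{b. edge ?a b} - {M (j + 1), M (j - 1)}.
        (\<Sum>c | cell ?a b c. sgn (orient ?a b c)) * cross2 n (b - ?a) / 6 = 0"
    proof
      fix b assume b: "b \<in> {b. edge ?a b} - {M (j + 1), M (j - 1)}"
      then have "midpoint ?a b \<in> \<Omega>" using side_neighbour[OF 1(1,2)] by blast
      then show "(\<Sum>c | cell ?a b c. sgn (orient ?a b c)) * cross2 n (b - ?a) / 6 = 0"
        using sum_sides_interior b by simp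
    qed
  qed
  also have "\<dots> = dist ?a (M (j + 1)) / 6 + dist ?a (M (j - 1)) / 6"
  proof -
    have "midpoint ?a (M (j + 1)) \<in> \<Gamma>1" using Mhalf_in_N1[OF j'(4)] unfolding Mhalf_def by blast
    moreover have "midpoint ?a (M (j - 1)) \<in> \<Gamma>1"
      using Mhalf_in_N1[OF j'(3)] 1(1) unfolding Mhalf_def by (simp add: midpoint_sym)
    moreover have "edge ?a (M (j + 1))" "edge ?a (M (j - 1))"
      using side_edge[OF j'(4)] edge_sym[OF side_edge[OF j'(3)]] 1(1) by simp_all
    moreover have "M (j + 1) \<noteq> M (j - 1)" using M_inj[OF j'(2) j'(5)] by simp
    ultimately show ?thesis using sum_sides_boundary by simp
  qed
  also have "\<dots> = weight z" unfolding 1(3) weight_vertex[OF 1(1,2)] by (simp add: add_divide_distrib)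
  finally show ?thesis unfolding form_b_def e v_def by simp
next
  case (2 i)
  let ?a = "M i" and ?b = "M (i + 1)"
  note ab = side_edge[OF 2(1)]
  have e: "(\<lambda>x. shape z x *\<^sub>R n) = (\<lambda>y. (4 * (hat ?a y * hat ?b y) + 0 * hat ?a y) *\<^sub>R n)"
    unfolding 2(2) Mhalf_def shape_midpoint[OF ab] by (simp only: mult_zero_left add_0_right)
  define v where "v = (\<lambda>y. (4 * (hat ?a y * hat ?b y) + 0 * hat ?a y) *\<^sub>R n)"
  have "(LINT x|lebesgue_on \<Omega>. divergence v x) = (\<Sum>T\<in>\<T>. LINT x|lebesgue_on T. divergence v x)"
    unfolding v_def by (intro piecewise_integral(2) divergence_piecewise hat_combination_in_V)
  also have "\<dots> = (\<Sum>c | cell ?a ?b c. LINT x|lebesgue_on (convex hull {?a, ?b, c}). divergence v x)"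
  proof (rule sum_edge_cells[OF ab])
    show "(LINT x|lebesgue_on T. divergence v x) = 0"
      if "T \<in> \<T>" "\<not> (?a extreme_point_of T \<and> ?b extreme_point_of T)" for T
      unfolding v_def using integral_divergence_outside_cell[OF that _ piecewise_const[of 1], of 0 4 n] by simp
  qed
  also have "\<dots> = (\<Sum>c | cell ?a ?b c. 2 / 3 * (sgn (orient ?a ?b c) * cross2 n (?b - ?a)))"
    unfolding v_def by (intro sum.cong refl integral_divergence_midpoint_cell) simp
  also have "\<dots> = 2 / 3 * ((\<Sum>c | cell ?a ?b c. sgn (orient ?a ?b c)) * cross2 n (?b - ?a))"
    by (simp add: sum_distrib_left sum_distrib_right)
  also have "\<dots> = weight z"
  proof -
    have "midpoint ?a ?b \<in> \<Gamma>1" using Mhalf_in_N1[OF 2(1)] unfolding Mhalf_def by blast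
    then show ?thesis unfolding sum_sides_boundary[OF ab \<open>midpoint ?a ?b \<in> \<Gamma>1\<close>] 2(2) weight_midpoint[OF 2(1)] by simp
  qed
  finally show ?thesis unfolding form_b_def e v_def by simp
qed

text \<open>All cells at the edge contribute \<open>r a - r b\<close> with positive factors, so
  nothing can cancel.\<close>

lemma form_b_edge_eq_0:
  assumes e: "edge a b" and r: "r \<in> Q_space \<Omega> \<T>"
    and 0: "form_b \<Omega> (\<lambda>y. (4 * (hat a y * hat b y) + 0 * hat a y) *\<^sub>R (b - a)) r = 0"
  shows "r a = r b"
proof -
  let ?v = "\<lambda>y. (4 * (hat a y * hat b y) + 0 * hat a y) *\<^sub>R (b - a)"
  let ?k = "\<lambda>c. LINT x|lebesgue_on (convex hull {a, b, c}). (bary a b c x - bary b c a x)\<^sup>2"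
  have "(LINT x|lebesgue_on \<Omega>. divergence ?v x * r x) = (\<Sum>T\<in>\<T>. LINT x|lebesgue_on T. divergence ?v x * r x)"
    by (intro piecewise_integral(2) piecewise_mult divergence_piecewise hat_combination_in_V Q_space_piecewise r)
  also have "\<dots> = (\<Sum>c | cell a b c. LINT x|lebesgue_on (convex hull {a, b, c}). divergence ?v x * r x)"
    by (rule sum_edge_cells[OF e], rule integral_divergence_outside_cell[OF _ _ _ Q_space_piecewise[OF r]]) auto
  also have "\<dots> = (\<Sum>c | cell a b c. 2 * (r a - r b) * ?k c)"
    by (intro sum.cong refl integral_divergence_edge_cell r) simp
  also have "\<dots> = 2 * (r a - r b) * (\<Sum>c | cell a b c. ?k c)"
    by (simp add: sum_distrib_left)
  finally have "2 * (r a - r b) * (\<Sum>c | cell a b c. ?k c) = 0"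
    using 0 by (simp add: form_b_def)
  moreover have "(\<Sum>c | cell a b c. ?k c) > 0"
  proof (rule sum_pos[OF finite_cell_set])
    show "{c. cell a b c} \<noteq> {}" using edge_cell[OF e] by blast
    show "?k c > 0" if "c \<in> {c. cell a b c}" for c
      using that triangle_edge_moment_pos cell_orient by blast
  qed
  ultimately show ?thesis by simp
qed

text \<open>Equation \<open>eq\<close> is the difference of two momentum equations with the same
  velocity, for the differences r of the pressures and \<mu> of the multipliers.\<close>

lemma pressure_multiplier_rigidity:
  assumes r: "r \<in> Q_space \<Omega> \<T>" and g: "\<And>z. z \<in> N1 \<Longrightarrow> g z > 0"
    and eq: "\<And>v. v \<in> V\<tau> \<Longrightarrow> form_b \<Omega> v r + (\<Sum>z\<in>N1. weight z * (g z * (v z \<bullet> n) * \<mu> z)) = 0"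
  obtains \<delta> where "\<And>x. x \<in> closure \<Omega> \<Longrightarrow> r x = \<delta>" "\<And>z. z \<in> N1 \<Longrightarrow> \<mu> z = \<delta> / g z"
proof -
  have edge_const: "r a = r b" if ab: "edge a b" "a \<in> \<Omega>" for a b
  proof (rule form_b_edge_eq_0[OF ab(1) r])
    let ?z = "midpoint a b"
    have "?z \<in> open_segment a b" using ab(1) by (simp add: edge_def)
    then have z: "?z \<in> \<Omega>" "?z \<in> mesh_nodes \<T>"
      using edge_from_interior[OF ab] mesh_nodes_eq ab(1) by auto
    have e: "(\<lambda>y. (4 * (hat a y * hat b y) + 0 * hat a y) *\<^sub>R (b - a)) = (\<lambda>x. shape ?z x *\<^sub>R (b - a))"
      by (simp add: shape_midpoint[OF ab(1)])
    have "x \<noteq> ?z" if "x \<in> N1" for x using that z(1) \<Gamma>1_frontier frontier_iff by blast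
    then have "shape ?z x = 0" if "x \<in> N1" for x using shape_node[OF z(2), of x] that by auto
    then have "(\<Sum>x\<in>N1. weight x * (g x * ((shape ?z x *\<^sub>R (b - a)) \<bullet> n) * \<mu> x)) = 0"
      by (intro sum.neutral) auto
    then show "form_b \<Omega> (\<lambda>y. (4 * (hat a y * hat b y) + 0 * hat a y) *\<^sub>R (b - a)) r = 0"
      using eq[OF shape_interior_V\<tau>[OF z(2,1), of "b - a"]] unfolding e by simp
  qed
  \<comment> \<open>On each cell r equals its value at a vertex, so r takes finitely many values;
    being continuous on a connected set it is constant.\<close>
  have "r ` closure \<Omega> \<subseteq> r ` mesh_vertices \<T>"
  proof (rule image_subsetI)
    fix x assume "x \<in> closure \<Omega>"
    then obtain T where T: "T \<in> \<T>" "x \<in> T" by (rule in_closure_cell)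
    obtain w where w: "w extreme_point_of T" "w \<notin> frontier \<Omega>" using mesh_inner_vertex[OF T(1)] by blast
    obtain b c where c: "cell w b c" "T = convex hull {w, b, c}" by (rule cell_of_vertex[OF T(1) w(1)])
    have "w \<in> \<Omega>" using extreme_in[OF T(1) w(1)] cell_subset[OF T(1)] w(2) frontier_iff by blast
    moreover have "edge w b" "edge w c"
      using cell_edge[OF c(1)] edge_sym[OF cell_edge[OF cell_rotate[OF cell_rotate[OF c(1)]]]] by auto
    ultimately have k: "r w = r b" "r w = r c" using edge_const by blast+
    obtain q where q: "q \<in> polys 1" "\<And>x. x \<in> T \<Longrightarrow> r x = q x"
      using r T(1) unfolding Q_space_def poly_on_def by blast
    have qk: "q w = r w" "q b = r w" "q c = r w" using q(2) k c(2) by (auto simp: hull_inc)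
    obtain s t u where x: "x = s *\<^sub>R w + t *\<^sub>R b + u *\<^sub>R c" "s + t + u = 1"
      using T(2) unfolding c(2) convex_hull_3 by blast
    have "q x = (s + t + u) * r w"
      unfolding x(1) polys_1_convex_comb[OF q(1) x(2)] qk by (simp add: distrib_right)
    then have "r x = r w" using q(2)[OF T(2)] x(2) by simp
    moreover have "w \<in> mesh_vertices \<T>" using T(1) w(1) unfolding mesh_vertices_def by blast
    ultimately show "r x \<in> r ` mesh_vertices \<T>" by blast
  qed
  then have "finite (r ` closure \<Omega>)" using finite_vertices finite_subset by blast
  moreover have "continuous_on (closure \<Omega>) r" using r unfolding Q_space_def by blast
  moreover have "connected (closure \<Omega>)" using connected_domain by (rule connected_imp_connected_closure)
  ultimately have "r constant_on closure \<Omega>" using continuous_finite_range_constant by blast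
  then obtain \<delta> where \<delta>: "\<And>x. x \<in> closure \<Omega> \<Longrightarrow> r x = \<delta>" unfolding constant_on_def by blast
  have "\<mu> z = \<delta> / g z" if z: "z \<in> N1" for z
  proof -
    let ?v = "\<lambda>x. shape z x *\<^sub>R n"
    have "form_b \<Omega> ?v r = form_b \<Omega> ?v (\<lambda>x. \<delta> * 1)" using \<delta> by (intro form_b_cong) simp
    also have "\<dots> = \<delta> * - weight z" by (simp only: form_b_scale form_b_shape[OF z])
    finally have b: "form_b \<Omega> ?v r = - (\<delta> * weight z)" by simp
    have "(\<Sum>x\<in>N1. weight x * (g x * (?v x \<bullet> n) * \<mu> x)) = (\<Sum>x\<in>N1. if x = z then weight z * (g z * \<mu> z) else 0)"
    proof (rule sum.cong[OF refl])
      fix x assume x: "x \<in> N1"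
      have "?v x \<bullet> n = of_bool (x = z)"
        using shape_node[of z x] z x normal_n(1) by (auto simp: norm_eq_1)
      then show "weight x * (g x * (?v x \<bullet> n) * \<mu> x) = (if x = z then weight z * (g z * \<mu> z) else 0)" by simp
    qed
    also have "\<dots> = weight z * (g z * \<mu> z)" using z finite_N1 by simp
    finally have "weight z * (g z * \<mu> z) = weight z * \<delta>"
      using eq[OF shape_N1_V\<tau>[OF z]] b by (simp add: mult.commute)
    then have "g z * \<mu> z = \<delta>" using weight_pos[OF z] by simp
    then show ?thesis using g[OF z] by (simp add: field_simps)
  qed
  then show ?thesis using that \<delta> by blast
qed

end

subsection \<open>Definiteness of the strain form\<close>

lemma polys_1_eq_0_on_open:
  assumes "q \<in> polys 1" "open U" "U \<noteq> {}" "\<And>x. x \<in> U \<Longrightarrow> q x = 0"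
  shows "q x = 0"
proof -
  obtain \<alpha> \<beta> where q: "q = (\<lambda>x. \<alpha> + \<beta> \<bullet> x)" using assms(1) polys_1_iff by blast
  obtain y where y: "y \<in> U" using assms(3) by blast
  obtain r where r: "r > 0" "ball y r \<subseteq> U" by (rule openE[OF assms(2) y])
  obtain t where t: "t > 0" "t \<le> 1" "norm (t *\<^sub>R \<beta>) < r" by (rule scaleR_small[OF r(1)])
  have "y + t *\<^sub>R \<beta> \<in> ball y r" using t(3) by (simp add: dist_norm)
  then have "q (y + t *\<^sub>R \<beta>) = 0" using r(2) assms(4) by blast
  moreover have "q y = 0" using assms(4) y by blast
  moreover have "t * (\<beta> \<bullet> \<beta>) = q (y + t *\<^sub>R \<beta>) - q y" by (simp add: q inner_add_right)
  ultimately have "t * (\<beta> \<bullet> \<beta>) = 0" by simp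
  then have "\<beta> = 0" using t(1) by simp
  then show ?thesis using \<open>q y = 0\<close> by (simp add: q)
qed

text \<open>The derivatives of quadratics are affine, and an affine function that vanishes on a
  nonempty open set has zero coefficients. The strain equations thus become linear equations between
  the coefficients, which eliminate all quadratic terms.\<close>

lemma quadratic_rigid:
  fixes p :: "2 \<Rightarrow> real^2 \<Rightarrow> real"
  assumes p: "\<And>i. p i \<in> polys 2" and U: "open U" "U \<noteq> {}"
    and P: "\<And>i x. x \<in> U \<Longrightarrow> (p i has_derivative (\<lambda>w. P i 1 x * w $ 1 + P i 2 x * w $ 2)) (at x)"
    and e: "\<And>i j x. x \<in> U \<Longrightarrow> P i j x + P j i x = 0"
  obtains c d \<omega> where "\<And>x. p 1 x = c - \<omega> * x $ 2" "\<And>x. p 2 x = d + \<omega> * x $ 1"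
proof -
  have form: "\<exists>c0 c1 c2 c3 c4 c5. p i = (\<lambda>x. c0 + c1 * x $ 1 + c2 * x $ 2 + c3 * (x $ 1)\<^sup>2 + c4 * (x $ 1 * x $ 2) + c5 * (x $ 2)\<^sup>2)" for i
    using p polys_2_iff by blast
  obtain a0 a1 a2 a3 a4 a5 where a:
    "p 1 = (\<lambda>x. a0 + a1 * x $ 1 + a2 * x $ 2 + a3 * (x $ 1)\<^sup>2 + a4 * (x $ 1 * x $ 2) + a5 * (x $ 2)\<^sup>2)"
    using form[of 1] by blast
  obtain b0 b1 b2 b3 b4 b5 where b:
    "p 2 = (\<lambda>x. b0 + b1 * x $ 1 + b2 * x $ 2 + b3 * (x $ 1)\<^sup>2 + b4 * (x $ 1 * x $ 2) + b5 * (x $ 2)\<^sup>2)"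
    using form[of 2] by blast
  have h: "((\<lambda>x::real^2. x $ i) has_derivative (\<lambda>w. w $ i)) (at x)" for i x
    by (rule bounded_linear.has_derivative[OF bounded_linear_vec_nth has_derivative_ident])
  have D: "((\<lambda>x::real^2. c0 + c1 * x $ 1 + c2 * x $ 2 + c3 * (x $ 1)\<^sup>2 + c4 * (x $ 1 * x $ 2) + c5 * (x $ 2)\<^sup>2)
      has_derivative (\<lambda>w. (c1 + 2 * c3 * x $ 1 + c4 * x $ 2) * w $ 1 + (c2 + c4 * x $ 1 + 2 * c5 * x $ 2) * w $ 2)) (at x)"
    for c0 c1 c2 c3 c4 c5 x
    unfolding power2_eq_square
    by (rule has_derivative_eq_rhs, (rule has_derivative_add has_derivative_const has_derivative_mult h)+)
      (auto simp: fun_eq_iff algebra_simps)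
  have un: "P i 1 x = k \<and> P i 2 x = l"
    if "x \<in> U" "(p i has_derivative (\<lambda>w. k * w $ 1 + l * w $ 2)) (at x)" for i k l x
  proof -
    have "(\<lambda>w :: real^2. P i 1 x * w $ 1 + P i 2 x * w $ 2) = (\<lambda>w. k * w $ 1 + l * w $ 2)"
      by (rule has_derivative_unique[OF P[OF that(1)] that(2)])
    from fun_cong[OF this, of "axis 1 1"] fun_cong[OF this, of "axis 2 1"]
    show ?thesis by (simp add: axis_def)
  qed
  have aP: "P 1 1 x = a1 + 2 * a3 * x $ 1 + a4 * x $ 2 \<and> P 1 2 x = a2 + a4 * x $ 1 + 2 * a5 * x $ 2" if "x \<in> U" for x
    using D[of a0 a1 a2 a3 a4 a5 x] un[OF that, of 1] unfolding a by blast
  have bP: "P 2 1 x = b1 + 2 * b3 * x $ 1 + b4 * x $ 2 \<and> P 2 2 x = b2 + b4 * x $ 1 + 2 * b5 * x $ 2" if "x \<in> U" for x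
    using D[of b0 b1 b2 b3 b4 b5 x] un[OF that, of 2] unfolding b by blast
  have lin: "k = 0 \<and> l = 0 \<and> j = 0" if "\<And>x. x \<in> U \<Longrightarrow> k + l * x $ 1 + j * x $ 2 = 0" for k l j :: real
  proof -
    have q: "(\<lambda>x. k + (vector [l, j] :: real^2) \<bullet> x) \<in> polys 1" unfolding polys_1_iff by blast
    have z: "k + (vector [l, j] :: real^2) \<bullet> x = 0" for x
      by (rule polys_1_eq_0_on_open[OF q U]) (use that in \<open>simp add: inner_vec_def sum_2 add.assoc\<close>)
    from z[of 0] z[of "axis 1 1"] z[of "axis 2 1"] show ?thesis by (simp add: inner_axis)
  qed
  have "a1 = 0 \<and> 2 * a3 = 0 \<and> a4 = 0" using e[of _ 1 1] aP by (intro lin) force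
  moreover have "b2 = 0 \<and> b4 = 0 \<and> 2 * b5 = 0" using e[of _ 2 2] bP by (intro lin) force
  moreover have "a2 + b1 = 0 \<and> a4 + 2 * b3 = 0 \<and> 2 * a5 + b4 = 0"
  proof (rule lin)
    fix x assume x: "x \<in> U"
    show "a2 + b1 + (a4 + 2 * b3) * x $ 1 + (2 * a5 + b4) * x $ 2 = 0"
      using e[OF x, of 1 2] aP[OF x] bP[OF x] by (simp add: algebra_simps)
  qed
  ultimately have z: "a1 = 0" "a3 = 0" "a4 = 0" "a5 = 0" "b2 = 0" "b3 = 0" "b4 = 0" "b5 = 0" "a2 = - b1" by auto
  show ?thesis
    by (rule that[of a0 b1 b0]) (simp_all add: a b z)
qed

lemma form_a_nonneg: "\<nu> > 0 \<Longrightarrow> 0 \<le> form_a \<nu> \<Omega> u u"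
  unfolding form_a_def by (intro mult_nonneg_nonneg sum_nonneg integral_nonneg_AE) auto

context slip_domain
begin

lemma interior_cell_nonempty:
  assumes "T \<in> \<T>" shows "interior T \<noteq> {}"
proof -
  obtain a b c where c: "cell a b c" "T = convex hull {a, b, c}" by (rule cell_cases[OF assms])
  note o = cell_orient[OF c(1)]
  have o': "orient b c a \<noteq> 0" "orient c a b \<noteq> 0" using o orient_cycle[of a b c] by auto
  define x where "x = (1/3) *\<^sub>R a + (1/3) *\<^sub>R b + (1/3) *\<^sub>R c"
  have "bary a b c x = 1/3" "bary b c a x = 1/3" "bary c a b x = 1/3"
    using bary_of_comb[OF o, of "1/3" "1/3" "1/3"] bary_of_comb[OF o'(1), of "1/3" "1/3" "1/3"]
      bary_of_comb[OF o'(2), of "1/3" "1/3" "1/3"] by (simp_all add: x_def algebra_simps)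
  then have "x \<in> interior T" unfolding c(2) by (intro in_interior_triangle[OF o]) auto
  then show ?thesis by blast
qed

text \<open>The form is a positive multiple of a sum of integrals of squares, so each strain
  component vanishes almost everywhere. Continuity inside the cell upgrades this to every
  point.\<close>

lemma strain_eq_0:
  assumes "\<nu> > 0" and u: "u \<in> V_space \<Omega> \<T>" and "form_a \<nu> \<Omega> u u = 0" and T: "T \<in> \<T>" "x \<in> interior T"
  shows "strain u i j x = 0"
proof -
  define I where "I i j = (LINT x|lebesgue_on \<Omega>. strain u i j x * strain u i j x)" for i j
  have I: "I i j \<ge> 0" for i j unfolding I_def by (intro integral_nonneg_AE) auto
  have "(\<Sum>i\<in>UNIV. \<Sum>j\<in>UNIV. I i j) = 0" using assms(1,3) unfolding form_a_def I_def by simp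
  then have "\<forall>i\<in>UNIV. (\<Sum>j\<in>UNIV. I i j) = 0"
    by (subst (asm) sum_nonneg_eq_0_iff) (auto intro: sum_nonneg I)
  then have "\<forall>j\<in>UNIV. I i j = 0"
    using I by (subst sum_nonneg_eq_0_iff[symmetric]) auto
  then have "I i j = 0" by blast
  moreover have int: "integrable (lebesgue_on \<Omega>) (\<lambda>x. strain u i j x * strain u i j x)"
    by (intro piecewise_integral(1) piecewise_mult strain_piecewise u)
  ultimately have AE: "AE x in lebesgue_on \<Omega>. strain u i j x * strain u i j x = 0"
    using integral_nonneg_eq_0_iff_AE[OF int] unfolding I_def by auto
  obtain G where G: "continuous_on UNIV G" "\<forall>x\<in>interior T. strain u i j x = G x"
    using strain_piecewise[OF u] T(1) unfolding piecewise_def by blast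
  have "continuous_on (interior T) (strain u i j)"
    using continuous_on_subset[OF G(1), of "interior T"] G(2) by (simp cong: continuous_on_cong)
  then have "continuous_on (interior T) (\<lambda>x. strain u i j x * strain u i j x)" by (intro continuous_on_mult)
  from AE_eq_0_imp_eq_0_on_open[OF AE domain_sets open_interior interior_cell_subset[OF T(1)] this T(2)]
  show ?thesis by simp
qed

text \<open>An infinitesimal rigid motion: a translation plus \<omega> times the rotation by a right
  angle.\<close>

definition rigid :: "real \<Rightarrow> real \<Rightarrow> real \<Rightarrow> real^2 \<Rightarrow> real^2" where
  "rigid c d \<omega> x = vector [c - \<omega> * x $ 2, d + \<omega> * x $ 1]"

lemma rigid_eq:
  assumes "rigid c d \<omega> x = rigid c' d' \<omega>' x" "rigid c d \<omega> y = rigid c' d' \<omega>' y" "x \<noteq> y"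
  shows "c = c' \<and> d = d' \<and> \<omega> = \<omega>'"
proof -
  have v: "rigid c d \<omega> x $ 1 = c - \<omega> * x $ 2" "rigid c d \<omega> x $ 2 = d + \<omega> * x $ 1" for c d \<omega> x
    by (simp_all add: rigid_def)
  have e: "c - \<omega> * x $ 2 = c' - \<omega>' * x $ 2" "d + \<omega> * x $ 1 = d' + \<omega>' * x $ 1"
    "c - \<omega> * y $ 2 = c' - \<omega>' * y $ 2" "d + \<omega> * y $ 1 = d' + \<omega>' * y $ 1"
    using assms(1,2) v by metis+
  then have "(\<omega> - \<omega>') * (x $ 1 - y $ 1) = 0" "(\<omega> - \<omega>') * (x $ 2 - y $ 2) = 0" by algebra+
  moreover have "x $ 1 \<noteq> y $ 1 \<or> x $ 2 \<noteq> y $ 2" using assms(3) by (auto simp: vec_eq_iff forall_2)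
  ultimately have "\<omega> = \<omega>'" by auto
  then show ?thesis using e by simp
qed

lemma rigid_on_cell:
  assumes "\<nu> > 0" and u: "u \<in> V_space \<Omega> \<T>" and "form_a \<nu> \<Omega> u u = 0" and T: "T \<in> \<T>"
  shows "\<exists>c d \<omega>. \<forall>x\<in>T. u x = rigid c d \<omega> x"
proof -
  have "\<forall>i. \<exists>p. p \<in> polys 2 \<and> (\<forall>x\<in>T. u x $ i = p x)"
    using u T unfolding V_space_def poly_on_def by blast
  from choice[OF this] obtain p where p: "\<And>i. p i \<in> polys 2" "\<And>i x. x \<in> T \<Longrightarrow> u x $ i = p i x" by blast
  obtain P :: "2 \<Rightarrow> 2 \<Rightarrow> real^2 \<Rightarrow> real" where P: "\<And>x. x \<in> interior T \<Longrightarrow> (u has_derivative (\<lambda>w. \<chi> i. P i 1 x * w $ 1 + P i 2 x * w $ 2)) (at x)"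
    "\<And>x i j. x \<in> interior T \<Longrightarrow> pderiv_comp u i j x = P i j x"
    using V_space_derivative[OF u T] by blast
  note ne = interior_cell_nonempty[OF T]
  obtain c d \<omega> where r: "\<And>x. p 1 x = c - \<omega> * x $ 2" "\<And>x. p 2 x = d + \<omega> * x $ 1"
  proof (rule quadratic_rigid[OF p(1) open_interior ne])
    fix i x assume x: "x \<in> interior T"
    have "((\<lambda>x. u x $ i) has_derivative (\<lambda>w. P i 1 x * w $ 1 + P i 2 x * w $ 2)) (at x)"
      using bounded_linear.has_derivative[OF bounded_linear_vec_nth[of i] P(1)[OF x]] by simp
    then show "(p i has_derivative (\<lambda>w. P i 1 x * w $ 1 + P i 2 x * w $ 2)) (at x)"
    proof (rule has_derivative_transform_within_open[OF _ open_interior x])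
      show "u y $ i = p i y" if "y \<in> interior T" for y using p(2) interior_subset that by blast
    qed
  next
    fix i j x assume x: "x \<in> interior T"
    show "P i j x + P j i x = 0"
      using strain_eq_0[OF assms(1,2,3) T x, of i j] by (simp add: strain_def P(2)[OF x])
  qed blast
  have "u x = rigid c d \<omega> x" if "x \<in> T" for x
    using p(2)[OF that, of 1] p(2)[OF that, of 2] r by (simp add: rigid_def vec_eq_iff forall_2)
  then show ?thesis by blast
qed

text \<open>This is the kernel part of the Korn inequality: it gives definiteness of the strain
  form, without a constant.\<close>

lemma korn:
  assumes "\<nu> > 0" and u: "u \<in> V\<tau>" and "form_a \<nu> \<Omega> u u = 0" and x: "x \<in> closure \<Omega>"
  shows "u x = 0"
proof -
  have uV: "u \<in> V_space \<Omega> \<T>" using u unfolding V_tau_space_def by blast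
  have "\<forall>T\<in>\<T>. \<exists>q. \<forall>x\<in>T. u x = rigid (fst q) (fst (snd q)) (snd (snd q)) x"
    using rigid_on_cell[OF assms(1) uV assms(3)] by (simp add: split_paired_Ex)
  from bchoice[OF this] obtain q where
    q: "\<And>T x. T \<in> \<T> \<Longrightarrow> x \<in> T \<Longrightarrow> u x = rigid (fst (q T)) (fst (snd (q T))) (snd (snd (q T))) x" by blast
  \<comment> \<open>Cells that meet only in a vertex share one point, too little to compare rigid
    motions. Deleting the finitely many vertices leaves a connected open set.\<close>
  let ?S = "\<Omega> - mesh_vertices \<T>"
  have common: "q T = q T'" if T: "T \<in> \<T>" "T' \<in> \<T>" "x \<in> T" "x \<in> T'" "x \<notin> mesh_vertices \<T>" for T T' x
  proof -
    \<comment> \<open>If x were the only common point, it would be a face of T and hence a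
      vertex.\<close>
    have "T \<inter> T' \<noteq> {x}"
    proof
      assume "T \<inter> T' = {x}"
      then have "x extreme_point_of T"
        using mesh_face[OF T(1,2)] by (simp add: face_of_singleton)
      then show False using T(1,5) unfolding mesh_vertices_def by blast
    qed
    then obtain y where y: "y \<in> T" "y \<in> T'" "x \<noteq> y" using T(3,4) by blast
    have "rigid (fst (q T)) (fst (snd (q T))) (snd (snd (q T))) x = rigid (fst (q T')) (fst (snd (q T'))) (snd (snd (q T'))) x"
      "rigid (fst (q T)) (fst (snd (q T))) (snd (snd (q T))) y = rigid (fst (q T')) (fst (snd (q T'))) (snd (snd (q T'))) y"
      using q T y by metis+
    from rigid_eq[OF this y(3)] show ?thesis by (simp add: prod_eq_iff)
  qed
  have conn: "connected ?S"
    using connected_open_delete_finite[OF open_domain connected_domain _ finite_vertices] by simp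
  \<comment> \<open>The rigid motion is locally constant: all cells at a point near a contain a,
    where \<open>common\<close> identifies their parameters. Connectedness spreads this over
    \<open>?S\<close>.\<close>
  have same: "\<forall>T\<in>\<T>. \<forall>T'\<in>\<T>. a \<in> T \<and> b \<in> T' \<longrightarrow> q T = q T'" if "a \<in> ?S" "b \<in> ?S" for a b
  proof (rule connected_equivalence_relation[OF conn that, where R = "\<lambda>a b. \<forall>T\<in>\<T>. \<forall>T'\<in>\<T>. a \<in> T \<and> b \<in> T' \<longrightarrow> q T = q T'"])
    fix x y assume "\<forall>T\<in>\<T>. \<forall>T'\<in>\<T>. x \<in> T \<and> y \<in> T' \<longrightarrow> q T = q T'"
    then show "\<forall>T\<in>\<T>. \<forall>T'\<in>\<T>. y \<in> T \<and> x \<in> T' \<longrightarrow> q T = q T'" by metis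
  next
    fix x y z assume xy: "\<forall>T\<in>\<T>. \<forall>T'\<in>\<T>. x \<in> T \<and> y \<in> T' \<longrightarrow> q T = q T'"
      and yz: "\<forall>T\<in>\<T>. \<forall>T'\<in>\<T>. y \<in> T \<and> z \<in> T' \<longrightarrow> q T = q T'" and yS: "y \<in> ?S"
    have "y \<in> closure \<Omega>" using yS closure_subset by blast
    then obtain S where S: "S \<in> \<T>" "y \<in> S" by (rule in_closure_cell)
    show "\<forall>T\<in>\<T>. \<forall>T'\<in>\<T>. x \<in> T \<and> z \<in> T' \<longrightarrow> q T = q T'"
    proof (intro ballI impI)
      fix T T' assume T: "T \<in> \<T>" "T' \<in> \<T>" "x \<in> T \<and> z \<in> T'"
      have "q T = q S" using xy[rule_format, OF T(1) S(1)] T(3) S(2) by blast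
      also have "\<dots> = q T'" using yz[rule_format, OF S(1) T(2)] T(3) S(2) by blast
      finally show "q T = q T'" .
    qed
  next
    fix a assume a: "a \<in> ?S"
    obtain r where r: "r > 0" "\<And>z T. z \<in> ball a r \<Longrightarrow> T \<in> \<T> \<Longrightarrow> z \<in> T \<Longrightarrow> a \<in> T"
      by (rule locally_cells[of a]) blast
    have "openin (top_of_set ?S) (?S \<inter> ball a r)" by (intro openin_open_Int open_ball)
    moreover have "a \<in> ?S \<inter> ball a r" using a r(1) by simp
    moreover have "\<forall>x\<in>?S \<inter> ball a r. \<forall>T\<in>\<T>. \<forall>T'\<in>\<T>. a \<in> T \<and> x \<in> T' \<longrightarrow> q T = q T'"
    proof (intro ballI impI)
      fix x T T' assume "x \<in> ?S \<inter> ball a r" "T \<in> \<T>" "T' \<in> \<T>" "a \<in> T \<and> x \<in> T'"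
      then have "a \<in> T" "a \<in> T'" using r(2)[of x T'] by auto
      then show "q T = q T'" using common[OF \<open>T \<in> \<T>\<close> \<open>T' \<in> \<T>\<close>] a by simp
    qed
    ultimately show "\<exists>U. openin (top_of_set ?S) U \<and> a \<in> U \<and>
        (\<forall>x\<in>U. \<forall>T\<in>\<T>. \<forall>T'\<in>\<T>. a \<in> T \<and> x \<in> T' \<longrightarrow> q T = q T')" by blast
  qed
  have inner: "\<exists>y\<in>?S. y \<in> T" if T: "T \<in> \<T>" for T
  proof -
    obtain x where x: "x \<in> interior T" using interior_cell_nonempty[OF T] by blast
    then have xT: "x \<in> T" "x \<in> \<Omega>" using interior_subset interior_cell_subset[OF T] by blast+
    have "x \<notin> mesh_vertices \<T>"
      using vertex_in_cell[OF _ T xT(1)] extreme_point_not_in_interior[of x T] x by blast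
    then show ?thesis using xT by blast
  qed
  have allq: "q T = q T'" if T: "T \<in> \<T>" "T' \<in> \<T>" for T T'
  proof -
    obtain y y' where y: "y \<in> ?S" "y \<in> T" "y' \<in> ?S" "y' \<in> T'" using inner[OF T(1)] inner[OF T(2)] by blast
    show ?thesis using same[OF y(1,3), rule_format, OF T] y(2,4) by simp
  qed
  obtain T0 where T0: "T0 \<in> \<T>" "x \<in> T0" by (rule in_closure_cell[OF x])
  have ux: "u y = rigid (fst (q T0)) (fst (snd (q T0))) (snd (snd (q T0))) y" if y: "y \<in> closure \<Omega>" for y
  proof -
    obtain T where T: "T \<in> \<T>" "y \<in> T" by (rule in_closure_cell[OF y])
    then show ?thesis using q[OF T] allq[OF T(1) T0(1)] by simp
  qed
  have "u C = 0" "C \<in> closure \<Omega>" if "C \<in> {A, B}" for C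
  proof -
    have "C \<in> mesh_nodes \<T>" using that corners_nodes by blast
    then show "C \<in> closure \<Omega>" using nodes_subset by blast
    show "u C = 0"
      using u corner_in_closure_\<Gamma>0[OF that] \<open>C \<in> mesh_nodes \<T>\<close> unfolding V_tau_space_def by blast
  qed
  then have AB0: "u A = 0" "u B = 0" "A \<in> closure \<Omega>" "B \<in> closure \<Omega>" by blast+
  have r0: "rigid 0 0 0 y = 0" for y by (simp add: rigid_def vec_eq_iff forall_2)
  have "fst (q T0) = 0 \<and> fst (snd (q T0)) = 0 \<and> snd (snd (q T0)) = 0"
    by (rule rigid_eq[OF _ _ AB]) (simp_all only: r0 AB0(1,2) ux[OF AB0(3), symmetric] ux[OF AB0(4), symmetric])
  then show ?thesis using ux[OF x] r0 by simp
qed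

end

subsection \<open>Solvability of the discrete problem\<close>

text \<open>Letting t tend to 0. The expression is the difference quotient of a quadratic energy
  along a feasible segment, so the conclusion is the first order condition at a minimum.\<close>

lemma slope_nonneg:
  fixes \<alpha> \<beta> :: real
  assumes "\<And>t. 0 < t \<Longrightarrow> t \<le> 1 \<Longrightarrow> 0 \<le> 2 * \<alpha> + t * \<beta>"
  shows "0 \<le> \<alpha>"
proof (rule ccontr)
  assume neg: "\<not> 0 \<le> \<alpha>"
  define t where "t = min 1 (- \<alpha> / (\<bar>\<beta>\<bar> + 1))"
  have b: "\<bar>\<beta>\<bar> + 1 > 0" by linarith
  have "0 < - \<alpha> / (\<bar>\<beta>\<bar> + 1)" using neg b by (intro divide_pos_pos) auto
  then have t: "0 < t" "t \<le> 1" by (simp_all add: t_def)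
  have "t * (\<bar>\<beta>\<bar> + 1) \<le> - \<alpha>" using b by (simp add: t_def pos_le_divide_eq[symmetric])
  moreover have "t * \<beta> \<le> t * (\<bar>\<beta>\<bar> + 1)" using t by (intro mult_left_mono) auto
  ultimately show False using assms[OF t] neg by linarith
qed

text \<open>The Tychonoff theorem. In \<open>solution_exists\<close> the index type is the whole
  plane: multipliers are total functions, of which the energy sees only the finitely many
  coordinates in \<open>N1\<close>.\<close>

lemma compact_cube: "compact (PiE UNIV (\<lambda>_. {-1..1}) :: ('a \<Rightarrow> real) set)"
proof -
  have "compactin (product_topology (\<lambda>_ :: 'a. euclidean :: real topology) UNIV) (PiE UNIV (\<lambda>_. {-1..1}))"
    unfolding compactin_PiE by (simp add: compact_Icc)
  then show ?thesis unfolding euclidean_product_topology by simp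
qed

context triangulated_domain
begin

lemma V_linearD:
  assumes "V_linear L" "u \<in> V_space \<Omega> \<T>"
  shows "v \<in> V_space \<Omega> \<T> \<Longrightarrow> L (\<lambda>x. u x + v x) = L u + L v"
    and "L (\<lambda>x. c *\<^sub>R u x) = c * L u"
    and "(\<And>x. x \<in> closure \<Omega> \<Longrightarrow> u x = v x) \<Longrightarrow> L u = L v"
  using assms unfolding V_linear_def by blast+

lemma V_linear_0: "V_linear L \<Longrightarrow> L (\<lambda>x. 0) = 0"
proof -
  assume L: "V_linear L"
  have z: "(\<lambda>x. 0) \<in> V_space \<Omega> \<T>" unfolding V_space_def by (simp add: poly_on_0)
  from V_linearD(2)[OF L z, of 0] show ?thesis by simp
qed

lemma V_space_sum:
  "(\<And>i. i \<in> I \<Longrightarrow> u i \<in> V_space \<Omega> \<T>) \<Longrightarrow> (\<lambda>x. \<Sum>i\<in>I. c i *\<^sub>R u i x) \<in> V_space \<Omega> \<T>"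
proof (induction I rule: infinite_finite_induct)
  case (insert i I)
  then have "(\<lambda>x. c i *\<^sub>R u i x + (\<Sum>i\<in>I. c i *\<^sub>R u i x)) \<in> V_space \<Omega> \<T>"
    by (intro V_space_add V_space_scale) auto
  then show ?case using insert.hyps by simp
qed (simp_all add: V_space_def poly_on_0)

lemma V_linear_sum:
  assumes L: "V_linear L"
  shows "finite I \<Longrightarrow> (\<And>i. i \<in> I \<Longrightarrow> u i \<in> V_space \<Omega> \<T>) \<Longrightarrow>
    L (\<lambda>x. \<Sum>i\<in>I. c i *\<^sub>R u i x) = (\<Sum>i\<in>I. c i * L (u i))"
proof (induction I rule: finite_induct)
  case empty
  then show ?case using V_linear_0[OF L] by simp
next
  case (insert i I)
  have ui: "u i \<in> V_space \<Omega> \<T>" "(\<lambda>x. c i *\<^sub>R u i x) \<in> V_space \<Omega> \<T>"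
    "(\<lambda>x. \<Sum>i\<in>I. c i *\<^sub>R u i x) \<in> V_space \<Omega> \<T>"
    using insert.prems by (auto intro: V_space_scale V_space_sum)
  have "L (\<lambda>x. c i *\<^sub>R u i x + (\<Sum>i\<in>I. c i *\<^sub>R u i x)) = L (\<lambda>x. c i *\<^sub>R u i x) + L (\<lambda>x. \<Sum>i\<in>I. c i *\<^sub>R u i x)"
    by (rule V_linearD(1)[OF L ui(2,3)])
  moreover have "L (\<lambda>x. c i *\<^sub>R u i x) = c i * L (u i)" by (rule V_linearD(2)[OF L ui(1)])
  ultimately show ?case using insert by simp
qed

lemma V_linear_add:
  assumes "V_linear L" "V_linear L'"
  shows "V_linear (\<lambda>v. L v + L' v)"
proof -
  have "L u + L' u = L v + L' v" if "u \<in> V_space \<Omega> \<T>" "\<forall>x\<in>closure \<Omega>. u x = v x" for u v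
    using assms that unfolding V_linear_def by metis
  then show ?thesis using assms unfolding V_linear_def by (simp add: distrib_left)
qed

lemma V_linear_value:
  "z \<in> closure \<Omega> \<Longrightarrow> V_linear (\<lambda>v. k * (l * (v z \<bullet> w)))"
  unfolding V_linear_def by (simp add: inner_add_left distrib_left mult_ac)

lemma Q_space_sum:
  "(\<And>i. i \<in> I \<Longrightarrow> q i \<in> Q_space \<Omega> \<T>) \<Longrightarrow> (\<lambda>x. \<Sum>i\<in>I. c i * q i x) \<in> Q_space \<Omega> \<T>"
proof (induction I rule: infinite_finite_induct)
  case (insert i I)
  then have "(\<lambda>x. c i * q i x + (\<Sum>i\<in>I. c i * q i x)) \<in> Q_space \<Omega> \<T>"
    by (intro Q_space_add Q_space_scale) auto
  then show ?case using insert.hyps by simp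
qed (simp_all add: Q_space_def poly_on_0)

lemma form_b_sum:
  assumes u: "u \<in> V_space \<Omega> \<T>"
  shows "finite I \<Longrightarrow> (\<And>i. i \<in> I \<Longrightarrow> q i \<in> Q_space \<Omega> \<T>) \<Longrightarrow>
    form_b \<Omega> u (\<lambda>x. \<Sum>i\<in>I. c i * q i x) = (\<Sum>i\<in>I. c i * form_b \<Omega> u (q i))"
proof (induction I rule: finite_induct)
  case empty
  then show ?case by (simp add: form_b_def)
next
  case (insert i I)
  have "form_b \<Omega> u (\<lambda>x. c i * q i x + (\<Sum>i\<in>I. c i * q i x)) =
      form_b \<Omega> u (\<lambda>x. c i * q i x) + form_b \<Omega> u (\<lambda>x. \<Sum>i\<in>I. c i * q i x)"
    using insert.prems by (intro form_b_add u Q_space_scale Q_space_sum) auto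
  then show ?case using insert by (simp add: form_b_scale)
qed

lemma Q_space_expansion:
  assumes "q \<in> Q_space \<Omega> \<T>" "x \<in> closure \<Omega>"
  shows "q x = (\<Sum>a\<in>mesh_vertices \<T>. q a * hat a x)"
proof -
  let ?r = "\<lambda>x. \<Sum>a\<in>mesh_vertices \<T>. q a * hat a x"
  have rQ: "?r \<in> Q_space \<Omega> \<T>" by (intro Q_space_sum hat_in_Q)
  obtain T where T: "T \<in> \<T>" "x \<in> T" by (rule in_closure_cell[OF assms(2)])
  obtain a b c where c: "cell a b c" "T = convex hull {a, b, c}" by (rule cell_cases[OF T(1)])
  obtain p where p: "p \<in> polys 1" "\<And>y. y \<in> T \<Longrightarrow> q y = p y"
    using assms(1) T(1) unfolding Q_space_def poly_on_def by blast
  obtain p' where p': "p' \<in> polys 1" "\<And>y. y \<in> T \<Longrightarrow> ?r y = p' y"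
    using rQ T(1) unfolding Q_space_def poly_on_def by blast
  have "p v = p' v" if v: "v \<in> {a, b, c}" for v
  proof -
    have "v extreme_point_of T" using cell_extreme[OF c(1)] c(2) v by blast
    then have vv: "v \<in> mesh_vertices \<T>" "v \<in> T" using T(1) extreme_in unfolding mesh_vertices_def by auto
    have "?r v = (\<Sum>a\<in>mesh_vertices \<T>. if a = v then q v else 0)"
      by (rule sum.cong) (auto simp: hat_vertex[OF vv(1)])
    then have "?r v = q v" using vv(1) finite_vertices by simp
    then show ?thesis using p(2)[OF vv(2)] p'(2)[OF vv(2)] by simp
  qed
  then have "p x = p' x" using polys_1_eq_on_hull[OF p(1) p'(1)] T(2) c(2) by blast
  then show ?thesis using p(2)[OF T(2)] p'(2)[OF T(2)] by simp
qed

end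

context slip_domain
begin

lemma V\<tau>_V: "v \<in> V\<tau> \<Longrightarrow> v \<in> V_space \<Omega> \<T>"
  unfolding V_tau_space_def by blast

lemma V\<tau>_add: "u \<in> V\<tau> \<Longrightarrow> v \<in> V\<tau> \<Longrightarrow> (\<lambda>x. u x + v x) \<in> V\<tau>"
  unfolding V_tau_space_def by (auto intro: V_space_add simp: inner_add_left)

lemma V\<tau>_scale: "u \<in> V\<tau> \<Longrightarrow> (\<lambda>x. c *\<^sub>R u x) \<in> V\<tau>"
  unfolding V_tau_space_def by (auto intro: V_space_scale)

lemma V\<tau>_sum: "(\<And>i. i \<in> I \<Longrightarrow> u i \<in> V\<tau>) \<Longrightarrow> (\<lambda>x. \<Sum>i\<in>I. c i *\<^sub>R u i x) \<in> V\<tau>"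
  using V_space_sum[of I u c] unfolding V_tau_space_def by (auto simp: inner_sum_left)

lemma V\<tau>_corner: "v \<in> V\<tau> \<Longrightarrow> v A = 0 \<and> v B = 0"
  using corner_in_closure_\<Gamma>0 corners_nodes unfolding V_tau_space_def by blast

text \<open>The degrees of freedom, as pairs of a node and a direction: both components at nodes in
  \<Omega>, the normal component at nodes of \<Gamma>1, none on the closure of \<Gamma>0.\<close>

definition V_index :: "((real^2) \<times> (real^2)) set" where
  "V_index = (mesh_nodes \<T> \<inter> \<Omega>) \<times> {axis 1 1, axis 2 1} \<union> N1 \<times> {n}"

definition V_basis :: "(real^2) \<times> (real^2) \<Rightarrow> real^2 \<Rightarrow> real^2" where
  "V_basis i x = shape (fst i) x *\<^sub>R snd i"

lemma finite_V_index: "finite V_index"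
  unfolding V_index_def using finite_nodes by simp

lemma V_basis_in: "i \<in> V_index \<Longrightarrow> V_basis i \<in> V\<tau>"
  unfolding V_index_def V_basis_def using shape_interior_V\<tau> shape_N1_V\<tau> by force

text \<open>At every node the admissible directions are orthonormal, so inner products are the
  coefficients; at a node of \<Gamma>1 the vanishing tangential component leaves only n.\<close>

lemma V\<tau>_expansion:
  assumes v: "v \<in> V\<tau>" and x: "x \<in> closure \<Omega>"
  shows "v x = (\<Sum>i\<in>V_index. (v (fst i) \<bullet> snd i) *\<^sub>R V_basis i x)"
proof (rule V_space_eq_of_nodes[OF V\<tau>_V[OF v] _ _ x])
  show "(\<lambda>x. \<Sum>i\<in>V_index. (v (fst i) \<bullet> snd i) *\<^sub>R V_basis i x) \<in> V_space \<Omega> \<T>"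
    by (intro V\<tau>_V V\<tau>_sum V_basis_in)
  fix z assume z: "z \<in> mesh_nodes \<T>"
  have node: "fst i \<in> mesh_nodes \<T>" if "i \<in> V_index" for i using that unfolding V_index_def by auto
  have "(\<Sum>i\<in>V_index. (v (fst i) \<bullet> snd i) *\<^sub>R V_basis i z)
      = (\<Sum>i\<in>V_index. if fst i = z then (v z \<bullet> snd i) *\<^sub>R snd i else 0)"
    by (intro sum.cong refl) (auto simp: V_basis_def shape_node[OF node z])
  also have "\<dots> = (\<Sum>i\<in>{i\<in>V_index. fst i = z}. (v z \<bullet> snd i) *\<^sub>R snd i)"
    using finite_V_index by (simp add: sum.inter_filter)
  also have "\<dots> = v z"
    using z
  proof (cases rule: node_cases)
    case 1
    then have "z \<notin> N1" using \<Gamma>1_frontier frontier_iff by blast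
    then have "{i\<in>V_index. fst i = z} = {(z, axis 1 1), (z, axis 2 1)}"
      unfolding V_index_def using 1 z by auto
    moreover have "(axis 1 1 :: real^2) \<noteq> axis 2 1" by (simp add: axis_eq_axis)
    ultimately have "(\<Sum>i\<in>{i\<in>V_index. fst i = z}. (v z \<bullet> snd i) *\<^sub>R snd i)
        = (v z \<bullet> axis 1 1) *\<^sub>R axis 1 1 + (v z \<bullet> axis 2 1) *\<^sub>R axis 2 1" by simp
    also have "\<dots> = v z"
      unfolding inner_axis inner_real_def by (simp add: vec_eq_iff forall_2 axis_def)
    finally show ?thesis .
  next
    case 2
    then have "z \<notin> N1" "z \<notin> \<Omega>" using closure_\<Gamma>0_disjoint frontier_cases frontier_iff by blast+
    then have "{i\<in>V_index. fst i = z} = {}" unfolding V_index_def by auto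
    moreover have "v z = 0" using v 2 z unfolding V_tau_space_def by blast
    ultimately show ?thesis by (simp only: sum.empty)
  next
    case 3
    then have "z \<notin> \<Omega>" using \<Gamma>1_frontier frontier_iff by blast
    then have "{i\<in>V_index. fst i = z} = {(z, n)}" unfolding V_index_def using 3 by auto
    moreover have "(v z \<bullet> n) *\<^sub>R n = v z"
    proof -
      have t: "v z \<bullet> tangent n = 0" using v 3 unfolding V_tau_space_def by blast
      have nn: "n $ 1 * n $ 1 + n $ 2 * n $ 2 = 1"
        using normal_n(1) by (simp add: norm_eq_1 inner_vec_def sum_2)
      have "v z $ 1 * n $ 2 - v z $ 2 * n $ 1 = 0"
        using t by (simp add: tangent_def inner_vec_def sum_2)
      with nn show ?thesis
        unfolding vec_eq_iff forall_2 inner_vec_def sum_2 vector_scaleR_component inner_real_def real_scaleR_def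
        by algebra
    qed
    ultimately show ?thesis by simp
  qed
  finally show "v z = (\<Sum>i\<in>V_index. (v (fst i) \<bullet> snd i) *\<^sub>R V_basis i z)" by simp
qed

lemma V_linear_expansion:
  assumes "V_linear L" "v \<in> V\<tau>"
  shows "L v = (\<Sum>i\<in>V_index. (v (fst i) \<bullet> snd i) * L (V_basis i))"
proof -
  have "L v = L (\<lambda>x. \<Sum>i\<in>V_index. (v (fst i) \<bullet> snd i) *\<^sub>R V_basis i x)"
    by (rule V_linearD(3)[OF assms(1) V\<tau>_V[OF assms(2)] V\<tau>_expansion[OF assms(2)]])
  also have "\<dots> = (\<Sum>i\<in>V_index. (v (fst i) \<bullet> snd i) * L (V_basis i))"
    by (rule V_linear_sum[OF assms(1) finite_V_index]) (use V_basis_in V\<tau>_V in blast)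
  finally show ?thesis .
qed

text \<open>The saddle point matrix is symmetric, and a vector in its kernel has vanishing velocity part by
  lemma \<open>korn\<close>; hence every right hand side that only tests the velocity is orthogonal to the kernel.\<close>

lemma stokes_solvable:
  assumes \<nu>: "\<nu> > 0" and L: "V_linear L"
  shows "\<exists>u\<in>V\<tau>. \<exists>p\<in>Q_space \<Omega> \<T>. (\<forall>v\<in>V\<tau>. form_a \<nu> \<Omega> u v + form_b \<Omega> v p = L v) \<and>
    (\<forall>q\<in>Q_space \<Omega> \<T>. form_b \<Omega> u q = 0)"
proof -
  let ?Q = "mesh_vertices \<T>"
  let ?I = "V_index <+> ?Q"
  \<comment> \<open>The block matrix with velocity block a, off-diagonal blocks b and its transpose,
    and zero pressure block; \<open>R\<close> loads only the velocity rows.\<close>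
  define K where "K i j = (case i of Inl i \<Rightarrow> (case j of Inl j \<Rightarrow> form_a \<nu> \<Omega> (V_basis i) (V_basis j)
      | Inr b \<Rightarrow> form_b \<Omega> (V_basis i) (hat b))
    | Inr a \<Rightarrow> (case j of Inl j \<Rightarrow> form_b \<Omega> (V_basis j) (hat a) | Inr b \<Rightarrow> 0))" for i j
  define R where "R i = (case i of Inl i \<Rightarrow> L (V_basis i) | Inr a \<Rightarrow> 0)" for i :: "((real^2) \<times> (real^2)) + real^2"
  define U where "U y = (\<lambda>x. \<Sum>i\<in>V_index. y (Inl i) *\<^sub>R V_basis i x)" for y :: "((real^2) \<times> (real^2)) + real^2 \<Rightarrow> real"
  define P where "P y = (\<lambda>x. \<Sum>a\<in>?Q. y (Inr a) * hat a x)" for y :: "((real^2) \<times> (real^2)) + real^2 \<Rightarrow> real"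
  have fin: "finite ?I" using finite_V_index finite_vertices by simp
  have split: "(\<Sum>i\<in>?I. F i) = (\<Sum>i\<in>V_index. F (Inl i)) + (\<Sum>a\<in>?Q. F (Inr a))" for F :: "_ \<Rightarrow> real"
    using sum.Plus[OF finite_V_index finite_vertices, of F] by (simp add: comp_def)
  have UV: "U y \<in> V\<tau>" for y unfolding U_def by (intro V\<tau>_sum V_basis_in)
  have PQ: "P y \<in> Q_space \<Omega> \<T>" for y unfolding P_def by (intro Q_space_sum hat_in_Q)
  have lin: "L' (U y) = (\<Sum>i\<in>V_index. y (Inl i) * L' (V_basis i))" if "V_linear L'" for L' y
    unfolding U_def by (rule V_linear_sum[OF that finite_V_index]) (use V_basis_in V\<tau>_V in blast)
  have bP: "form_b \<Omega> v (P y) = (\<Sum>a\<in>?Q. y (Inr a) * form_b \<Omega> v (hat a))" if "v \<in> V\<tau>" for v y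
    unfolding P_def by (rule form_b_sum[OF V\<tau>_V[OF that] finite_vertices hat_in_Q])
  have aL: "V_linear (\<lambda>u. form_a \<nu> \<Omega> u v)" if "v \<in> V\<tau>" for v by (rule V_linear_form_a[OF V\<tau>_V[OF that]])
  have sym: "K i j = K j i" for i j by (cases i; cases j) (simp_all add: K_def form_a_commute)
  have row1: "(\<Sum>j\<in>?I. K (Inl i) j * y j) = form_a \<nu> \<Omega> (U y) (V_basis i) + form_b \<Omega> (V_basis i) (P y)"
    if "i \<in> V_index" for i y
    using lin[OF aL[OF V_basis_in[OF that]], of y] bP[OF V_basis_in[OF that], of y]
    unfolding split by (simp add: K_def form_a_commute[of \<nu> "V_basis i"] mult.commute)
  have row2: "(\<Sum>j\<in>?I. K (Inr a) j * y j) = form_b \<Omega> (U y) (hat a)" for a y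
    using lin[OF V_linear_form_b[OF hat_in_Q[of a]], of y]
    unfolding split by (simp add: K_def mult.commute)
  have "\<exists>x. \<forall>i\<in>?I. (\<Sum>j\<in>?I. K i j * x j) = R i"
  proof (rule fredholm_finite[OF fin fin])
    fix y assume y: "\<And>j. j \<in> ?I \<Longrightarrow> (\<Sum>i\<in>?I. y i * K i j) = 0"
    have y': "(\<Sum>j\<in>?I. K i j * y j) = 0" if "i \<in> ?I" for i
      using y[OF that] sym by (simp add: mult.commute)
    have 1: "form_a \<nu> \<Omega> (U y) (V_basis i) + form_b \<Omega> (V_basis i) (P y) = 0" if "i \<in> V_index" for i
      using y'[of "Inl i"] row1[OF that] that by auto
    have 2: "form_b \<Omega> (U y) (hat a) = 0" if "a \<in> ?Q" for a
      using y'[of "Inr a"] row2[of a y] that by auto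
    have M: "V_linear (\<lambda>v. form_a \<nu> \<Omega> v (U y) + form_b \<Omega> v (P y))"
      by (intro V_linear_add aL UV V_linear_form_b PQ)
    \<comment> \<open>The velocity rows are tested with the velocity of the kernel vector itself;
      the mixed term then vanishes by the pressure rows.\<close>
    have "form_a \<nu> \<Omega> (U y) (U y) + form_b \<Omega> (U y) (P y) = 0"
      unfolding lin[OF M] using 1 by (intro sum.neutral) (simp add: form_a_commute)
    moreover have "form_b \<Omega> (U y) (P y) = 0"
      unfolding bP[OF UV] using 2 by (intro sum.neutral) simp
    ultimately have "form_a \<nu> \<Omega> (U y) (U y) = 0" by simp
    then have "U y x = 0" if "x \<in> closure \<Omega>" for x using korn[OF \<nu> UV _ that] by blast
    \<comment> \<open>Pairing y with \<open>R\<close> yields \<open>L (U y)\<close>, so no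
      information on the pressure part of y is required.\<close>
    then have "L (U y) = L (\<lambda>x. 0)" by (intro V_linearD(3)[OF L V\<tau>_V[OF UV]])
    then show "(\<Sum>i\<in>?I. y i * R i) = 0"
      unfolding split using lin[OF L, of y] V_linear_0[OF L] by (simp add: R_def)
  qed
  then obtain y where y: "\<And>i. i \<in> ?I \<Longrightarrow> (\<Sum>j\<in>?I. K i j * y j) = R i" by blast
  have "form_a \<nu> \<Omega> (U y) v + form_b \<Omega> v (P y) = L v" if v: "v \<in> V\<tau>" for v
  proof -
    have M: "V_linear (\<lambda>v. form_a \<nu> \<Omega> v (U y) + form_b \<Omega> v (P y))"
      by (intro V_linear_add aL UV V_linear_form_b PQ)
    have "form_a \<nu> \<Omega> (V_basis i) (U y) + form_b \<Omega> (V_basis i) (P y) = L (V_basis i)" if "i \<in> V_index" for i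
      using y[of "Inl i"] row1[OF that, of y] that by (auto simp: R_def form_a_commute)
    then have "form_a \<nu> \<Omega> v (U y) + form_b \<Omega> v (P y) = L v"
      unfolding V_linear_expansion[OF M v] V_linear_expansion[OF L v] by (intro sum.cong refl) simp
    then show ?thesis by (simp add: form_a_commute)
  qed
  moreover have "form_b \<Omega> (U y) q = 0" if q: "q \<in> Q_space \<Omega> \<T>" for q
  proof -
    have "form_b \<Omega> (U y) q = form_b \<Omega> (U y) (\<lambda>x. \<Sum>a\<in>?Q. q a * hat a x)"
      by (intro form_b_cong Q_space_expansion q)
    also have "\<dots> = (\<Sum>a\<in>?Q. q a * form_b \<Omega> (U y) (hat a))"
      by (rule form_b_sum[OF V\<tau>_V[OF UV] finite_vertices hat_in_Q])
    also have "\<dots> = 0"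
    proof (rule sum.neutral, rule ballI)
      fix a assume "a \<in> ?Q"
      then have "form_b \<Omega> (U y) (hat a) = 0" using y[of "Inr a"] row2[of a y] by (auto simp: R_def)
      then show "q a * form_b \<Omega> (U y) (hat a) = 0" by simp
    qed
    finally show ?thesis .
  qed
  ultimately show ?thesis using UV PQ by blast
qed

text \<open>Turns prescribed values at the nodes of \<Gamma>1 into a member of
  \<open>Lambda_space\<close>. The quadratic shape functions restrict to quadratics on the edges of
  the side and vanish at its ends when their node lies in \<Gamma>1.\<close>

definition nodal :: "(real^2 \<Rightarrow> real) \<Rightarrow> real^2 \<Rightarrow> real" where
  "nodal \<mu> x = (\<Sum>z\<in>N1. \<mu> z * shape z x)"

lemma nodal_node:
  assumes "y \<in> mesh_nodes \<T>"
  shows "nodal \<mu> y = (if y \<in> N1 then \<mu> y else 0)"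
proof -
  have "nodal \<mu> y = (\<Sum>z\<in>N1. if z = y then \<mu> y else 0)"
    unfolding nodal_def by (rule sum.cong) (use shape_node assms in auto)
  then show ?thesis using finite_N1 by simp
qed

lemma corner_notin_N1: "A \<notin> N1" "B \<notin> N1"
  unfolding \<Gamma>1_eq open_segment_def by auto

lemma side_edge_cell: "i \<in> {1..m} \<Longrightarrow> \<exists>T\<in>\<T>. closed_segment (M i) (M (i + 1)) \<subseteq> T"
  using side_edge[of i] unfolding edge_def by (meson cell_convex closed_segment_subset extreme_in)

lemma nodal_Lambda: "nodal \<mu> \<in> Lambda_space \<Gamma>1 m M"
proof -
  have "closure \<Gamma>1 \<subseteq> closure \<Omega>" unfolding closure_\<Gamma>1 using frontier_eq frontier_iff by blast
  then have "continuous_on (closure \<Gamma>1) (nodal \<mu>)"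
    unfolding nodal_def by (intro continuous_intros) (auto intro: continuous_on_subset[OF shape_continuous])
  moreover have "poly_on 2 (closed_segment (M i) (M (i + 1))) (nodal \<mu>)" if "i \<in> {1..m}" for i
  proof -
    obtain T where T: "T \<in> \<T>" "closed_segment (M i) (M (i + 1)) \<subseteq> T" using side_edge_cell[OF \<open>i \<in> {1..m}\<close>] by blast
    have "poly_on 2 T (nodal \<mu>)" unfolding nodal_def by (intro poly_on_sum poly_on_scale shape_poly_on T(1)) auto
    then show ?thesis using T(2) by (rule poly_on_mono)
  qed
  moreover have "nodal \<mu> A = 0" "nodal \<mu> B = 0"
    by (simp_all only: nodal_node[OF corners_nodes(1)] nodal_node[OF corners_nodes(2)] corner_notin_N1 if_False)
  ultimately show ?thesis unfolding Lambda_space_def using M_ends by simp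
qed

lemma form_Lambda_V:
  assumes "v \<in> V\<tau>"
  shows "form_Lambda g m M (\<lambda>x. v x \<bullet> n) \<mu> = (\<Sum>z\<in>N1. weight z * (g z * (v z \<bullet> n) * \<mu> z))"
  using V\<tau>_corner[OF assms] by (intro form_Lambda_eq) auto

lemma Lambda_tilde_N1: "\<mu> \<in> Lambda_tilde \<Gamma>1 \<T> m M \<Longrightarrow> z \<in> N1 \<Longrightarrow> \<bar>\<mu> z\<bar> \<le> 1"
  unfolding Lambda_tilde_def by blast

lemma nodal_Lambda_tilde: "(\<And>z. z \<in> N1 \<Longrightarrow> \<bar>\<mu> z\<bar> \<le> 1) \<Longrightarrow> nodal \<mu> \<in> Lambda_tilde \<Gamma>1 \<T> m M"
  unfolding Lambda_tilde_def using nodal_Lambda nodal_node by auto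

text \<open>For a given multiplier \<open>\<mu>\<close> the velocity \<open>U \<mu>\<close> is affine in \<open>\<mu>\<close>. Minimizing its energy over the cube
  \<open>\<bar>\<mu>\<bar> \<le> 1\<close> (the dual problem), the first order condition is the variational inequality.\<close>

lemma solution_exists:
  assumes \<nu>: "\<nu> > 0" and f: "L2_vec \<Omega> f"
  shows "\<exists>u p \<eta>. VE_solution \<Omega> \<Gamma>0 \<Gamma>1 n \<nu> f g \<T> m M u p \<eta>"
proof -
  let ?Q = "Q_space \<Omega> \<T>"
  obtain u0 p0 where u0: "u0 \<in> V\<tau>" "p0 \<in> ?Q" "\<And>v. v \<in> V\<tau> \<Longrightarrow> form_a \<nu> \<Omega> u0 v + form_b \<Omega> v p0 = L2_inner \<Omega> f v"
    "\<And>q. q \<in> ?Q \<Longrightarrow> form_b \<Omega> u0 q = 0"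
    using stokes_solvable[OF \<nu> V_linear_L2_inner[OF f]] by blast
  \<comment> \<open>One Stokes response for each unit multiplier at a node. Together with the
    response \<open>u0\<close> to f, superposition gives velocity and pressure for any nodal values
    \<mu>, with the sign of a term moved to the right hand side.\<close>
  have "\<forall>z\<in>N1. \<exists>sr. fst sr \<in> V\<tau> \<and> snd sr \<in> ?Q \<and>
      (\<forall>v\<in>V\<tau>. form_a \<nu> \<Omega> (fst sr) v + form_b \<Omega> v (snd sr) = weight z * (g z * (v z \<bullet> n))) \<and>
      (\<forall>q\<in>?Q. form_b \<Omega> (fst sr) q = 0)"
  proof
    fix z assume "z \<in> N1"
    then have "z \<in> closure \<Omega>" using nodes_subset by blast
    from stokes_solvable[OF \<nu> V_linear_value[OF this, of "weight z" "g z" n]]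
    obtain u p where "u \<in> V\<tau>" "p \<in> ?Q" "\<forall>v\<in>V\<tau>. form_a \<nu> \<Omega> u v + form_b \<Omega> v p = weight z * (g z * (v z \<bullet> n))"
      "\<forall>q\<in>?Q. form_b \<Omega> u q = 0" by blast
    then show "\<exists>sr. fst sr \<in> V\<tau> \<and> snd sr \<in> ?Q \<and>
      (\<forall>v\<in>V\<tau>. form_a \<nu> \<Omega> (fst sr) v + form_b \<Omega> v (snd sr) = weight z * (g z * (v z \<bullet> n))) \<and>
      (\<forall>q\<in>?Q. form_b \<Omega> (fst sr) q = 0)" by (intro exI[of _ "(u, p)"]) simp
  qed
  from bchoice[OF this] obtain sr where sr: "\<forall>z\<in>N1. fst (sr z) \<in> V\<tau> \<and> snd (sr z) \<in> ?Q \<and>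
      (\<forall>v\<in>V\<tau>. form_a \<nu> \<Omega> (fst (sr z)) v + form_b \<Omega> v (snd (sr z)) = weight z * (g z * (v z \<bullet> n))) \<and>
      (\<forall>q\<in>?Q. form_b \<Omega> (fst (sr z)) q = 0)" ..
  define s where "s z = fst (sr z)" for z
  define r where "r z = snd (sr z)" for z
  have sV: "s z \<in> V\<tau>" and rQ: "r z \<in> ?Q" and s0: "\<And>q. q \<in> ?Q \<Longrightarrow> form_b \<Omega> (s z) q = 0"
    and sr: "\<And>v. v \<in> V\<tau> \<Longrightarrow> form_a \<nu> \<Omega> (s z) v + form_b \<Omega> v (r z) = weight z * (g z * (v z \<bullet> n))" if "z \<in> N1" for z
    using sr that unfolding s_def r_def by blast+
  define S where "S \<mu> = (\<lambda>x. \<Sum>z\<in>N1. \<mu> z *\<^sub>R s z x)" for \<mu> :: "real^2 \<Rightarrow> real"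
  define U where "U \<mu> = (\<lambda>x. u0 x + (-1) *\<^sub>R S \<mu> x)" for \<mu>
  define P where "P \<mu> = (\<lambda>x. p0 x + (\<Sum>z\<in>N1. (- \<mu> z) * r z x))" for \<mu> :: "real^2 \<Rightarrow> real"
  have SV: "S \<mu> \<in> V\<tau>" for \<mu> unfolding S_def by (intro V\<tau>_sum sV)
  have UV: "U \<mu> \<in> V\<tau>" for \<mu> unfolding U_def by (intro V\<tau>_add V\<tau>_scale u0(1) SV)
  have PQ: "P \<mu> \<in> ?Q" for \<mu> unfolding P_def by (intro Q_space_add Q_space_sum u0(2) rQ)
  have aL: "V_linear (\<lambda>u. form_a \<nu> \<Omega> u v)" if "v \<in> V\<tau>" for v by (rule V_linear_form_a[OF V\<tau>_V[OF that]])
  have linS: "L (S \<mu>) = (\<Sum>z\<in>N1. \<mu> z * L (s z))" if "V_linear L" for L \<mu>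
    unfolding S_def by (rule V_linear_sum[OF that finite_N1]) (use sV V\<tau>_V in blast)
  have lin2: "L (\<lambda>x. u x + t *\<^sub>R v x) = L u + t * L v" if L: "V_linear L" "u \<in> V\<tau>" "v \<in> V\<tau>" for L u t v
  proof -
    have "L (\<lambda>x. u x + t *\<^sub>R v x) = L u + L (\<lambda>x. t *\<^sub>R v x)"
      by (rule V_linearD(1)[OF L(1) V\<tau>_V[OF L(2)] V_space_scale[OF V\<tau>_V[OF L(3)]]])
    then show ?thesis using V_linearD(2)[OF L(1) V\<tau>_V[OF L(3)]] by simp
  qed
  have linU: "L (U \<mu>) = L u0 - L (S \<mu>)" if "V_linear L" for L \<mu>
    unfolding U_def lin2[OF that u0(1) SV] by simp
  have a2: "form_a \<nu> \<Omega> (\<lambda>x. u x + t *\<^sub>R v x) (\<lambda>x. u x + t *\<^sub>R v x)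
      = form_a \<nu> \<Omega> u u + t * (2 * form_a \<nu> \<Omega> u v + t * form_a \<nu> \<Omega> v v)" if "u \<in> V\<tau>" "v \<in> V\<tau>" for u v t
  proof -
    have w: "(\<lambda>x. u x + t *\<^sub>R v x) \<in> V\<tau>" by (intro V\<tau>_add V\<tau>_scale that)
    show ?thesis
      unfolding lin2[OF aL[OF w] that] form_a_commute[of \<nu> _ "\<lambda>x. u x + t *\<^sub>R v x"]
        lin2[OF aL[OF that(1)] that] lin2[OF aL[OF that(2)] that] form_a_commute[of \<nu> v u]
      by (simp add: algebra_simps)
  qed
  define F where "F \<mu> = form_a \<nu> \<Omega> (U \<mu>) (U \<mu>)" for \<mu>
  \<comment> \<open>Written as a polynomial in the coordinates of \<mu>, the energy is visibly
    continuous for the product topology.\<close>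
  have F: "F \<mu> = form_a \<nu> \<Omega> u0 u0 - 2 * (\<Sum>z\<in>N1. \<mu> z * form_a \<nu> \<Omega> (s z) u0)
      + (\<Sum>z\<in>N1. \<mu> z * (\<Sum>y\<in>N1. \<mu> y * form_a \<nu> \<Omega> (s y) (s z)))" for \<mu>
  proof -
    have "F \<mu> = form_a \<nu> \<Omega> u0 u0 - 2 * form_a \<nu> \<Omega> (S \<mu>) u0 + form_a \<nu> \<Omega> (S \<mu>) (S \<mu>)"
      unfolding F_def U_def a2[OF u0(1) SV] by (simp add: form_a_commute[of \<nu> u0 "S \<mu>"])
    moreover have "form_a \<nu> \<Omega> (S \<mu>) u0 = (\<Sum>z\<in>N1. \<mu> z * form_a \<nu> \<Omega> (s z) u0)"
      by (rule linS[OF aL[OF u0(1)]])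
    moreover have "form_a \<nu> \<Omega> (S \<mu>) (S \<mu>) = (\<Sum>z\<in>N1. \<mu> z * form_a \<nu> \<Omega> (s z) (S \<mu>))"
      by (rule linS[OF aL[OF SV]])
    moreover have "(\<Sum>z\<in>N1. \<mu> z * form_a \<nu> \<Omega> (s z) (S \<mu>)) = (\<Sum>z\<in>N1. \<mu> z * (\<Sum>y\<in>N1. \<mu> y * form_a \<nu> \<Omega> (s y) (s z)))"
    proof (rule sum.cong[OF refl])
      fix z assume "z \<in> N1"
      have "form_a \<nu> \<Omega> (s z) (S \<mu>) = form_a \<nu> \<Omega> (S \<mu>) (s z)" by (rule form_a_commute)
      also have "\<dots> = (\<Sum>y\<in>N1. \<mu> y * form_a \<nu> \<Omega> (s y) (s z))" by (rule linS[OF aL[OF sV[OF \<open>z \<in> N1\<close>]]])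
      finally show "\<mu> z * form_a \<nu> \<Omega> (s z) (S \<mu>) = \<mu> z * (\<Sum>y\<in>N1. \<mu> y * form_a \<nu> \<Omega> (s y) (s z))" by simp
    qed
    ultimately show ?thesis by simp
  qed
  let ?K = "PiE UNIV (\<lambda>_. {-1..1}) :: (real^2 \<Rightarrow> real) set"
  have coord: "continuous_on ?K (\<lambda>\<mu>. \<mu> z)" for z
    by (rule continuous_on_subset[OF continuous_on_product_coordinates subset_UNIV])
  have cont: "continuous_on ?K F"
    unfolding F[abs_def] by (intro continuous_intros coord)
  have "?K \<noteq> {}" by (auto simp: PiE_eq_empty_iff)
  then obtain \<mu>0 where \<mu>0: "\<mu>0 \<in> ?K" "\<And>\<mu>. \<mu> \<in> ?K \<Longrightarrow> F \<mu>0 \<le> F \<mu>"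
    using continuous_attains_inf[OF compact_cube _ cont] by blast
  have bound: "\<bar>\<mu>0 z\<bar> \<le> 1" for z using \<mu>0(1) by (auto simp: PiE_iff abs_le_iff)
  have div0: "form_b \<Omega> (U \<mu>) q = 0" if q: "q \<in> ?Q" for \<mu> q
    unfolding linU[OF V_linear_form_b[OF q]] linS[OF V_linear_form_b[OF q]] using s0[OF _ q] u0(4)[OF q] by simp
  have VI: "(\<Sum>z\<in>N1. weight z * (g z * (U \<mu>0 z \<bullet> n) * (\<mu> z - \<mu>0 z))) \<le> 0" if \<mu>: "\<And>z. \<bar>\<mu> z\<bar> \<le> 1" for \<mu>
  proof -
    define d where "d z = \<mu> z - \<mu>0 z" for z
    have "0 \<le> - form_a \<nu> \<Omega> (U \<mu>0) (S d)"
    proof (rule slope_nonneg)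
      fix t :: real assume t: "0 < t" "t \<le> 1"
      have "\<mu>0 z + t * d z \<in> {-1..1}" for z
      proof -
        have e: "\<mu>0 z + t * d z = (1 - t) * \<mu>0 z + t * \<mu> z" by (simp add: d_def algebra_simps)
        have "\<bar>(1 - t) * \<mu>0 z + t * \<mu> z\<bar> \<le> (1 - t) * \<bar>\<mu>0 z\<bar> + t * \<bar>\<mu> z\<bar>"
          using t abs_triangle_ineq[of "(1 - t) * \<mu>0 z" "t * \<mu> z"] by (simp add: abs_mult)
        also have "\<dots> \<le> (1 - t) * 1 + t * 1"
          using t bound[of z] \<mu>[of z] by (intro add_mono mult_left_mono) auto
        finally show ?thesis unfolding e by (auto simp: abs_le_iff)
      qed
      then have "(\<lambda>z. \<mu>0 z + t * d z) \<in> ?K" by (simp add: PiE_iff)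
      then have le: "F \<mu>0 \<le> F (\<lambda>z. \<mu>0 z + t * d z)" by (rule \<mu>0(2))
      have "S (\<lambda>z. \<mu>0 z + t * d z) = (\<lambda>x. S \<mu>0 x + t *\<^sub>R S d x)"
        unfolding S_def by (simp add: scaleR_add_left sum.distrib scaleR_sum_right)
      then have "U (\<lambda>z. \<mu>0 z + t * d z) = (\<lambda>x. U \<mu>0 x + (- t) *\<^sub>R S d x)"
        unfolding U_def by (simp add: algebra_simps)
      \<comment> \<open>A change of the multiplier by t d changes the velocity by -t times
        \<open>S d\<close>, which explains the signs of the expansion.\<close>
      then have "F (\<lambda>z. \<mu>0 z + t * d z) = F \<mu>0 + (- t) * (2 * form_a \<nu> \<Omega> (U \<mu>0) (S d) + (- t) * form_a \<nu> \<Omega> (S d) (S d))"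
        unfolding F_def by (simp only: a2[OF UV SV])
      with le have "0 \<le> t * (2 * - form_a \<nu> \<Omega> (U \<mu>0) (S d) + t * form_a \<nu> \<Omega> (S d) (S d))"
        by (simp add: algebra_simps)
      then show "0 \<le> 2 * - form_a \<nu> \<Omega> (U \<mu>0) (S d) + t * form_a \<nu> \<Omega> (S d) (S d)"
        using t(1) by (simp only: zero_le_mult_iff) auto
    qed
    moreover have "form_a \<nu> \<Omega> (U \<mu>0) (S d) = (\<Sum>z\<in>N1. d z * form_a \<nu> \<Omega> (s z) (U \<mu>0))"
      unfolding form_a_commute[of \<nu> "U \<mu>0" "S d"] by (rule linS[OF aL[OF UV]])
    moreover have "(\<Sum>z\<in>N1. d z * form_a \<nu> \<Omega> (s z) (U \<mu>0)) = (\<Sum>z\<in>N1. weight z * (g z * (U \<mu>0 z \<bullet> n) * (\<mu> z - \<mu>0 z)))"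
    proof (rule sum.cong[OF refl])
      fix z assume z: "z \<in> N1"
      \<comment> \<open>The response \<open>s z\<close> is tested with a discretely divergence-free
        velocity, so its pressure drops out and the load at z evaluates the normal velocity
        there.\<close>
      have "form_a \<nu> \<Omega> (s z) (U \<mu>0) = weight z * (g z * (U \<mu>0 z \<bullet> n))"
        using sr[OF z UV] div0[OF rQ[OF z]] by simp
      then show "d z * form_a \<nu> \<Omega> (s z) (U \<mu>0) = weight z * (g z * (U \<mu>0 z \<bullet> n) * (\<mu> z - \<mu>0 z))"
        by (simp add: d_def mult_ac)
    qed
    ultimately show ?thesis by linarith
  qed
  have node: "nodal \<mu>0 z = \<mu>0 z" if "z \<in> N1" for z using nodal_node[of z \<mu>0] that by simp
  have "VE_solution \<Omega> \<Gamma>0 \<Gamma>1 n \<nu> f g \<T> m M (U \<mu>0) (P \<mu>0) (nodal \<mu>0)"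
    unfolding VE_solution_def
  proof (intro conjI ballI UV PQ)
    show "nodal \<mu>0 \<in> Lambda_tilde \<Gamma>1 \<T> m M" by (rule nodal_Lambda_tilde) (rule bound)
    show "form_b \<Omega> (U \<mu>0) q = 0" if "q \<in> ?Q" for q by (rule div0[OF that])
    show "form_a \<nu> \<Omega> (U \<mu>0) v + form_b \<Omega> v (P \<mu>0) + form_Lambda g m M (\<lambda>x. v x \<bullet> n) (nodal \<mu>0) = L2_inner \<Omega> f v"
      if v: "v \<in> V\<tau>" for v
    proof -
      have "form_b \<Omega> v (P \<mu>0) = form_b \<Omega> v p0 + form_b \<Omega> v (\<lambda>x. \<Sum>z\<in>N1. (- \<mu>0 z) * r z x)"
        unfolding P_def by (intro form_b_add V\<tau>_V[OF v] u0(2) Q_space_sum rQ)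
      also have "form_b \<Omega> v (\<lambda>x. \<Sum>z\<in>N1. (- \<mu>0 z) * r z x) = (\<Sum>z\<in>N1. (- \<mu>0 z) * form_b \<Omega> v (r z))"
        by (rule form_b_sum[OF V\<tau>_V[OF v] finite_N1 rQ])
      finally have b: "form_b \<Omega> v (P \<mu>0) = form_b \<Omega> v p0 - (\<Sum>z\<in>N1. \<mu>0 z * form_b \<Omega> v (r z))"
        by (simp add: sum_negf)
      have a: "form_a \<nu> \<Omega> (U \<mu>0) v = form_a \<nu> \<Omega> u0 v - (\<Sum>z\<in>N1. \<mu>0 z * form_a \<nu> \<Omega> (s z) v)"
        unfolding linU[OF aL[OF v]] linS[OF aL[OF v]] ..
      have "(\<Sum>z\<in>N1. weight z * (g z * (v z \<bullet> n) * nodal \<mu>0 z))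
          = (\<Sum>z\<in>N1. \<mu>0 z * form_a \<nu> \<Omega> (s z) v + \<mu>0 z * form_b \<Omega> v (r z))"
      proof (rule sum.cong[OF refl])
        fix z assume z: "z \<in> N1"
        have "\<mu>0 z * form_a \<nu> \<Omega> (s z) v + \<mu>0 z * form_b \<Omega> v (r z) = \<mu>0 z * (weight z * (g z * (v z \<bullet> n)))"
          unfolding sr[OF z v, symmetric] by (simp add: distrib_left)
        then show "weight z * (g z * (v z \<bullet> n) * nodal \<mu>0 z) = \<mu>0 z * form_a \<nu> \<Omega> (s z) v + \<mu>0 z * form_b \<Omega> v (r z)"
          using node[OF z] by (simp add: mult_ac)
      qed
      then show ?thesis unfolding form_Lambda_V[OF v] a b using u0(3)[OF v] by (simp add: sum.distrib)
    qed
    fix \<mu> assume \<mu>: "\<mu> \<in> Lambda_tilde \<Gamma>1 \<T> m M"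
    \<comment> \<open>Only the values at the nodes of \<Gamma>1 are known to be bounded by 1,
      whereas \<open>VI\<close> asks for the bound everywhere; elsewhere the value is therefore set
      to 0.\<close>
    define \<mu>' where "\<mu>' z = (if z \<in> N1 then \<mu> z else 0)" for z
    have "\<bar>\<mu>' z\<bar> \<le> 1" for z using Lambda_tilde_N1[OF \<mu>] by (simp add: \<mu>'_def)
    then have "(\<Sum>z\<in>N1. weight z * (g z * (U \<mu>0 z \<bullet> n) * (\<mu>' z - \<mu>0 z))) \<le> 0" by (rule VI)
    also have "(\<Sum>z\<in>N1. weight z * (g z * (U \<mu>0 z \<bullet> n) * (\<mu>' z - \<mu>0 z)))
        = (\<Sum>z\<in>N1. weight z * (g z * (U \<mu>0 z \<bullet> n) * (\<mu> z - nodal \<mu>0 z)))"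
    proof (rule sum.cong[OF refl])
      fix z assume "z \<in> N1"
      then show "weight z * (g z * (U \<mu>0 z \<bullet> n) * (\<mu>' z - \<mu>0 z))
          = weight z * (g z * (U \<mu>0 z \<bullet> n) * (\<mu> z - nodal \<mu>0 z))"
        using node[of z] by (simp only: \<mu>'_def if_True)
    qed
    finally show "form_Lambda g m M (\<lambda>x. U \<mu>0 x \<bullet> n) (\<lambda>x. \<mu> x - nodal \<mu>0 x) \<le> 0"
      unfolding form_Lambda_V[OF UV] .
  qed
  then show ?thesis by blast
qed

end

subsection \<open>Uniqueness\<close>

context slip_domain
begin

lemma side_cover:
  assumes "x \<in> closed_segment A B"
  obtains i where "i \<in> {1..m}" "x \<in> closed_segment (M i) (M (i + 1))"
proof -
  obtain t where t: "0 \<le> t" "t \<le> 1" "x = pt t" using assms pt_closed by blast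
  have cov: "\<exists>i\<in>{1..k}. pos i \<le> t \<and> t \<le> pos (i + 1)" if "1 \<le> k" "t \<le> pos (k + 1)" for k
    using that
  proof (induction k rule: dec_induct)
    case base
    then show ?case using t pos_ends by auto
  next
    case (step k)
    show ?case
    proof (cases "t \<le> pos (k + 1)")
      case True
      then obtain i where "i \<in> {1..k}" "pos i \<le> t \<and> t \<le> pos (i + 1)" using step.IH by blast
      then show ?thesis by (intro bexI[of _ i]) auto
    next
      case False
      then show ?thesis using step.prems by (intro bexI[of _ "Suc k"]) auto
    qed
  qed
  have "t \<le> pos (m + 1)" using t(2) pos_ends(2) by simp
  from cov[OF m_pos this] obtain i where i: "i \<in> {1..m}" "pos i \<le> t" "t \<le> pos (i + 1)" by blast
  have lt: "pos i < pos (i + 1)" using pos_mono[of i "i + 1"] i(1) by auto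
  have M: "M i = pt (pos i)" "M (i + 1) = pt (pos (i + 1))" using M_at(1)[of i] M_at(1)[of "i + 1"] i(1) by auto
  define s where "s = (t - pos i) / (pos (i + 1) - pos i)"
  have s: "0 \<le> s" "s \<le> 1" "t = (1 - s) * pos i + s * pos (i + 1)"
  proof -
    have "s * (pos (i + 1) - pos i) = t - pos i" using lt by (simp add: s_def)
    then show "t = (1 - s) * pos i + s * pos (i + 1)" by (simp add: algebra_simps)
    show "0 \<le> s" "s \<le> 1" using i lt by (simp_all add: s_def)
  qed
  have "x = (1 - s) *\<^sub>R M i + s *\<^sub>R M (i + 1)"
    unfolding M t(3) pt_def s(3) by (simp add: algebra_simps)
  then have "x \<in> closed_segment (M i) (M (i + 1))" unfolding in_segment using s by blast
  then show ?thesis using that i(1) by blast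
qed

text \<open>On each edge of the side a quadratic is determined by its two ends and its midpoint, all
  of which are nodes of \<Gamma>1 or ends of the side.\<close>

lemma eq_0_on_side:
  assumes poly: "\<And>i. i \<in> {1..m} \<Longrightarrow> poly_on 2 (closed_segment (M i) (M (i + 1))) \<phi>"
    and zero: "\<phi> A = 0" "\<phi> B = 0" "\<And>z. z \<in> N1 \<Longrightarrow> \<phi> z = 0" and x: "x \<in> closed_segment A B"
  shows "\<phi> x = 0"
proof -
  obtain i where i: "i \<in> {1..m}" "x \<in> closed_segment (M i) (M (i + 1))" by (rule side_cover[OF x])
  have M0: "\<phi> (M j) = 0" if "j \<in> {1..m + 1}" for j
    using that zero M_ends M_in_N1[of j] by (cases "j = 1 \<or> j = m + 1") auto
  have e: "\<phi> (M i) = 0" "\<phi> (M (i + 1)) = 0" "\<phi> (midpoint (M i) (M (i + 1))) = 0"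
    using M0 i(1) zero(3) Mhalf_in_N1[OF i(1)] unfolding Mhalf_def by auto
  \<comment> \<open>The segment is treated as a triangle with a repeated vertex; the six
    interpolation points collapse to the two ends and the midpoint.\<close>
  have h: "convex hull {M i, M (i + 1), M (i + 1)} = closed_segment (M i) (M (i + 1))"
    by (simp add: segment_convex_hull)
  show ?thesis
    by (rule poly_on_2_interpolation[of "M i" "M (i + 1)" "M (i + 1)" \<phi> x, unfolded h])
      (use poly[OF i(1)] i(2) e in \<open>simp_all add: midpoint_sym\<close>)
qed

lemma poly_on_normal_component:
  assumes "u \<in> V\<tau>" "i \<in> {1..m}"
  shows "poly_on 2 (closed_segment (M i) (M (i + 1))) (\<lambda>x. u x \<bullet> n)"
proof -
  obtain T where T: "T \<in> \<T>" "closed_segment (M i) (M (i + 1)) \<subseteq> T" using side_edge_cell[OF assms(2)] by blast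
  have "poly_on 2 T (\<lambda>x. u x $ j)" for j using V\<tau>_V[OF assms(1)] T(1) unfolding V_space_def by blast
  then have "poly_on 2 T (\<lambda>x. n $ 1 * u x $ 1 + n $ 2 * u x $ 2)" by (intro poly_on_add poly_on_scale)
  then have "poly_on 2 T (\<lambda>x. u x \<bullet> n)" by (simp add: inner_vec_def sum_2 mult.commute)
  then show ?thesis using T(2) by (rule poly_on_mono)
qed

context
  fixes \<nu> :: real and f :: "real^2 \<Rightarrow> real^2" and g :: "real^2 \<Rightarrow> real"
  assumes \<nu>: "\<nu> > 0" and g: "\<And>x. x \<in> \<Gamma>1 \<Longrightarrow> g x > 0"
begin

abbreviation "sol \<equiv> VE_solution \<Omega> \<Gamma>0 \<Gamma>1 n \<nu> f g \<T> m M"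

lemma sol_space: "sol u p \<eta> \<Longrightarrow> u \<in> V\<tau> \<and> p \<in> Q_space \<Omega> \<T> \<and> \<eta> \<in> Lambda_tilde \<Gamma>1 \<T> m M"
  unfolding VE_solution_def by blast

lemma sol_momentum:
  assumes "sol u p \<eta>" "v \<in> V\<tau>"
  shows "form_a \<nu> \<Omega> u v + form_b \<Omega> v p + (\<Sum>z\<in>N1. weight z * (g z * (v z \<bullet> n) * \<eta> z)) = L2_inner \<Omega> f v"
proof -
  have "form_a \<nu> \<Omega> u v + form_b \<Omega> v p + form_Lambda g m M (\<lambda>x. v x \<bullet> n) \<eta> = L2_inner \<Omega> f v"
    using assms unfolding VE_solution_def by blast
  then show ?thesis unfolding form_Lambda_V[OF assms(2)] .
qed

lemma sol_divergence: "sol u p \<eta> \<Longrightarrow> q \<in> Q_space \<Omega> \<T> \<Longrightarrow> form_b \<Omega> u q = 0"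
  unfolding VE_solution_def by blast

lemma sol_inequality:
  assumes "sol u p \<eta>" "\<And>z. z \<in> N1 \<Longrightarrow> \<bar>\<mu> z\<bar> \<le> 1"
  shows "(\<Sum>z\<in>N1. weight z * (g z * (u z \<bullet> n) * (\<mu> z - \<eta> z))) \<le> 0"
proof -
  have "form_Lambda g m M (\<lambda>x. u x \<bullet> n) (\<lambda>x. nodal \<mu> x - \<eta> x) \<le> 0"
    using assms(1) nodal_Lambda_tilde[of \<mu>, OF assms(2)] unfolding VE_solution_def by blast
  then have "(\<Sum>z\<in>N1. weight z * (g z * (u z \<bullet> n) * (nodal \<mu> z - \<eta> z))) \<le> 0"
    unfolding form_Lambda_V[OF sol_space[OF assms(1), THEN conjunct1]] .
  also have "(\<Sum>z\<in>N1. weight z * (g z * (u z \<bullet> n) * (nodal \<mu> z - \<eta> z)))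
      = (\<Sum>z\<in>N1. weight z * (g z * (u z \<bullet> n) * (\<mu> z - \<eta> z)))"
  proof (rule sum.cong[OF refl])
    fix z assume z: "z \<in> N1"
    then have "nodal \<mu> z = \<mu> z" using nodal_node[of z \<mu>] by simp
    then show "weight z * (g z * (u z \<bullet> n) * (nodal \<mu> z - \<eta> z)) = weight z * (g z * (u z \<bullet> n) * (\<mu> z - \<eta> z))"
      by simp
  qed
  finally show ?thesis .
qed

lemma velocity_unique:
  assumes s: "sol u p \<eta>" and s': "sol u' p' \<eta>'" and x: "x \<in> closure \<Omega>"
  shows "u x = u' x"
proof -
  define w where "w = (\<lambda>x. u x + (-1) *\<^sub>R u' x)"
  have uV: "u \<in> V\<tau>" "u' \<in> V\<tau>" and pQ: "p \<in> Q_space \<Omega> \<T>" "p' \<in> Q_space \<Omega> \<T>"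
    and \<eta>: "\<eta> \<in> Lambda_tilde \<Gamma>1 \<T> m M" "\<eta>' \<in> Lambda_tilde \<Gamma>1 \<T> m M"
    using sol_space[OF s] sol_space[OF s'] by auto
  have w: "w \<in> V\<tau>" unfolding w_def by (intro V\<tau>_add V\<tau>_scale uV)
  have lin: "L w = L u - L u'" if L: "V_linear L" for L
    unfolding w_def V_linearD(1)[OF L V\<tau>_V[OF uV(1)] V_space_scale[OF V\<tau>_V[OF uV(2)]]]
      V_linearD(2)[OF L V\<tau>_V[OF uV(2)]] by simp
  let ?S = "\<lambda>u \<eta>. \<Sum>z\<in>N1. weight z * (g z * (u z \<bullet> n) * \<eta> z)"
  have b: "form_b \<Omega> w p = 0" "form_b \<Omega> w p' = 0"
    using lin[OF V_linear_form_b[OF pQ(1)]] lin[OF V_linear_form_b[OF pQ(2)]]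
      sol_divergence[OF s] sol_divergence[OF s'] pQ by auto
  have "form_a \<nu> \<Omega> u w - form_a \<nu> \<Omega> u' w = - (?S w \<eta> - ?S w \<eta>')"
    using sol_momentum[OF s w] sol_momentum[OF s' w] b by simp
  moreover have "form_a \<nu> \<Omega> w w = form_a \<nu> \<Omega> u w - form_a \<nu> \<Omega> u' w"
    by (rule lin[OF V_linear_form_a[OF V\<tau>_V[OF w]]])
  moreover have "?S u (\<lambda>z. \<eta>' z - \<eta> z) \<le> 0"
    by (rule sol_inequality[OF s]) (use Lambda_tilde_N1[OF \<eta>(2)] in blast)
  moreover have "?S u' (\<lambda>z. \<eta> z - \<eta>' z) \<le> 0"
    by (rule sol_inequality[OF s']) (use Lambda_tilde_N1[OF \<eta>(1)] in blast)
  \<comment> \<open>Each multiplier serves as test function for the other solution. The sum of the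
    two inequalities is exactly the multiplier term in the energy of the difference w.\<close>
  moreover have "?S u (\<lambda>z. \<eta>' z - \<eta> z) + ?S u' (\<lambda>z. \<eta> z - \<eta>' z) = - (?S w \<eta> - ?S w \<eta>')"
    unfolding sum.distrib[symmetric] sum_subtractf[symmetric] sum_negf[symmetric] w_def
    by (intro sum.cong refl) (simp add: inner_diff_left algebra_simps)
  ultimately have "form_a \<nu> \<Omega> w w \<le> 0" by linarith
  then have "form_a \<nu> \<Omega> w w = 0" using form_a_nonneg[OF \<nu>, of \<Omega> w] by linarith
  then have "w x = 0" by (rule korn[OF \<nu> w _ x])
  then show ?thesis by (simp add: w_def)
qed

lemma shift_exists:
  assumes s: "sol u p \<eta>" and s': "sol u p' \<eta>'"
  shows "\<exists>!\<delta>. shift_relation \<Omega> \<Gamma>1 g \<T> p \<eta> p' \<eta>' \<delta>"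
proof -
  define r where "r = (\<lambda>x. p x + (-1) * p' x)"
  have pQ: "p \<in> Q_space \<Omega> \<T>" "p' \<in> Q_space \<Omega> \<T>" using sol_space[OF s] sol_space[OF s'] by auto
  have r: "r \<in> Q_space \<Omega> \<T>" unfolding r_def by (intro Q_space_add Q_space_scale pQ)
  have "form_b \<Omega> v r + (\<Sum>z\<in>N1. weight z * (g z * (v z \<bullet> n) * (\<eta> z - \<eta>' z))) = 0" if v: "v \<in> V\<tau>" for v
  proof -
    have "form_b \<Omega> v r = form_b \<Omega> v p - form_b \<Omega> v p'"
      unfolding r_def form_b_add[OF V\<tau>_V[OF v] pQ(1) Q_space_scale[OF pQ(2)]] form_b_scale by simp
    then show ?thesis
      using sol_momentum[OF s v] sol_momentum[OF s' v] by (simp add: right_diff_distrib sum_subtractf)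
  qed
  then obtain \<delta> where \<delta>: "\<And>x. x \<in> closure \<Omega> \<Longrightarrow> r x = \<delta>" "\<And>z. z \<in> N1 \<Longrightarrow> \<eta> z - \<eta>' z = \<delta> / g z"
    using pressure_multiplier_rigidity[OF r, of g "\<lambda>z. \<eta> z - \<eta>' z"] g by blast
  obtain x where x: "x \<in> closure \<Omega>" using nonempty_domain closure_subset by blast
  show ?thesis
  proof (rule ex1I)
    show "shift_relation \<Omega> \<Gamma>1 g \<T> p \<eta> p' \<eta>' \<delta>"
      unfolding shift_relation_def using \<delta> by (auto simp: r_def algebra_simps)
    show "\<delta>' = \<delta>" if "shift_relation \<Omega> \<Gamma>1 g \<T> p \<eta> p' \<eta>' \<delta>'" for \<delta>'
      using that \<delta>(1)[OF x] x unfolding shift_relation_def by (auto simp: r_def)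
  qed
qed

text \<open>The inequality is tested with a function that differs from the multiplier at the single
  node z and takes the value \<open>sgn (u z \<bullet> n)\<close> there. Together with the bound by
  1 this leaves no other value.\<close>

lemma multiplier_sign:
  assumes s: "sol u p \<eta>" and z: "z \<in> N1" and ne: "u z \<bullet> n \<noteq> 0"
  shows "\<eta> z = sgn (u z \<bullet> n)"
proof -
  have \<eta>: "\<eta> \<in> Lambda_tilde \<Gamma>1 \<T> m M" using sol_space[OF s] by blast
  define \<mu> where "\<mu> y = (if y = z then sgn (u z \<bullet> n) else \<eta> y)" for y
  have "\<bar>\<mu> y\<bar> \<le> 1" if "y \<in> N1" for y
    using Lambda_tilde_N1[OF \<eta> that] by (simp add: \<mu>_def abs_sgn_eq)
  from sol_inequality[OF s, of \<mu>, OF this]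
  have le: "(\<Sum>y\<in>N1. weight y * (g y * (u y \<bullet> n) * (\<mu> y - \<eta> y))) \<le> 0" .
  have "(\<Sum>y\<in>N1. weight y * (g y * (u y \<bullet> n) * (\<mu> y - \<eta> y)))
      = (\<Sum>y\<in>N1. if y = z then weight z * (g z * (u z \<bullet> n) * (sgn (u z \<bullet> n) - \<eta> z)) else 0)"
    by (intro sum.cong refl) (simp add: \<mu>_def)
  with le have "(weight z * g z) * ((u z \<bullet> n) * (sgn (u z \<bullet> n) - \<eta> z)) \<le> 0"
    using z finite_N1 by (simp add: mult.assoc)
  moreover have "weight z * g z > 0" using weight_pos[OF z] g z by simp
  ultimately have le: "(u z \<bullet> n) * (sgn (u z \<bullet> n) - \<eta> z) \<le> 0"
    by (metis mult_le_cancel_left_pos mult_zero_right)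
  have b: "\<bar>\<eta> z\<bar> \<le> 1" by (rule Lambda_tilde_N1[OF \<eta> z])
  show ?thesis
  proof (cases "u z \<bullet> n > 0")
    case True
    then show ?thesis using le b by (simp add: mult_le_0_iff)
  next
    case False
    then have "u z \<bullet> n < 0" using ne by simp
    then show ?thesis using le b by (simp add: mult_le_0_iff)
  qed
qed

text \<open>Piecewise quadratics vanish on the side when they vanish at its nodes, so the normal
  velocity is nonzero at some node. Both multipliers equal its sign there, and their difference
  \<delta>/g is 0.\<close>

lemma shift_zero:
  assumes s: "sol u p \<eta>" and s': "sol u p' \<eta>'" and ne: "x \<in> \<Gamma>1" "u x \<bullet> n \<noteq> 0"
    and sh: "shift_relation \<Omega> \<Gamma>1 g \<T> p \<eta> p' \<eta>' \<delta>"
  shows "\<delta> = 0"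
proof -
  have u: "u \<in> V\<tau>" using sol_space[OF s] by blast
  have "\<exists>z\<in>N1. u z \<bullet> n \<noteq> 0"
  proof (rule ccontr)
    assume "\<not> (\<exists>z\<in>N1. u z \<bullet> n \<noteq> 0)"
    then have "u x \<bullet> n = 0"
      using eq_0_on_side[of "\<lambda>x. u x \<bullet> n" x] poly_on_normal_component[OF u] V\<tau>_corner[OF u]
        ne(1) closure_\<Gamma>1 closure_subset[of \<Gamma>1] by auto
    then show False using ne(2) by simp
  qed
  then obtain z where z: "z \<in> N1" "u z \<bullet> n \<noteq> 0" by blast
  have "\<eta> z = \<eta>' z + \<delta> / g z" using sh z(1) unfolding shift_relation_def by blast
  then have "\<delta> / g z = 0" using multiplier_sign[OF s z] multiplier_sign[OF s' z] by simp
  then show ?thesis using g[of z] z(1) by simp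
qed

lemma solution_unique:
  assumes s: "sol u p \<eta>" and s': "sol u' p' \<eta>'" and ne: "x0 \<in> \<Gamma>1" "u x0 \<bullet> n \<noteq> 0"
  shows "x \<in> closure \<Omega> \<Longrightarrow> u x = u' x \<and> p x = p' x" and "x \<in> closure \<Gamma>1 \<Longrightarrow> \<eta> x = \<eta>' x"
proof -
  have uu: "u x = u' x" if "x \<in> closure \<Omega>" for x by (rule velocity_unique[OF s s' that])
  have uV: "u \<in> V\<tau>" "u' \<in> V\<tau>" using sol_space[OF s] sol_space[OF s'] by auto
  have cong: "L u = L u'" if "V_linear L" for L
    by (rule V_linearD(3)[OF that V\<tau>_V[OF uV(1)] uu])
  have node: "u z = u' z" if "z \<in> N1" for z using uu nodes_subset that by blast
  \<comment> \<open>The two velocities agree only on the closure of \<Omega>, while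
    \<open>shift_exists\<close> and \<open>shift_zero\<close> compare solutions with literally the
    same velocity function. The second solution is therefore transferred to u.\<close>
  have "sol u p' \<eta>'"
    unfolding VE_solution_def form_Lambda_V[OF uV(1)]
  proof (intro conjI ballI)
    show "u \<in> V\<tau>" "p' \<in> Q_space \<Omega> \<T>" "\<eta>' \<in> Lambda_tilde \<Gamma>1 \<T> m M"
      using uV(1) sol_space[OF s'] by auto
    show "form_a \<nu> \<Omega> u v + form_b \<Omega> v p' + form_Lambda g m M (\<lambda>x. v x \<bullet> n) \<eta>' = L2_inner \<Omega> f v"
      if v: "v \<in> V\<tau>" for v
      using s' v cong[OF V_linear_form_a[OF V\<tau>_V[OF v]]] unfolding VE_solution_def by simp
    show "form_b \<Omega> u q = 0" if q: "q \<in> Q_space \<Omega> \<T>" for q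
      using sol_divergence[OF s' q] cong[OF V_linear_form_b[OF q]] by simp
    show "(\<Sum>z\<in>N1. weight z * (g z * (u z \<bullet> n) * (\<mu> z - \<eta>' z))) \<le> 0" if \<mu>: "\<mu> \<in> Lambda_tilde \<Gamma>1 \<T> m M" for \<mu>
    proof -
      have "(\<Sum>z\<in>N1. weight z * (g z * (u z \<bullet> n) * (\<mu> z - \<eta>' z)))
          = (\<Sum>z\<in>N1. weight z * (g z * (u' z \<bullet> n) * (\<mu> z - \<eta>' z)))"
        by (rule sum.cong[OF refl]) (simp only: node)
      also have "\<dots> \<le> 0" by (rule sol_inequality[OF s']) (rule Lambda_tilde_N1[OF \<mu>])
      finally show ?thesis .
    qed
  qed
  then obtain \<delta> where \<delta>: "shift_relation \<Omega> \<Gamma>1 g \<T> p \<eta> p' \<eta>' \<delta>" using shift_exists[OF s] by blast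
  then have "\<delta> = 0" using shift_zero[OF s \<open>sol u p' \<eta>'\<close> ne] by blast
  with \<delta> have eq: "\<And>x. x \<in> closure \<Omega> \<Longrightarrow> p x = p' x" "\<And>z. z \<in> N1 \<Longrightarrow> \<eta> z = \<eta>' z"
    unfolding shift_relation_def by auto
  then show "x \<in> closure \<Omega> \<Longrightarrow> u x = u' x \<and> p x = p' x" using uu by blast
  assume x: "x \<in> closure \<Gamma>1"
  have L: "\<eta> \<in> Lambda_space \<Gamma>1 m M" "\<eta>' \<in> Lambda_space \<Gamma>1 m M"
    using sol_space[OF s] sol_space[OF s'] unfolding Lambda_tilde_def by auto
  have "\<eta> x + (-1) * \<eta>' x = 0"
  proof (rule eq_0_on_side[of "\<lambda>x. \<eta> x + (-1) * \<eta>' x"])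
    show "poly_on 2 (closed_segment (M i) (M (i + 1))) (\<lambda>x. \<eta> x + (-1) * \<eta>' x)" if "i \<in> {1..m}" for i
      using L that unfolding Lambda_space_def by (intro poly_on_add poly_on_scale) blast+
    show "\<eta> A + (-1) * \<eta>' A = 0" "\<eta> B + (-1) * \<eta>' B = 0"
      using L M_ends unfolding Lambda_space_def by auto
    show "\<eta> z + (-1) * \<eta>' z = 0" if "z \<in> N1" for z using eq(2)[OF that] by simp
    show "x \<in> closed_segment A B" using x closure_\<Gamma>1 by simp
  qed
  then show "\<eta> x = \<eta>' x" by simp
qed

end

end

text \<open>The last conjunct expresses uniqueness of the triple as equality on the closures of
  \<Omega> and \<Gamma>1, since total functions may differ arbitrarily elsewhere.\<close>

theorem theorem5p2:
  fixes \<Omega> \<Gamma>0 \<Gamma>1 :: "(real^2) set" and Ps :: "(real^2) list set" and A B n :: "real^2"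
    and \<nu> :: real and f :: "real^2 \<Rightarrow> real^2" and g :: "real^2 \<Rightarrow> real"
    and H :: "real set" and \<T> :: "real \<Rightarrow> (real^2) set set"
    and h :: real and m :: nat and M :: "nat \<Rightarrow> real^2"
  assumes "polygonal_domain \<Omega> Ps"
    and "boundary_partition \<Omega> Ps \<Gamma>0 \<Gamma>1 A B"
    and "outer_unit_normal \<Omega> A B n"
    and "\<nu> > 0"
    and "L2_vec \<Omega> f"
    and "continuous_on (closure \<Gamma>1) g"
    and "\<forall>x\<in>\<Gamma>1. g x > 0"
    and "mesh_family \<Omega> H \<T>"
    and "h \<in> H"
    and "side_nodes (\<T> h) \<Gamma>1 A B m M"
  defines "sol \<equiv> VE_solution \<Omega> \<Gamma>0 \<Gamma>1 n \<nu> f g (\<T> h) m M"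
  shows
    "((\<exists>u p \<eta>. sol u p \<eta>) \<and>
      (\<forall>u p \<eta> u' p' \<eta>'. sol u p \<eta> \<and> sol u' p' \<eta>' \<longrightarrow> (\<forall>x\<in>closure \<Omega>. u x = u' x))) \<and>
     (\<forall>u p \<eta> p' \<eta>'. sol u p \<eta> \<and> sol u p' \<eta>' \<longrightarrow>
        (\<exists>!\<delta>. shift_relation \<Omega> \<Gamma>1 g (\<T> h) p \<eta> p' \<eta>' \<delta>)) \<and>
     (\<forall>u p \<eta> p' \<eta>'. sol u p \<eta> \<and> sol u p' \<eta>' \<and> (\<exists>x\<in>\<Gamma>1. u x \<bullet> n \<noteq> 0) \<longrightarrow>
        (\<forall>\<delta>. shift_relation \<Omega> \<Gamma>1 g (\<T> h) p \<eta> p' \<eta>' \<delta> \<longrightarrow> \<delta> = 0)) \<and>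
     (\<forall>u p \<eta> u' p' \<eta>'. sol u p \<eta> \<and> sol u' p' \<eta>' \<and> (\<exists>x\<in>\<Gamma>1. u x \<bullet> n \<noteq> 0) \<longrightarrow>
        (\<forall>x\<in>closure \<Omega>. u x = u' x \<and> p x = p' x) \<and> (\<forall>x\<in>closure \<Gamma>1. \<eta> x = \<eta>' x))"
proof -
  have mesh: "mesh_of \<Omega> (\<T> h)" using assms(8,9) unfolding mesh_family_def by blast
  interpret slip_domain \<Omega> "\<T> h" \<Gamma>0 \<Gamma>1 Ps A B n m M
    by unfold_locales (use assms(1,2,3,10) mesh in \<open>auto simp: polygonal_domain_def\<close>)
  have g: "\<And>x. x \<in> \<Gamma>1 \<Longrightarrow> g x > 0" using assms(7) by blast
  note \<nu> = assms(4)
  show ?thesis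
    unfolding sol_def
  proof (intro conjI allI impI ballI)
    show "\<exists>u p \<eta>. VE_solution \<Omega> \<Gamma>0 \<Gamma>1 n \<nu> f g (\<T> h) m M u p \<eta>"
      by (rule solution_exists[OF \<nu> assms(5)])
  next
    fix u p \<eta> u' p' \<eta>' x
    assume "VE_solution \<Omega> \<Gamma>0 \<Gamma>1 n \<nu> f g (\<T> h) m M u p \<eta> \<and> VE_solution \<Omega> \<Gamma>0 \<Gamma>1 n \<nu> f g (\<T> h) m M u' p' \<eta>'"
      and x: "x \<in> closure \<Omega>"
    then show "u x = u' x" using velocity_unique[where g = g, OF \<nu> g _ _ x] by blast
  next
    fix u p \<eta> p' \<eta>'
    assume "VE_solution \<Omega> \<Gamma>0 \<Gamma>1 n \<nu> f g (\<T> h) m M u p \<eta> \<and> VE_solution \<Omega> \<Gamma>0 \<Gamma>1 n \<nu> f g (\<T> h) m M u p' \<eta>'"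
    then show "\<exists>!\<delta>. shift_relation \<Omega> \<Gamma>1 g (\<T> h) p \<eta> p' \<eta>' \<delta>" using shift_exists[where g = g, OF \<nu> g] by blast
  next
    fix u p \<eta> p' \<eta>' \<delta>
    assume "VE_solution \<Omega> \<Gamma>0 \<Gamma>1 n \<nu> f g (\<T> h) m M u p \<eta> \<and> VE_solution \<Omega> \<Gamma>0 \<Gamma>1 n \<nu> f g (\<T> h) m M u p' \<eta>' \<and>
      (\<exists>x\<in>\<Gamma>1. u x \<bullet> n \<noteq> 0)" and "shift_relation \<Omega> \<Gamma>1 g (\<T> h) p \<eta> p' \<eta>' \<delta>"
    then show "\<delta> = 0" using shift_zero[where g = g, OF \<nu> g] by blast
  next
    fix u p \<eta> u' p' \<eta>' x
    assume a: "VE_solution \<Omega> \<Gamma>0 \<Gamma>1 n \<nu> f g (\<T> h) m M u p \<eta> \<and> VE_solution \<Omega> \<Gamma>0 \<Gamma>1 n \<nu> f g (\<T> h) m M u' p' \<eta>' \<and>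
      (\<exists>x\<in>\<Gamma>1. u x \<bullet> n \<noteq> 0)"
    then obtain x0 where x0: "x0 \<in> \<Gamma>1" "u x0 \<bullet> n \<noteq> 0" by blast
    note un = solution_unique[where g = g, OF \<nu> g a[THEN conjunct1] a[THEN conjunct2, THEN conjunct1] x0]
    show "u x = u' x" "p x = p' x" if "x \<in> closure \<Omega>" using un(1)[OF _ that] by auto
    show "\<eta> x = \<eta>' x" if "x \<in> closure \<Gamma>1" using un(2)[OF _ that] by simp
  qed
qed

end
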